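(* Let $K$ be any algebraically closed field of characteristic $0$ and let $A\subset\mathbb{Z}^n$ have cardinality at most $n+2$ and be such that no $n+1$ points of $A$ lie in a hyperplane. Suppose $f_1,\ldots,f_n\in K[x_1,\ldots,x_n]$ have supports contained in $A$ and that, with $F:=(f_1,\ldots,f_n)$, the set $Z^*_K(F)$ is finite. Then the intersection multiplicity of any point of $Z^*_K(F)$ is at most $n+1$ when $\#A=n+2$, and at most $1$ when $\#A=n+1$; and both bounds are sharp.
   Context: The support of a polynomial is the set of exponent vectors of its monomial terms. $Z^*_K(F)$ is the set of common roots of $f_1,\ldots,f_n$ in $(K\setminus\{0\})^n$. Hyperplanes are affine hyperplanes in $\mathbb{R}^n$. Intersection multiplicity is the classical one from commutative algebra: for an isolated common root $\zeta$, the $K$-dimension of the local ring at $\zeta$ modulo the ideal generated by $f_1,\ldots,f_n$. *)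

theory Defs
  imports
    "HOL-Analysis.Analysis"
    "HOL-Library.Poly_Mapping"
    "HOL-Computational_Algebra.Fraction_Field"
    "HOL-Algebra.QuotRing"
    "HOL-Algebra.Embedded_Algebras"
begin

text \<open>
  The index type \<open>'n\<close> of the variables is finite with \<open>n = CARD('n) \<ge> 1\<close>. The order
  on \<open>'n\<close> is used only because the library's instance making finitely supported
  functions an integral domain, which the fraction field needs, asks for linearly
  ordered exponents; none of the notions below depends on it.
\<close>

type_synonym ('n, 'k) mpoly = "('n \<Rightarrow>\<^sub>0 nat) \<Rightarrow>\<^sub>0 'k"

definition mpoly_const :: "'k \<Rightarrow> ('n, 'k::zero) mpoly"
  where "mpoly_const c = Poly_Mapping.single 0 c"

definition mpoly_eval :: "('n::finite, 'k::comm_semiring_1) mpoly \<Rightarrow> 'k ^ 'n::finite \<Rightarrow> 'k"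
  where "mpoly_eval p z =
    (\<Sum>m\<in>Poly_Mapping.keys p.
       Poly_Mapping.lookup p m * (\<Prod>i\<in>UNIV. (z $ i) ^ Poly_Mapping.lookup m i))"

text \<open>The support, viewed inside the integer lattice.\<close>

definition mpoly_support :: "('n::finite, 'k::zero) mpoly \<Rightarrow> (int ^ 'n::finite) set"
  where "mpoly_support p =
    (\<lambda>m. \<chi> i. int (Poly_Mapping.lookup m i)) ` Poly_Mapping.keys p"

definition torus_zeros :: "('n::finite \<Rightarrow> ('n, 'k::comm_semiring_1) mpoly) \<Rightarrow> ('k ^ 'n::finite) set"
  where "torus_zeros F = {z. (\<forall>i. z $ i \<noteq> 0) \<and> (\<forall>j. mpoly_eval (F j) z = 0)}"

definition real_point :: "int ^ 'n::finite \<Rightarrow> real ^ 'n::finite"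
  where "real_point a = (\<chi> i. real_of_int (a $ i))"

definition affine_hyperplane :: "(real ^ 'n::finite) set \<Rightarrow> bool"
  where "affine_hyperplane H \<longleftrightarrow> (\<exists>v b. v \<noteq> 0 \<and> H = {x. v \<bullet> x = b})"

definition no_hyperplane_subset :: "(int ^ 'n::finite) set \<Rightarrow> bool"
  where "no_hyperplane_subset A \<longleftrightarrow>
    \<not> (\<exists>S H. S \<subseteq> A \<and> card S = CARD('n) + 1 \<and> affine_hyperplane H \<and> real_point ` S \<subseteq> H)"

text \<open>
  The local ring at \<open>z\<close>: the localization of the polynomial ring at the maximal ideal
  of \<open>z\<close>, realized inside the field of rational functions.
\<close>

definition local_ring ::
  "'k ^ 'n::{finite,linorder} \<Rightarrow> ('n, 'k::field) mpoly fract ring"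
  where "local_ring z =
    \<lparr>carrier = {Fract p q | p q. mpoly_eval q z \<noteq> 0},
     monoid.mult = (*), one = 1, ring.zero = 0, add = (+)\<rparr>"

definition local_ideal ::
  "('n::{finite,linorder} \<Rightarrow> ('n, 'k::field) mpoly) \<Rightarrow> 'k ^ 'n::{finite,linorder} \<Rightarrow> ('n, 'k) mpoly fract set"
  where "local_ideal F z = Idl\<^bsub>local_ring z\<^esub> (range (\<lambda>j. Fract (F j) 1))"

definition local_quotient ::
  "('n::{finite,linorder} \<Rightarrow> ('n, 'k::field) mpoly) \<Rightarrow> 'k ^ 'n::{finite,linorder} \<Rightarrow> ('n, 'k) mpoly fract set ring"
  where "local_quotient F z = local_ring z Quot local_ideal F z"

text \<open>The copy of the base field \<open>K\<close> inside the quotient.\<close>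

definition local_constants ::
  "('n::{finite,linorder} \<Rightarrow> ('n, 'k::field) mpoly) \<Rightarrow> 'k ^ 'n::{finite,linorder} \<Rightarrow> ('n, 'k) mpoly fract set set"
  where "local_constants F z =
    range (\<lambda>c. local_ideal F z +>\<^bsub>local_ring z\<^esub> Fract (mpoly_const c) 1)"

definition intersection_multiplicity ::
  "('n::{finite,linorder} \<Rightarrow> ('n, 'k::field) mpoly) \<Rightarrow> 'k ^ 'n::{finite,linorder} \<Rightarrow> enat"
  where "intersection_multiplicity F z =
    (let Q = local_quotient F z; K = local_constants F z in
     if ring.finite_dimension Q K (carrier Q) then enat (ring.dim Q K (carrier Q)) else \<infinity>)"

end

theory Submission
  imports Defs
begin

text \<open>
  Write \<open>n\<close> for the number of variables. The proof replaces the system by one equation in one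
  variable. Read \<open>F\<close> as a linear system in the monomials \<open>x\<^sup>a\<close>, \<open>a \<in> A\<close>, with \<open>n\<close> rows.
  Elimination (\<open>gaussian_elimination\<close>) leaves a set \<open>B \<subseteq> A\<close> of at least \<open>card A - n\<close> free
  monomials and expresses every \<open>x\<^sup>a\<close> modulo the ideal as a linear combination of them. Fix
  \<open>b \<in> B\<close> and divide by \<open>x\<^sup>b\<close>. The lattice vectors \<open>a - b\<close> span a lattice of finite index, so
  the values of the monomials \<open>x\<^sup>a\<^sup>-\<^sup>b\<close> determine the coordinates up to roots of unity; near
  a given zero \<open>z\<close>, in characteristic 0, they determine the coordinates outright
  (\<open>monomials_determine_coordinates\<close>).

  With one free monomial every \<open>x\<^sup>a\<^sup>-\<^sup>b\<close> is constant modulo the ideal, so the local quotient is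
  \<open>K\<close> and the multiplicity is 1. With two free monomials \<open>x\<^sup>b\<close> and \<open>x\<^sup>c\<close> put
  \<open>s = x\<^sup>c\<^sup>-\<^sup>b - z\<^sup>c\<^sup>-\<^sup>b\<close>. Then every \<open>x\<^sup>a\<^sup>-\<^sup>b\<close> is a linear polynomial \<open>v\<^sub>a + g\<^sub>a s\<close> in \<open>s\<close>,
  and \<open>s\<close> generates the local quotient as a \<open>K\<close>-algebra. An integer relation
  \<open>\<Sum> e\<^sub>a (a - b) = 0\<close> turns into the equation \<open>\<Prod> (v\<^sub>a + g\<^sub>a s)\<^sup>e\<^sup>a = 1\<close>. The logarithmic
  derivative of the left-hand side has a numerator of degree at most \<open>n\<close> when \<open>card A = n + 2\<close>, so
  unless the equation is an identity, its solution \<open>s = 0\<close> has order at most \<open>n + 1\<close>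
  (\<open>prod_power_diff_order_bound\<close>). That bounds the dimension of the local quotient.

  All other cases contradict the finiteness of the zero set. Nonzero values that are assigned to
  the monomials \<open>x\<^sup>a\<^sup>-\<^sup>b\<close> come from a point of the torus as soon as they satisfy all integer
  relations between the vectors \<open>a - b\<close>, because the multiplicative group of an algebraically closed
  field is divisible (\<open>torus_point_exists\<close>). If all relations are identities in \<open>s\<close>, this yields a
  one-parameter family of zeros. If three monomials are free, the relations are the multiples of
  a single one, which cuts a curve out of a plane of candidates; infinitely many points of that
  curve have no vanishing coordinate (\<open>infinitely_many_zeros_off_lines\<close>).

  For sharpness the circuit \<open>\<Prod> (1 + i s)\<^sup>e\<^sup>i = 1\<close>, \<open>e\<^sub>i = \<plusminus> (n + 1 choose i)\<close>, attains the order
  \<open>n + 1\<close>, because the logarithmic derivative of its left-hand side has the numerator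
  \<open>\<plusminus> (n + 1)! s\<^sup>n\<close> (\<open>binomial_partial_fraction\<close>).
  Restricting to the line \<open>x\<^sub>j = 1 + j s\<close> shows that the powers of \<open>s\<close> up to the \<open>n\<close>-th are linearly
  independent in the local quotient (\<open>local_dimension_ge\<close>).
\<close>

section \<open>Products of powers of linear polynomials\<close>

text \<open>
  The logarithmic derivative of a product of powers, with denominators cleared. The factor \<open>\<Prod> w\<close> makes
  the identity one between polynomials, so that the cases \<open>k a = 0\<close> need no special treatment.
\<close>
lemma pderiv_prod_power_times_prod:
  fixes w :: "'i \<Rightarrow> 'a::idom poly"
  assumes "finite I"
  shows "pderiv (\<Prod>a\<in>I. w a ^ k a) * (\<Prod>a\<in>I. w a) =
    (\<Prod>a\<in>I. w a ^ k a) * (\<Sum>a\<in>I. of_nat (k a) * pderiv (w a) * (\<Prod>b\<in>I-{a}. w b))"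
  using assms
proof (induction I)
  case empty
  then show ?case by simp
next
  case (insert x F)
  let ?P = "\<Prod>a\<in>F. w a ^ k a" and ?W = "\<Prod>a\<in>F. w a"
  let ?S = "\<Sum>a\<in>F. of_nat (k a) * pderiv (w a) * (\<Prod>b\<in>F-{a}. w b)"
  have S: "(\<Sum>a\<in>F. of_nat (k a) * pderiv (w a) * (\<Prod>b\<in>insert x F-{a}. w b)) = w x * ?S"
    unfolding sum_distrib_left
  proof (rule sum.cong)
    fix a assume "a \<in> F"
    then have "insert x F - {a} = insert x (F - {a})" using insert by auto
    then show "of_nat (k a) * pderiv (w a) * (\<Prod>b\<in>insert x F-{a}. w b) =
        w x * (of_nat (k a) * pderiv (w a) * (\<Prod>b\<in>F-{a}. w b))"
      using insert by (simp add: algebra_simps)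
  qed simp
  have R: "insert x F - {x} = F" using insert by auto
  have pw: "pderiv (w x ^ k x) * w x = of_nat (k x) * pderiv (w x) * w x ^ k x"
  proof (cases "k x")
    case (Suc m)
    show ?thesis unfolding Suc pderiv_power_Suc by (simp add: of_nat_poly algebra_simps)
  qed simp
  have "pderiv (\<Prod>a\<in>insert x F. w a ^ k a) * (\<Prod>a\<in>insert x F. w a) =
     (pderiv (w x ^ k x) * w x) * ?P * ?W + w x ^ k x * w x * (pderiv ?P * ?W)"
    using insert by (simp add: pderiv_mult algebra_simps)
  also have "\<dots> = (w x ^ k x * ?P) * (of_nat (k x) * pderiv (w x) * ?W + w x * ?S)"
    unfolding pw insert.IH by (simp add: algebra_simps)
  also have "\<dots> = (\<Prod>a\<in>insert x F. w a ^ k a) * (\<Sum>a\<in>insert x F. of_nat (k a) * pderiv (w a) * (\<Prod>b\<in>insert x F-{a}. w b))"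
    using insert S R by simp
  finally show ?case .
qed

text \<open>
  The two sides of \<open>\<Prod> w\<^sup>e = 1\<close> are split by the sign of the integer exponents. The last sum is the
  numerator of the logarithmic derivative of \<open>\<Prod> w\<^sup>e\<close>; everything else is divisible by \<open>P - Q\<close> itself,
  which is why the order of \<open>P - Q\<close> at a zero is governed by that numerator.
\<close>
lemma pderiv_prod_power_diff:
  fixes w :: "'i \<Rightarrow> 'a::idom poly" and e :: "'i \<Rightarrow> int"
  assumes "finite I"
  defines "P \<equiv> \<Prod>a\<in>I. w a ^ nat (e a)" and "Q \<equiv> \<Prod>a\<in>I. w a ^ nat (- e a)"
  shows "pderiv (P - Q) * (\<Prod>a\<in>I. w a) =
    (P - Q) * (\<Sum>a\<in>I. of_nat (nat (e a)) * pderiv (w a) * (\<Prod>b\<in>I-{a}. w b)) +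
    Q * (\<Sum>a\<in>I. of_int (e a) * pderiv (w a) * (\<Prod>b\<in>I-{a}. w b))"
proof -
  have e: "(of_int (e a) :: 'a poly) = of_nat (nat (e a)) - of_nat (nat (- e a))" for a
    by (cases "e a \<ge> 0") auto
  show ?thesis
    unfolding pderiv_diff left_diff_distrib P_def Q_def
      pderiv_prod_power_times_prod[OF assms(1)] e sum_subtractf right_diff_distrib
    by simp
qed

lemma X_power_dvd_mult_cancel:
  fixes p q :: "'a::idom poly"
  assumes "[:0, 1:] ^ k dvd p * q" "poly q 0 \<noteq> 0"
  shows "[:0, 1:] ^ k dvd p"
proof (cases "p = 0")
  case False
  have "q \<noteq> 0" using assms by auto
  then have "k \<le> Polynomial.order 0 (p * q)"
    using assms(1) False order_divides[of 0 k "p * q"] by simp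
  also have "\<dots> = Polynomial.order 0 p"
    using False \<open>q \<noteq> 0\<close> assms(2) by (simp add: order_mult order_root)
  finally show ?thesis using order_divides[of 0 k p] by simp
qed simp

lemma X_power_dvd_pderiv:
  fixes p :: "'a::idom poly"
  assumes "[:0, 1:] ^ Suc k dvd p"
  shows "[:0, 1:] ^ k dvd pderiv p"
proof -
  from assms obtain q where q: "p = [:0, 1:] ^ Suc k * q" by (elim dvdE)
  have "pderiv p = [:0, 1:] ^ k * ([:0, 1:] * pderiv q + Polynomial.smult (of_nat (Suc k)) q)"
    unfolding q pderiv_mult pderiv_power_Suc pderiv_pCons
    by (simp add: distrib_left mult_ac one_pCons[symmetric] del: of_nat_Suc mult_pCons_left mult_pCons_right)
  then show ?thesis by (rule dvdI)
qed

lemma X_power_not_dvd_pderiv: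
  fixes p :: "'a::field_char_0 poly"
  assumes "p \<noteq> 0" "poly p 0 = 0"
  shows "\<not> [:0, 1:] ^ Polynomial.order 0 p dvd pderiv p"
proof -
  have o: "Polynomial.order 0 p \<noteq> 0" using assms order_root by blast
  have "pderiv p \<noteq> 0"
  proof
    assume "pderiv p = 0"
    then obtain h where "p = [:h:]" using pderiv_iszero by blast
    with assms show False by simp
  qed
  with o show ?thesis
    using order_divides[of 0 "Polynomial.order 0 p" "pderiv p"] order_pderiv[OF assms] \<open>pderiv p \<noteq> 0\<close> by auto
qed

text \<open>
  If \<open>P - Q\<close> vanishes to order above \<open>card I\<close> at 0, then the numerator \<open>S\<close> of the logarithmic
  derivative of \<open>P / Q\<close> vanishes to order at least \<open>card I\<close>. Its degree is at most \<open>card I - 1\<close>, so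
  \<open>S = 0\<close>. Then \<open>P / Q\<close> is a constant in characteristic 0, and its value at 0 is 1.
\<close>
lemma prod_power_diff_order_bound:
  fixes v g :: "'i \<Rightarrow> 'a::field_char_0" and e :: "'i \<Rightarrow> int"
  assumes I: "finite I" and v: "\<And>a. a \<in> I \<Longrightarrow> v a \<noteq> 0"
  defines "P \<equiv> \<Prod>a\<in>I. [:v a, g a:] ^ nat (e a)" and "Q \<equiv> \<Prod>a\<in>I. [:v a, g a:] ^ nat (- e a)"
  assumes dvd: "[:0, 1:] ^ Suc (card I) dvd P - Q"
  shows "P = Q"
proof (rule ccontr)
  assume "P \<noteq> Q"
  define w where "w = (\<lambda>a. [:v a, g a:])"
  define S1 where "S1 = (\<Sum>a\<in>I. of_nat (nat (e a)) * pderiv (w a) * (\<Prod>b\<in>I-{a}. w b))"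
  define S where "S = (\<Sum>a\<in>I. of_int (e a) * pderiv (w a) * (\<Prod>b\<in>I-{a}. w b))"
  let ?X = "[:0, 1:] :: 'a poly"
  have main: "pderiv (P - Q) * (\<Prod>a\<in>I. w a) = (P - Q) * S1 + Q * S"
    unfolding P_def Q_def S_def S1_def w_def by (rule pderiv_prod_power_diff[OF I])
  have "?X ^ card I dvd P - Q" using dvd by (rule dvd_trans[rotated]) (intro le_imp_power_dvd, simp)
  moreover have "?X ^ card I dvd pderiv (P - Q)" using dvd by (rule X_power_dvd_pderiv)
  ultimately have "?X ^ card I dvd pderiv (P - Q) * (\<Prod>a\<in>I. w a) - (P - Q) * S1"
    by (rule dvd_diff[OF dvd_mult2 dvd_mult2, rotated])
  then have "?X ^ card I dvd S * Q" unfolding main by (simp add: mult.commute)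
  moreover have "poly Q 0 \<noteq> 0" unfolding Q_def using v I by (simp add: poly_prod)
  ultimately have XS: "?X ^ card I dvd S" by (rule X_power_dvd_mult_cancel)
  have "S = 0"
  proof (cases "I = {}")
    case True
    then show ?thesis by (simp add: S_def)
  next
    case False
    have "Polynomial.degree S \<le> card I - 1"
      unfolding S_def
    proof (rule degree_sum_le[OF I])
      fix a assume a: "a \<in> I"
      have "Polynomial.degree (\<Prod>b\<in>I-{a}. w b) \<le> (\<Sum>b\<in>I-{a}. Polynomial.degree (w b))"
        using I degree_prod_sum_le[of "I - {a}" w] by (simp add: o_def)
      also have "\<dots> \<le> (\<Sum>b\<in>I-{a}. 1)" by (intro sum_mono) (simp add: w_def)
      also have "\<dots> = card I - 1" using a I by simp
      finally have 1: "Polynomial.degree (\<Prod>b\<in>I-{a}. w b) \<le> card I - 1" .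
      have 2: "of_int (e a) * pderiv (w a) = [:of_int (e a) * g a:]"
        by (simp add: w_def pderiv_pCons of_int_poly)
      show "Polynomial.degree (of_int (e a) * pderiv (w a) * (\<Prod>b\<in>I-{a}. w b)) \<le> card I - 1"
        unfolding 2 using 1 order.trans[OF degree_smult_le 1] by simp
    qed
    moreover have "Polynomial.degree (?X ^ card I) = card I" by (simp add: degree_power_eq)
    moreover have "card I > 0" using False I by (simp add: card_gt_0_iff)
    ultimately show ?thesis using dvd_imp_degree_le[OF XS] by (cases "S = 0") linarith+
  qed
  \<comment> \<open>Differentiation lowers the order at 0 by exactly one, so \<open>P - Q\<close> cannot divide its own derivative there.\<close>
  then have "pderiv (P - Q) * (\<Prod>a\<in>I. w a) = (P - Q) * S1" using main by simp
  moreover have "?X ^ Polynomial.order 0 (P - Q) dvd P - Q"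
    using order_divides[of 0 _ "P - Q"] by simp
  ultimately have "?X ^ Polynomial.order 0 (P - Q) dvd pderiv (P - Q) * (\<Prod>a\<in>I. w a)"
    by (simp add: dvd_mult2)
  moreover have "poly (\<Prod>a\<in>I. w a) 0 \<noteq> 0" using I v by (simp add: poly_prod w_def)
  ultimately have "?X ^ Polynomial.order 0 (P - Q) dvd pderiv (P - Q)"
    by (rule X_power_dvd_mult_cancel)
  moreover have "poly (P - Q) 0 = 0"
  proof -
    obtain q where q: "P - Q = ?X ^ Suc (card I) * q" using dvd by (elim dvdE)
    show ?thesis unfolding q by simp
  qed
  ultimately show False using X_power_not_dvd_pderiv[of "P - Q"] \<open>P \<noteq> Q\<close> by simp
qed

text \<open>
  This is the partial fraction expansion of \<open>s\<^sup>N\<^sup>-\<^sup>1 / \<Prod> (1 + j s)\<close>, up to a constant factor and with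
  denominators cleared. Both sides have degree at most \<open>N - 1\<close>, and they agree at the \<open>N\<close>
  points \<open>-1/k\<close>, where only the summand \<open>i = k\<close> survives.
\<close>
lemma binomial_partial_fraction:
  fixes N :: nat
  assumes "N > 0"
  shows "(\<Sum>i\<in>{1..N}. of_int ((-1) ^ i * int (N choose i) * int i) * (\<Prod>j\<in>{1..N}-{i}. [:1, of_nat j:])) =
     - Polynomial.smult (fact N) ([:0, 1::'a::field_char_0:] ^ (N - 1))" (is "?L = ?R")
proof -
  have "?L - ?R = 0"
  proof (rule ccontr)
    assume nz: "?L - ?R \<noteq> 0"
    have "Polynomial.degree ?L \<le> N - 1"
    proof (rule degree_sum_le)
      fix i assume i: "i \<in> {1..N}"
      have "Polynomial.degree (\<Prod>j\<in>{1..N}-{i}. [:1::'a, of_nat j:]) \<le> (\<Sum>j\<in>{1..N}-{i}. Polynomial.degree [:1::'a, of_nat j:])"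
        using degree_prod_sum_le[of "{1..N} - {i}" "\<lambda>j. [:1::'a, of_nat j:]"] by (simp add: o_def)
      also have "\<dots> \<le> (\<Sum>j\<in>{1..N}-{i}. 1)" by (intro sum_mono) simp
      also have "\<dots> = N - 1" using i by simp
      finally show "Polynomial.degree (of_int ((-1) ^ i * int (N choose i) * int i) * (\<Prod>j\<in>{1..N}-{i}. [:1::'a, of_nat j:])) \<le> N - 1"
        by (simp only: of_int_poly mult_pCons_left, simp)
    qed simp
    moreover have "Polynomial.degree ?R \<le> N - 1"
      by (simp add: degree_power_eq)
    ultimately have deg: "Polynomial.degree (?L - ?R) \<le> N - 1" by (rule degree_diff_le)
    let ?Z = "(\<lambda>k. - inverse (of_nat k) :: 'a) ` {1..N}"
    have "?Z \<subseteq> {x. poly (?L - ?R) x = 0}"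
    proof safe
      fix k assume k: "k \<in> {1..N}"
      then have k0: "(of_nat k :: 'a) \<noteq> 0" by auto
      let ?x = "- inverse (of_nat k) :: 'a"
      have fac: "1 + ?x * of_nat j = (of_nat k - of_nat j) / of_nat k" for j
        using k0 by (simp add: field_simps)
      have "poly ?L ?x = (\<Sum>i\<in>{1..N}. of_int ((-1) ^ i * int (N choose i) * int i) * (\<Prod>j\<in>{1..N}-{i}. (of_nat k - of_nat j) / of_nat k))"
        by (simp only: poly_sum poly_prod poly_mult of_int_poly poly_pCons poly_0 mult_zero_right add_0_right flip: fac)
      also have "\<dots> = (\<Sum>i\<in>{k}. of_int ((-1) ^ i * int (N choose i) * int i) * (\<Prod>j\<in>{1..N}-{i}. (of_nat k - of_nat j) / of_nat k))"
      proof (rule sum.mono_neutral_right)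
        show "\<forall>i\<in>{1..N} - {k}. of_int ((-1) ^ i * int (N choose i) * int i) * (\<Prod>j\<in>{1..N}-{i}. (of_nat k - of_nat j) / (of_nat k :: 'a)) = 0"
          using k by (auto intro!: prod_zero bexI[of _ k])
      qed (use k in auto)
      also have "\<dots> = (-1) ^ k * of_nat (N choose k) * of_nat k * ((\<Prod>j\<in>{1..N}-{k}. of_nat k - of_nat j) / of_nat k ^ (N - 1))"
        using k by (simp add: prod_dividef)
      also have "(\<Prod>j\<in>{1..N}-{k}. of_nat k - of_nat j :: 'a) = (\<Prod>j\<in>{1..<k}. of_nat k - of_nat j) * (\<Prod>j\<in>{k<..N}. of_nat k - of_nat j)"
        using k by (subst prod.union_disjoint[symmetric]) (auto intro!: prod.cong)
      also have "(\<Prod>j\<in>{1..<k}. of_nat k - of_nat j :: 'a) = (\<Prod>j\<in>{1..<k}. of_nat j)"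
        by (rule prod.reindex_bij_witness[of _ "\<lambda>j. k - j" "\<lambda>j. k - j"]) (auto simp: of_nat_diff)
      also have "\<dots> = fact (k - 1)"
        using k by (simp add: fact_prod atLeastLessThanSuc_atLeastAtMost[symmetric])
      also have "(\<Prod>j\<in>{k<..N}. of_nat k - of_nat j :: 'a) = (\<Prod>j\<in>{1..N-k}. - of_nat j)"
        by (rule prod.reindex_bij_witness[of _ "\<lambda>j. k + j" "\<lambda>j. j - k"]) (auto simp: of_nat_diff)
      also have "\<dots> = (-1) ^ (N - k) * fact (N - k)"
        by (simp add: fact_prod prod_uminus)
      also have "(-1) ^ k * of_nat (N choose k) * of_nat k * (fact (k - 1) * ((-1) ^ (N - k) * fact (N - k)) / of_nat k ^ (N - 1))
         = ((-1) ^ k * (-1) ^ (N - k)) * (of_nat (N choose k) * (of_nat k * fact (k - 1)) * fact (N - k)) / (of_nat k ^ (N - 1) :: 'a)"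
        by (simp add: field_simps)
      also have "(-1) ^ k * (-1) ^ (N - k) = ((-1) ^ N :: 'a)"
        using k by (simp flip: power_add)
      also have "(of_nat k * fact (k - 1) :: 'a) = fact k"
        using k by (simp add: fact_reduce[of k])
      also have "of_nat (N choose k) * fact k * fact (N - k) = (fact N :: 'a)"
        using k binomial_fact_lemma[of k N]
        by (metis (no_types, opaque_lifting) atLeastAtMost_iff mult.assoc mult.commute of_nat_fact of_nat_mult)
      finally have L: "poly ?L ?x = (-1) ^ N * fact N / of_nat k ^ (N - 1)" .
      have "poly ?R ?x = - fact N * ((- 1) ^ (N - 1) / of_nat k ^ (N - 1))"
        by (simp only: poly_minus poly_smult poly_power poly_pCons poly_0 mult_zero_right add_0_right mult_1_right add_0_left
            power_minus[of "inverse _"] power_inverse) (simp add: divide_inverse)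
      also have "\<dots> = (-1) ^ N * fact N / of_nat k ^ (N - 1)"
        using assms by (cases N) auto
      finally have R: "poly ?R ?x = (-1) ^ N * fact N / of_nat k ^ (N - 1)" .
      show "poly (?L - ?R) ?x = 0" unfolding poly_diff L R by simp
    qed
    then have "card ?Z \<le> card {x. poly (?L - ?R) x = 0}"
      using poly_roots_finite[OF nz] by (rule card_mono[rotated])
    also have "\<dots> \<le> Polynomial.degree (?L - ?R)" using nz by (rule card_poly_roots_bound)
    finally have "card ?Z \<le> N - 1" using deg by simp
    moreover have "card ?Z = N" by (subst card_image) (auto simp: inj_on_def)
    ultimately show False using assms by simp
  qed
  then show ?thesis by (simp only: right_minus_eq)
qed

text \<open>
  A converse of the order bound: near 0 the derivative of \<open>D\<close> is \<open>D\<close> times a regular function plus a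
  term of order \<open>n\<close>, so an order of \<open>D\<close> between 1 and \<open>n\<close> would be at most the order of the derivative,
  which is one less.
\<close>
lemma X_power_dvd_of_logarithmic_derivative:
  fixes D :: "'a::field_char_0 poly"
  assumes eq: "pderiv D * W = D * S + [:0, 1:] ^ n * T" and W: "poly W 0 \<noteq> 0" and D: "poly D 0 = 0"
  shows "[:0, 1:] ^ Suc n dvd D"
proof (rule ccontr)
  assume not: "\<not> [:0, 1:] ^ Suc n dvd D"
  then have nz: "D \<noteq> 0" by auto
  let ?k = "Polynomial.order 0 D" and ?X = "[:0, 1:] :: 'a poly"
  have "?k \<le> n" using not order_divides[of 0 "Suc n" D] by simp
  then have "?X ^ ?k dvd ?X ^ n" by (rule le_imp_power_dvd)
  moreover have "?X ^ ?k dvd D" using order_divides[of 0 ?k D] by simp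
  ultimately have "?X ^ ?k dvd pderiv D * W" unfolding eq by (intro dvd_add dvd_mult2)
  then have "?X ^ ?k dvd pderiv D" using W by (rule X_power_dvd_mult_cancel)
  then show False using X_power_not_dvd_pderiv[OF nz D] by blast
qed

text \<open>
  The extremal case of \<open>prod_power_diff_order_bound\<close>: with these exponents the numerator of the
  logarithmic derivative is a nonzero multiple of \<open>s\<^sup>N\<^sup>-\<^sup>1\<close>. The sign is normalised so that
  \<open>e N = -1\<close>, which later makes the last linear factor the value of a single monomial.
\<close>
lemma binomial_prod_power_diff:
  fixes N :: nat
  assumes N: "N > 0"
  defines "e \<equiv> \<lambda>i. (-1) ^ (N + 1 + i) * int (N choose i)"
  defines "P \<equiv> \<Prod>i\<in>{1..N}. [:1, of_nat i :: 'a::field_char_0:] ^ nat (e i)"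
    and "Q \<equiv> \<Prod>i\<in>{1..N}. [:1, of_nat i :: 'a:] ^ nat (- e i)"
  shows "[:0, 1:] ^ N dvd P - Q" and "P \<noteq> Q"
proof -
  let ?w = "\<lambda>i. [:1, of_nat i :: 'a:]"
  define c where "c = (-1) ^ N * (fact N :: 'a)"
  let ?S = "\<Sum>i\<in>{1..N}. of_int (e i) * pderiv (?w i) * (\<Prod>j\<in>{1..N}-{i}. ?w j)"
  have "?S = (\<Sum>i\<in>{1..N}. (-1) ^ (N + 1) * (of_int ((-1) ^ i * int (N choose i) * int i) * (\<Prod>j\<in>{1..N}-{i}. ?w j)))"
  proof (rule sum.cong)
    fix i
    have "pderiv (?w i) = of_nat i" by (simp add: pderiv_pCons of_nat_poly)
    then show "of_int (e i) * pderiv (?w i) * (\<Prod>j\<in>{1..N}-{i}. ?w j) =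
        (-1) ^ (N + 1) * (of_int ((-1) ^ i * int (N choose i) * int i) * (\<Prod>j\<in>{1..N}-{i}. ?w j))"
      unfolding e_def power_add[of _ "N + 1" i] by (simp add: mult_ac)
  qed simp
  also have "\<dots> = (-1) ^ (N + 1) * - Polynomial.smult (fact N) ([:0, 1:] ^ (N - 1))"
    unfolding sum_distrib_left[symmetric] binomial_partial_fraction[OF N] ..
  also have "\<dots> = [:0, 1:] ^ (N - 1) * [:c:]"
    by (cases "even N") (simp_all add: c_def)
  finally have S: "?S = [:0, 1:] ^ (N - 1) * [:c:]" .
  have Q0: "poly Q 0 = 1" unfolding Q_def by (simp add: poly_prod)
  have P0: "poly P 0 = 1" unfolding P_def by (simp add: poly_prod)
  have main: "pderiv (P - Q) * (\<Prod>i\<in>{1..N}. ?w i) =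
    (P - Q) * (\<Sum>i\<in>{1..N}. of_nat (nat (e i)) * pderiv (?w i) * (\<Prod>j\<in>{1..N}-{i}. ?w j)) +
      [:0, 1:] ^ (N - 1) * ([:c:] * Q)"
    unfolding P_def Q_def
    by (subst pderiv_prod_power_diff, simp, subst S, simp only: mult_ac)
  have "[:0, 1:] ^ Suc (N - 1) dvd P - Q"
    by (rule X_power_dvd_of_logarithmic_derivative[OF main]) (simp_all add: poly_prod P0 Q0)
  then show "[:0, 1:] ^ N dvd P - Q" using N by simp
  show "P \<noteq> Q"
  proof
    assume "P = Q"
    then have "[:0, 1:] ^ (N - 1) * ([:c:] * Q) = 0" using main by simp
    then have "Q = 0" by (auto simp: c_def)
    then show False using Q0 by simp
  qed
qed

section \<open>Zeros of a plane curve off a set of lines\<close>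

lemma poly_eq_prod_of_linear_factors:
  fixes p :: "'k::alg_closed_field poly" and W :: "'i \<Rightarrow> 'k poly"
  assumes I: "finite I" and deg: "\<And>a. a \<in> I \<Longrightarrow> Polynomial.degree (W a) \<le> 1" and W: "\<And>a. a \<in> I \<Longrightarrow> W a \<noteq> 0"
    and p: "p \<noteq> 0" and roots: "\<And>u. poly p u = 0 \<Longrightarrow> \<exists>a\<in>I. poly (W a) u = 0"
  shows "\<exists>c k. p = Polynomial.smult c (\<Prod>a\<in>I. W a ^ k a) \<and> (\<forall>a. k a \<le> Polynomial.degree p)"
  using p roots
proof (induction "Polynomial.degree p" arbitrary: p)
  case 0
  then obtain c where "p = [:c:]" using degree_eq_zeroE by metis
  then show ?case by (intro exI[of _ c] exI[of _ "\<lambda>_. 0"]) simp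
next
  case (Suc n)
  then obtain u where u: "poly p u = 0" using alg_closed_imp_poly_has_root[of p] by auto
  then obtain a where a: "a \<in> I" "poly (W a) u = 0" using Suc by blast
  then have "[:-u, 1:] dvd W a" by (simp add: poly_eq_0_iff_dvd)
  then obtain r where r: "W a = [:-u, 1:] * r" by (elim dvdE)
  have r0: "r \<noteq> 0" using r W[OF a(1)] by auto
  then have "Polynomial.degree (W a) = 1 + Polynomial.degree r" unfolding r by (subst degree_mult_eq) auto
  then have "Polynomial.degree r = 0" and dW: "Polynomial.degree (W a) = 1" using deg[OF a(1)] by auto
  then obtain h where h: "r = [:h:]" using degree_eq_zeroE by metis
  have "h \<noteq> 0" using r0 h by simp
  obtain s where s: "p = [:-u, 1:] * s" using u by (metis dvdE poly_eq_0_iff_dvd)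
  define q where "q = Polynomial.smult (inverse h) s"
  have "[:h:] * q = s" unfolding q_def using \<open>h \<noteq> 0\<close> by simp
  then have p: "p = W a * q" unfolding s r h mult.assoc by simp
  then have q0: "q \<noteq> 0" using Suc by auto
  then have dq: "Polynomial.degree p = Suc (Polynomial.degree q)"
    unfolding p using W[OF a(1)] dW by (subst degree_mult_eq) auto
  have "\<And>u. poly q u = 0 \<Longrightarrow> \<exists>a\<in>I. poly (W a) u = 0" using Suc.prems(2) p by simp
  with Suc.hyps(1)[of q] dq Suc.hyps(2) q0 obtain c k
    where k: "q = Polynomial.smult c (\<Prod>a\<in>I. W a ^ k a)" "\<And>a. k a \<le> Polynomial.degree q" by auto
  let ?k = "k(a := Suc (k a))"
  have "(\<Prod>b\<in>I. W b ^ ?k b) = W a ^ Suc (k a) * (\<Prod>b\<in>I-{a}. W b ^ k b)"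
    using a(1) I by (subst prod.remove[of I a]) auto
  also have "\<dots> = W a * (\<Prod>b\<in>I. W b ^ k b)"
    using a(1) I by (subst prod.remove[of I a]) (auto simp: mult.assoc)
  finally have "p = Polynomial.smult c (\<Prod>a\<in>I. W a ^ ?k a)" unfolding p k(1) by simp
  moreover have "\<forall>b. ?k b \<le> Polynomial.degree p" using k(2) dq by (simp add: le_SucI)
  ultimately show ?case by blast
qed

text \<open>
  The curve passes through the origin, which lies on none of the lines, so a component of it through the
  origin is not one of the lines; it has infinitely many points, finitely many of them on the lines.
  To avoid a decomposition into components, assume finiteness and restrict to the vertical line with
  abscissa \<open>c\<close>. For almost all \<open>c\<close> every root of the restriction is a root of a linear form, so the
  restriction is a product of powers of the linear forms up to a constant. One exponent vector \<open>k\<close>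
  serves infinitely many \<open>c\<close>. Eliminating the constant by means of the value at \<open>u = 0\<close> gives an
  identity that is polynomial in \<open>c\<close>, hence holds at \<open>c = 0\<close> too; there it says that the
  whole vertical axis lies on the curve, which makes the set of solutions infinite after all.
\<close>
lemma infinitely_many_zeros_off_lines:
  fixes v g h :: "'i \<Rightarrow> 'k::{alg_closed_field,field_char_0}" and e :: "'i \<Rightarrow> int"
  assumes I: "finite I" and v: "\<And>a. a \<in> I \<Longrightarrow> v a \<noteq> 0"
    and base: "(\<Prod>a\<in>I. v a ^ nat (e a)) = (\<Prod>a\<in>I. v a ^ nat (- e a))"
  shows "infinite {(c, u). (\<forall>a\<in>I. v a + g a * c + h a * u \<noteq> 0) \<and>
    (\<Prod>a\<in>I. (v a + g a * c + h a * u) ^ nat (e a)) = (\<Prod>a\<in>I. (v a + g a * c + h a * u) ^ nat (- e a))}"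
    (is "infinite ?Z")
proof
  assume "finite ?Z"
  define Z where "Z = ?Z"
  with \<open>finite ?Z\<close> have fin: "finite Z" by simp
  \<comment> \<open>Each bivariate object is kept twice, as a polynomial in the ordinate for a fixed abscissa (\<open>W\<close>, \<open>P\<close>)
    and as a polynomial in the abscissa for a fixed ordinate (\<open>V\<close>, \<open>R\<close>).\<close>
  define W where "W = (\<lambda>c a. [:v a + g a * c, h a:])"
  define V where "V = (\<lambda>u a. [:v a + h a * u, g a:])"
  define P where "P = (\<lambda>c. (\<Prod>a\<in>I. W c a ^ nat (e a)) - (\<Prod>a\<in>I. W c a ^ nat (- e a)))"
  define R where "R = (\<lambda>u. (\<Prod>a\<in>I. V u a ^ nat (e a)) - (\<Prod>a\<in>I. V u a ^ nat (- e a)))"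
  have pW: "poly (W c a) u = v a + g a * c + h a * u" for c a u by (simp add: W_def mult.commute)
  have pV: "poly (V u a) c = v a + g a * c + h a * u" for c a u by (simp add: V_def mult.commute)
  have pP: "poly (P c) u = (\<Prod>a\<in>I. (v a + g a * c + h a * u) ^ nat (e a)) -
      (\<Prod>a\<in>I. (v a + g a * c + h a * u) ^ nat (- e a))" for c u
    unfolding P_def by (simp add: poly_prod pW)
  have pR: "poly (R u) c = poly (P c) u" for c u
    unfolding pP R_def by (simp add: poly_prod pV)
  have inf: "infinite (UNIV :: 'k set)" by (rule infinite_UNIV_char_0)
  have degprod: "Polynomial.degree (\<Prod>a\<in>I. W c a ^ k a) \<le> sum k I" for c and k :: "'i \<Rightarrow> nat"
  proof -
    have "Polynomial.degree (W c a ^ k a) \<le> k a" for a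
      using degree_power_le[of "W c a" "k a"] degree_pCons_le[of "v a + g a * c" "[:h a:]"]
      by (simp add: W_def split: if_splits)
    then have "(\<Sum>a\<in>I. Polynomial.degree (W c a ^ k a)) \<le> sum k I" by (intro sum_mono)
    then show ?thesis using degree_prod_sum_le[OF I, of "\<lambda>a. W c a ^ k a"] by (simp add: o_def)
  qed
  define D where "D = (\<Sum>a\<in>I. nat (e a)) + (\<Sum>a\<in>I. nat (- e a))"
  have degP: "Polynomial.degree (P c) \<le> D" for c
    unfolding P_def D_def using degprod[of c "\<lambda>a. nat (e a)"] degprod[of c "\<lambda>a. nat (- e a)"]
    by (intro degree_diff_le) linarith+
  define C where "C = - (fst ` Z \<union> (\<Union>a\<in>I. {c. poly [:v a, g a:] c = 0}))"
  have "finite {c. poly [:v a, g a:] c = 0}" if "a \<in> I" for a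
    using v[OF that] by (intro poly_roots_finite) simp
  then have "finite (fst ` Z \<union> (\<Union>a\<in>I. {c. poly [:v a, g a:] c = 0}))"
    using fin I by blast
  then have C: "infinite C" unfolding C_def Compl_eq_Diff_UNIV using inf by (rule Diff_infinite_finite)
  have fact: "\<exists>c' k. P c = Polynomial.smult c' (\<Prod>a\<in>I. W c a ^ k a) \<and> k \<in> I \<rightarrow>\<^sub>E {..D}" if c: "c \<in> C" for c
  proof -
    from c have cZ: "c \<notin> fst ` Z" and cI': "c \<notin> (\<Union>a\<in>I. {c. poly [:v a, g a:] c = 0})"
      unfolding C_def Compl_iff Un_iff de_Morgan_disj by (rule conjunct1, rule conjunct2)
    from cI' have cI: "poly [:v a, g a:] c \<noteq> 0" if "a \<in> I" for a
      using that by blast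
    have W0: "W c a \<noteq> 0" if "a \<in> I" for a
      using cI[OF that] unfolding W_def by (simp add: mult.commute[of c])
    have notZ: "(c, u) \<notin> Z" for u using cZ image_eqI[of c fst "(c, u)" Z] unfolding fst_conv by blast
    have roots: "\<exists>a\<in>I. poly (W c a) u = 0" if "poly (P c) u = 0" for u
      using notZ[of u] that unfolding pP pW Z_def by auto
    have "P c \<noteq> 0"
    proof
      assume "P c = 0"
      then have "{u. poly (\<Prod>a\<in>I. W c a) u = 0} = UNIV" using roots I by (auto simp: poly_prod)
      moreover have "(\<Prod>a\<in>I. W c a) \<noteq> 0" using W0 I by simp
      ultimately show False using poly_roots_finite inf by metis
    qed
    have "Polynomial.degree (W c a) \<le> 1" for a by (simp add: W_def)
    from poly_eq_prod_of_linear_factors[OF I this W0 \<open>P c \<noteq> 0\<close> roots] obtain c' k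
      where k: "P c = Polynomial.smult c' (\<Prod>a\<in>I. W c a ^ k a)" "\<And>a. k a \<le> Polynomial.degree (P c)" by blast
    have "P c = Polynomial.smult c' (\<Prod>a\<in>I. W c a ^ restrict k I a)" unfolding k(1) by simp
    moreover have "restrict k I \<in> I \<rightarrow>\<^sub>E {..D}" using order.trans[OF k(2) degP] by (simp add: PiE_I)
    ultimately show ?thesis by blast
  qed
  then have "\<forall>c\<in>C. \<exists>k c'. P c = Polynomial.smult c' (\<Prod>a\<in>I. W c a ^ k a) \<and> k \<in> I \<rightarrow>\<^sub>E {..D}" by blast
  from bchoice[OF this] obtain K where
    K: "\<And>c. c \<in> C \<Longrightarrow> \<exists>c'. P c = Polynomial.smult c' (\<Prod>a\<in>I. W c a ^ K c a) \<and> K c \<in> I \<rightarrow>\<^sub>E {..D}" by blast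
  then have "K ` C \<subseteq> I \<rightarrow>\<^sub>E {..D}" by blast
  then have "finite (K ` C)" using finite_PiE[OF I, of "\<lambda>_. {..D}"] finite_subset by blast
  from pigeonhole_infinite[OF C this] obtain c0 where c0: "infinite {c \<in> C. K c = K c0}" by blast
  define k where "k = K c0"
  define M where "M = (\<lambda>u. \<Prod>a\<in>I. V u a ^ k a)"
  have vanish: "poly (R u) 0 = 0" for u
  proof -
    have "poly (R 0 * M u - R u * M 0) c = 0" if c: "c \<in> C" "K c = K c0" for c
    proof -
      obtain c' where c': "P c = Polynomial.smult c' (\<Prod>a\<in>I. W c a ^ k a)" using K[OF c(1)] c(2) k_def by auto
      have "poly (P c) u = c' * poly (M u) c" for u
        unfolding c' M_def by (simp add: poly_prod pW pV)
      then show ?thesis by (simp add: pR)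
    qed
    then have "{c \<in> C. K c = K c0} \<subseteq> {c. poly (R 0 * M u - R u * M 0) c = 0}" by blast
    then have "infinite {c. poly (R 0 * M u - R u * M 0) c = 0}" using c0 finite_subset by blast
    then have "R 0 * M u - R u * M 0 = 0" using poly_roots_finite by blast
    then have "poly (R 0 * M u - R u * M 0) 0 = 0" by simp
    moreover have "poly (R 0) 0 = 0" unfolding pR pP using base by simp
    moreover have "poly (M 0) 0 \<noteq> 0" unfolding M_def using I v by (simp add: poly_prod pV)
    ultimately show ?thesis by simp
  qed
  define U where "U = - (\<Union>a\<in>I. {u. poly [:v a, h a:] u = 0})"
  have "finite {u. poly [:v a, h a:] u = 0}" if "a \<in> I" for a
    using v[OF that] by (intro poly_roots_finite) simp
  then have "finite (\<Union>a\<in>I. {u. poly [:v a, h a:] u = 0})" using I by blast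
  then have "infinite U" unfolding U_def Compl_eq_Diff_UNIV using inf by (rule Diff_infinite_finite)
  moreover have "(0, u) \<in> Z" if u: "u \<in> U" for u
  proof -
    from u have "u \<notin> (\<Union>a\<in>I. {u. poly [:v a, h a:] u = 0})" unfolding U_def by (rule ComplD)
    then have "v a + g a * 0 + h a * u \<noteq> 0" if "a \<in> I" for a
      using that by (simp add: mult.commute[of u])
    then have "\<forall>a\<in>I. v a + g a * 0 + h a * u \<noteq> 0" by (rule ballI)
    then show ?thesis
      using vanish[of u] unfolding pR pP Z_def mem_Collect_eq case_prod_conv right_minus_eq by (rule conjI)
  qed
  then have "Pair 0 ` U \<subseteq> Z" by (rule image_subsetI)
  then have "finite (Pair (0::'k) ` U)" using fin by (rule finite_subset)
  then have "finite U" by (rule finite_imageD) (simp add: inj_on_def)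
  ultimately show False by (rule notE)
qed

section \<open>Gaussian elimination\<close>

text \<open>
  Elimination in a form that can be transported to any module over the field. \<open>B\<close> is the set of free
  columns. The columns of \<open>g\<close> form a basis of the kernel of the system, and the coefficients \<open>h\<close> witness
  that the difference between the unknown \<open>a\<close> and its expression in the free unknowns is a combination of
  the rows. Rows are added one at a time; a row that does not vanish on the current kernel gives a pivot,
  which stops being free.
\<close>
lemma gaussian_elimination:
  fixes \<rho> :: "'j \<Rightarrow> 'a \<Rightarrow> 'k::field"
  assumes A: "finite A" and J: "finite J"
  shows "\<exists>B g h. B \<subseteq> A \<and> card A \<le> card B + card J \<and>
    (\<forall>j\<in>J. \<forall>b\<in>B. (\<Sum>a\<in>A. \<rho> j a * g a b) = 0) \<and>
    (\<forall>b\<in>B. \<forall>b'\<in>B. g b b' = (if b = b' then 1 else 0)) \<and>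
    (\<forall>a\<in>A. \<forall>a'\<in>A. (if a = a' then 1 else 0) =
        (if a' \<in> B then g a a' else 0) + (\<Sum>j\<in>J. h a j * \<rho> j a'))"
  using J
proof (induction J)
  case empty
  show ?case
    by (intro exI[of _ A] exI[of _ "\<lambda>a b. if a = b then 1 else 0"]) auto
next
  case (insert i J)
  then obtain B g h where B: "B \<subseteq> A" and card: "card A \<le> card B + card J"
    and ker: "\<And>j b. j \<in> J \<Longrightarrow> b \<in> B \<Longrightarrow> (\<Sum>a\<in>A. \<rho> j a * g a b) = 0"
    and gB: "\<And>b b'. b \<in> B \<Longrightarrow> b' \<in> B \<Longrightarrow> g b b' = (if b = b' then 1 else 0)"
    and rep: "\<And>a a'. a \<in> A \<Longrightarrow> a' \<in> A \<Longrightarrow> (if a = a' then 1 else 0) =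
        (if a' \<in> B then g a a' else 0) + (\<Sum>j\<in>J. h a j * \<rho> j a')"
    by blast
  have finB: "finite B" using B A finite_subset by blast
  define r where "r = (\<lambda>b. \<Sum>a\<in>A. \<rho> i a * g a b)"
  \<comment> \<open>The new row, reduced modulo the old ones: only its entries \<open>r\<close> in free columns remain.\<close>
  have row: "(if a' \<in> B then r a' else 0) = \<rho> i a' - (\<Sum>j\<in>J. (\<Sum>a\<in>A. \<rho> i a * h a j) * \<rho> j a')"
    if "a' \<in> A" for a'
  proof -
    have "\<rho> i a' = (\<Sum>a\<in>A. \<rho> i a * (if a = a' then 1 else 0))"
      using that A by (simp add: if_distrib cong: if_cong)
    also have "\<dots> = (\<Sum>a\<in>A. \<rho> i a * ((if a' \<in> B then g a a' else 0) + (\<Sum>j\<in>J. h a j * \<rho> j a')))"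
      using rep that by (intro sum.cong) auto
    also have "\<dots> = (if a' \<in> B then r a' else 0) + (\<Sum>a\<in>A. \<Sum>j\<in>J. \<rho> i a * h a j * \<rho> j a')"
      by (simp add: r_def distrib_left sum.distrib sum_distrib_left mult.assoc)
    also have "(\<Sum>a\<in>A. \<Sum>j\<in>J. \<rho> i a * h a j * \<rho> j a') = (\<Sum>j\<in>J. (\<Sum>a\<in>A. \<rho> i a * h a j) * \<rho> j a')"
      by (subst sum.swap) (simp add: sum_distrib_right)
    finally show ?thesis by (simp add: algebra_simps)
  qed
  show ?case
  proof (cases "\<forall>b\<in>B. r b = 0")
    case True
    define h' where "h' = (\<lambda>a j. if j = i then 0 else h a j)"
    have "(\<Sum>j\<in>insert i J. h' a j * \<rho> j a') = (\<Sum>j\<in>J. h a j * \<rho> j a')" for a a'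
      using insert by (auto simp: h'_def intro!: sum.cong)
    then show ?thesis
      using B card ker gB rep True insert.hyps
      by (intro exI[of _ B] exI[of _ g] exI[of _ h']) (auto simp: r_def)
  next
    case False
    then obtain p where p: "p \<in> B" "r p \<noteq> 0" by blast
    define B' where "B' = B - {p}"
    define g' where "g' = (\<lambda>a b. g a b - g a p * r b / r p)"
    define h' where "h' = (\<lambda>a j. if j = i then g a p / r p
        else h a j - g a p / r p * (\<Sum>a\<in>A. \<rho> i a * h a j))"
    have "card B = Suc (card B')" using p finB unfolding B'_def by (metis card.remove)
    then have 1: "card A \<le> card B' + card (insert i J)" using card insert by simp
    have ker': "(\<Sum>a\<in>A. \<rho> j a * g' a b) = (\<Sum>a\<in>A. \<rho> j a * g a b) - (\<Sum>a\<in>A. \<rho> j a * g a p) * r b / r p"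
      for j b
      unfolding g'_def by (simp add: right_diff_distrib sum_subtractf sum_distrib_right sum_divide_distrib mult.assoc)
    have 2: "(\<Sum>a\<in>A. \<rho> j a * g' a b) = 0" if "j \<in> insert i J" "b \<in> B'" for j b
    proof (cases "j = i")
      case True
      then show ?thesis using p unfolding ker' True by (simp add: r_def)
    next
      case False
      then show ?thesis using ker[of j] that p unfolding ker' B'_def by simp
    qed
    have 3: "g' b b' = (if b = b' then 1 else 0)" if "b \<in> B'" "b' \<in> B'" for b b'
      using that gB p unfolding g'_def B'_def by auto
    have 4: "(if a = a' then 1 else 0) =
        (if a' \<in> B' then g' a a' else 0) + (\<Sum>j\<in>insert i J. h' a j * \<rho> j a')"
      if a: "a \<in> A" "a' \<in> A" for a a'
    proof -
      let ?c = "g a p / r p"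
      have "(\<Sum>j\<in>insert i J. h' a j * \<rho> j a') = ?c * \<rho> i a' + (\<Sum>j\<in>J. h' a j * \<rho> j a')"
        using insert by (simp add: h'_def)
      also have "(\<Sum>j\<in>J. h' a j * \<rho> j a') =
          (\<Sum>j\<in>J. h a j * \<rho> j a' - ?c * ((\<Sum>a\<in>A. \<rho> i a * h a j) * \<rho> j a'))"
        using insert by (intro sum.cong) (auto simp: h'_def algebra_simps)
      also have "\<dots> = (\<Sum>j\<in>J. h a j * \<rho> j a') - ?c * (\<Sum>j\<in>J. (\<Sum>a\<in>A. \<rho> i a * h a j) * \<rho> j a')"
        by (simp add: sum_subtractf sum_distrib_left)
      also have "?c * \<rho> i a' + ((\<Sum>j\<in>J. h a j * \<rho> j a') - ?c * (\<Sum>j\<in>J. (\<Sum>a\<in>A. \<rho> i a * h a j) * \<rho> j a'))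
          = (\<Sum>j\<in>J. h a j * \<rho> j a') + ?c * (if a' \<in> B then r a' else 0)"
        unfolding row[OF a(2)] by (simp add: algebra_simps)
      finally have "(if a' \<in> B' then g' a a' else 0) + (\<Sum>j\<in>insert i J. h' a j * \<rho> j a')
          = (if a' \<in> B then g a a' else 0) + (\<Sum>j\<in>J. h a j * \<rho> j a')"
        using p by (auto simp: B'_def g'_def)
      then show ?thesis using rep[OF a] by simp
    qed
    show ?thesis
      using B 1 2 3 4 by (intro exI[of _ B'] exI[of _ g'] exI[of _ h']) (auto simp: B'_def)
  qed
qed

section \<open>Points of the torus with prescribed monomials\<close>

lemma prod_powi: "(\<Prod>i\<in>I. f i) powi k = (\<Prod>i\<in>I. f i powi k)" for f :: "'i \<Rightarrow> 'f::field"
  by (induction I rule: infinite_finite_induct) (simp_all add: power_int_mult_distrib)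

definition laurent :: "('n::finite \<Rightarrow> 'f::field) \<Rightarrow> int ^ 'n \<Rightarrow> 'f"
  where "laurent x a = (\<Prod>i\<in>UNIV. x i powi (a $ i))"

lemma laurent_0 [simp]: "laurent x 0 = 1"
  by (simp add: laurent_def)

lemma laurent_nonzero: "(\<And>i. x i \<noteq> 0) \<Longrightarrow> laurent x a \<noteq> 0"
  by (simp add: laurent_def)

lemma laurent_add: "(\<And>i. x i \<noteq> 0) \<Longrightarrow> laurent x (a + b) = laurent x a * laurent x b"
  by (simp add: laurent_def power_int_add prod.distrib)

lemma laurent_diff: "(\<And>i. x i \<noteq> 0) \<Longrightarrow> laurent x (a - b) = laurent x a / laurent x b"
  by (simp add: laurent_def power_int_diff prod_dividef)

lemma laurent_scale: "laurent x (k *s a) = laurent x a powi k"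
  by (simp add: laurent_def prod_powi power_int_mult mult.commute[of k])

lemma laurent_sum: "(\<And>i. x i \<noteq> 0) \<Longrightarrow> laurent x (\<Sum>i\<in>I. f i) = (\<Prod>i\<in>I. laurent x (f i))"
  by (induction I rule: infinite_finite_induct) (auto simp: laurent_add)

lemma laurent_axis: "laurent x (axis i 1) = x i"
proof -
  have "laurent x (axis i 1) = (\<Prod>j\<in>UNIV. if j = i then x j else 1)"
    unfolding laurent_def by (intro prod.cong) (auto simp: axis_def)
  then show ?thesis by simp
qed

text \<open>
  The graph of a group homomorphism into the multiplicative group of the field, defined on some subgroup of
  the lattice. Working with graphs makes extension to a larger subgroup an inclusion of sets.
\<close>
definition partial_character :: "((int ^ 'n) \<times> 'k::field) set \<Rightarrow> bool"
  where "partial_character H \<longleftrightarrow> (0, 1) \<in> H \<and> (\<forall>y. (0, y) \<in> H \<longrightarrow> y = 1) \<and>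
    (\<forall>v y. (v, y) \<in> H \<longrightarrow> y \<noteq> 0) \<and>
    (\<forall>v y v' y'. (v, y) \<in> H \<longrightarrow> (v', y') \<in> H \<longrightarrow> (v - v', y / y') \<in> H)"

lemma partial_character_inverse:
  "partial_character H \<Longrightarrow> (v, y) \<in> H \<Longrightarrow> (- v, inverse y) \<in> H"
  unfolding partial_character_def by (metis (no_types, lifting) case_prodD diff_0 inverse_eq_divide)

lemma partial_character_mult:
  assumes "partial_character H" "(v, y) \<in> H" "(v', y') \<in> H"
  shows "(v + v', y * y') \<in> H"
proof -
  have "(v - (- v'), y / inverse y') \<in> H"
    using assms partial_character_inverse[OF assms(1,3)] unfolding partial_character_def by blast
  then show ?thesis by (simp add: divide_inverse)
qed

lemma partial_character_power:
  assumes "partial_character H" "(v, y) \<in> H"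
  shows "(k *s v, y powi k) \<in> H"
proof -
  have n: "(int m *s v, y powi int m) \<in> H" for m
  proof (induction m)
    case 0
    then show ?case using assms(1) by (simp add: partial_character_def)
  next
    case (Suc m)
    have "(int (Suc m) *s v, y powi int (Suc m)) = (v + int m *s v, y * y powi int m)"
      unfolding power_int_of_nat power_Suc
      by (simp add: vec_eq_iff algebra_simps del: power_int_of_nat)
    then show ?case using partial_character_mult[OF assms Suc] by simp
  qed
  show ?thesis
  proof (cases "k \<ge> 0")
    case True
    then show ?thesis using n[of "nat k"] by simp
  next
    case False
    then have "(- (int (nat (-k)) *s v), inverse (y powi int (nat (-k)))) \<in> H"
      using partial_character_inverse[OF assms(1) n] by blast
    moreover have "- (int (nat (-k)) *s v) = k *s v" "inverse (y powi int (nat (-k))) = y powi k"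
      using False by (simp_all add: vec_eq_iff power_int_minus)
    ultimately show ?thesis by simp
  qed
qed

lemma partial_character_unique:
  assumes "partial_character H" "(v, y) \<in> H" "(v, y') \<in> H"
  shows "y = y'"
proof -
  have *: "(v - v, y / y') \<in> H" "y' \<noteq> 0" using assms unfolding partial_character_def by blast+
  have "y / y' = 1" using assms(1) *(1) unfolding partial_character_def by auto
  then show ?thesis using \<open>y' \<noteq> 0\<close> by simp
qed

text \<open>
  The multiples \<open>k\<close> with \<open>k q\<close> in the domain form an ideal of the integers. If it is generated by
  \<open>d > 0\<close>, then a \<open>d\<close>-th root of the value at \<open>d q\<close> is a consistent value at \<open>q\<close>; if it is zero, then any
  nonzero value is.
\<close>
lemma partial_character_extend:
  fixes H :: "((int ^ 'n) \<times> 'k::alg_closed_field) set" and q :: "int ^ 'n"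
  assumes H: "partial_character H"
  shows "\<exists>H' u. partial_character H' \<and> H \<subseteq> H' \<and> (q, u) \<in> H'"
proof -
  have "\<exists>u::'k. u \<noteq> 0 \<and> (\<forall>k y. (k *s q, y) \<in> H \<longrightarrow> y = u powi k)"
  proof (cases "\<exists>d>0. \<exists>y. (int d *s q, y) \<in> H")
    case False
    have "k = 0" if "(k *s q, y) \<in> H" for k y
    proof (rule ccontr)
      assume "k \<noteq> 0"
      show False
      proof (cases "k > 0")
        case True
        then show False using False that by (metis int_nat_eq less_imp_le zero_less_nat_eq)
      next
        case neg: False
        have "(- (k *s q), inverse y) \<in> H" using partial_character_inverse[OF H that] .
        moreover have "- (k *s q) = int (nat (-k)) *s q" using neg by (simp add: vec_eq_iff)
        ultimately show False using False neg \<open>k \<noteq> 0\<close> by (metis linorder_neqE_linordered_idom neg_0_less_iff_less zero_less_nat_eq)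
      qed
    qed
    then show ?thesis using H unfolding partial_character_def
      by (intro exI[of _ 1]) fastforce
  next
    case True
    define d where "d = (LEAST d. d > 0 \<and> (\<exists>y. (int d *s q, y) \<in> H))"
    from True have d: "d > 0 \<and> (\<exists>y. (int d *s q, y) \<in> H)" unfolding d_def by (rule LeastI_ex)
    then obtain y0 where y0: "(int d *s q, y0) \<in> H" by blast
    obtain u where u: "u ^ d = y0" using d nth_root_exists[of d y0] by blast
    have "y0 \<noteq> 0" using y0 H unfolding partial_character_def by blast
    then have "u \<noteq> 0" using u d by auto
    moreover have "y = u powi k" if k: "(k *s q, y) \<in> H" for k y
    proof -
      define m where "m = k div int d"
      have pm: "(m *s (int d *s q), y0 powi m) \<in> H" using partial_character_power[OF H y0] .
      have "(k *s q - m *s (int d *s q), y / y0 powi m) \<in> H"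
        using H k pm unfolding partial_character_def by blast
      moreover have "k *s q - m *s (int d *s q) = (k mod int d) *s q"
        by (simp add: vec_eq_iff m_def minus_div_mult_eq_mod[symmetric] left_diff_distrib mult.assoc)
      moreover have "k mod int d = int (nat (k mod int d))" using d by simp
      ultimately have r: "(int (nat (k mod int d)) *s q, y / y0 powi m) \<in> H" by simp
      have "nat (k mod int d) < d" using d by (simp add: nat_less_iff)
      then have "nat (k mod int d) = 0"
        using r not_less_Least[of "nat (k mod int d)" "\<lambda>d. d > 0 \<and> (\<exists>y. (int d *s q, y) \<in> H)"]
        unfolding d_def[symmetric] by auto
      then have "k mod int d = 0" using d by (metis nat_eq_iff2 pos_mod_sign of_nat_0_less_iff of_nat_0 int_nat_eq)
      then have km: "k = int d * m" unfolding m_def by (simp add: mult_div_mod_eq[symmetric] flip: minus_mod_eq_mult_div)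
      then have "m *s (int d *s q) = k *s q" by (simp add: mult.commute)
      then have "y = y0 powi m" using partial_character_unique[OF H k] pm by simp
      also have "\<dots> = u powi k" unfolding km u[symmetric] by (simp add: power_int_mult)
      finally show ?thesis .
    qed
    ultimately show ?thesis by blast
  qed
  then obtain u :: 'k where u: "u \<noteq> 0" and uq: "\<And>k y. (k *s q, y) \<in> H \<Longrightarrow> y = u powi k" by blast
  define H' where "H' = {(v + k *s q, y * u powi k) | v y k. (v, y) \<in> H}"
  have H0: "(0, 1) \<in> H" using H unfolding partial_character_def by blast
  have sub: "H \<subseteq> H'"
  proof safe
    fix v y assume "(v, y) \<in> H"
    then show "(v, y) \<in> H'" unfolding H'_def
      by (intro CollectI exI[of _ v] exI[of _ y] exI[of _ 0]) (simp add: vec_eq_iff)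
  qed
  have q: "(q, u) \<in> H'" unfolding H'_def using H0
    by (intro CollectI exI[of _ 0] exI[of _ 1] exI[of _ 1]) (simp add: vec_eq_iff)
  have "partial_character H'"
    unfolding partial_character_def
  proof (intro conjI allI impI ballI, goal_cases)
    case 1
    then show ?case using sub H0 by blast
  next
    case (2 y)
    then obtain v y' k where *: "(v, y') \<in> H" "0 = v + k *s q" "y = y' * u powi k" unfolding H'_def by blast
    have "v = (- k) *s q" using *(2) by (simp add: vec_eq_iff) (metis add.commute add_eq_0_iff)
    then have "y' = u powi (- k)" using * uq by blast
    then show ?case using u * by (simp add: power_int_minus)
  next
    case (3 v y)
    then show ?case using H u unfolding H'_def partial_character_def by auto
  next
    case (4 v1 y1 v1' y1')
    then obtain v y k v' y' k' where *: "v1 = v + k *s q" "y1 = y * u powi k" "(v, y) \<in> H"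
      "v1' = v' + k' *s q" "y1' = y' * u powi k'" "(v', y') \<in> H" unfolding H'_def by blast
    have "(v - v', y / y') \<in> H" using H * unfolding partial_character_def by blast
    moreover have "v + k *s q - (v' + k' *s q) = v - v' + (k - k') *s q"
      by (simp add: vec_eq_iff algebra_simps)
    moreover have "y * u powi k / (y' * u powi k') = y / y' * u powi (k - k')"
      using u by (simp add: power_int_diff)
    ultimately show ?case using *(3,6) unfolding H'_def *
      by (intro CollectI exI[of _ "v - v'"] exI[of _ "y / y'"] exI[of _ "k - k'"]) (simp_all only: prod.inject simp_thms)
  qed
  then show ?thesis using sub q by blast
qed

text \<open>
  The hypothesis \<open>rel\<close> makes \<open>p a \<mapsto> w a\<close> a well-defined character of the lattice spanned by the vectors
  \<open>p a\<close>. Extended to the unit vectors one at a time, it becomes a character of the full lattice, and these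
  are the evaluations at points of the torus.
\<close>
lemma torus_point_exists:
  fixes p :: "'i \<Rightarrow> int ^ 'n::finite" and w :: "'i \<Rightarrow> 'k::alg_closed_field"
  assumes I: "finite I" and w: "\<And>a. a \<in> I \<Longrightarrow> w a \<noteq> 0"
    and rel: "\<And>e. (\<Sum>a\<in>I. e a *s p a) = 0 \<Longrightarrow> (\<Prod>a\<in>I. w a powi e a) = 1"
  shows "\<exists>x. (\<forall>i. x i \<noteq> 0) \<and> (\<forall>a\<in>I. laurent x (p a) = w a)"
proof -
  define H where "H = {(\<Sum>a\<in>I. e a *s p a, \<Prod>a\<in>I. w a powi e a) | e. True}"
  have H: "partial_character H"
    unfolding partial_character_def
  proof (intro conjI allI impI ballI, goal_cases)
    case 1
    show ?case unfolding H_def by (intro CollectI exI[of _ "\<lambda>_. 0"]) (simp add: vec_eq_iff)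
  next
    case (2 y)
    then show ?case using rel unfolding H_def by auto
  next
    case (3 v y)
    then show ?case using w I unfolding H_def by auto
  next
    case (4 v y v' y')
    then obtain e e' where *: "v = (\<Sum>a\<in>I. e a *s p a)" "y = (\<Prod>a\<in>I. w a powi e a)"
      "v' = (\<Sum>a\<in>I. e' a *s p a)" "y' = (\<Prod>a\<in>I. w a powi e' a)" unfolding H_def by blast
    have "(\<Sum>a\<in>I. e a *s p a) - (\<Sum>a\<in>I. e' a *s p a) = (\<Sum>a\<in>I. (e a - e' a) *s p a)"
      by (simp add: vec_eq_iff sum_subtractf left_diff_distrib)
    moreover have "(\<Prod>a\<in>I. w a powi e a) / (\<Prod>a\<in>I. w a powi e' a) = (\<Prod>a\<in>I. w a powi (e a - e' a))"
      unfolding prod_dividef[symmetric] using w by (intro prod.cong) (auto simp: power_int_diff)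
    ultimately show ?case unfolding * H_def
      by (intro CollectI exI[of _ "\<lambda>a. e a - e' a"] conjI) (simp_all only: prod.inject simp_thms)
  qed
  have "\<exists>H' x. partial_character H' \<and> H \<subseteq> H' \<and> (\<forall>i\<in>S. (axis i 1, x i) \<in> H')" if "finite S" for S :: "'n set"
    using that
  proof (induction S)
    case empty
    then show ?case using H by auto
  next
    case (insert i S)
    then obtain H' x where *: "partial_character H'" "H \<subseteq> H'" "\<forall>i\<in>S. (axis i 1, x i) \<in> H'" by blast
    from partial_character_extend[OF *(1), of "axis i 1"] obtain H'' u
      where "partial_character H''" "H' \<subseteq> H''" "(axis i 1, u) \<in> H''" by blast
    then show ?case using * insert(2) by (intro exI[of _ H''] exI[of _ "x(i := u)"]) auto
  qed
  from this[of UNIV] obtain H' x where H': "partial_character H'" "H \<subseteq> H'" and x: "\<And>i. (axis i 1, x i) \<in> H'"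
    by auto
  have "(\<Sum>i\<in>S. (v $ i) *s axis i 1, \<Prod>i\<in>S. x i powi (v $ i)) \<in> H'" if "finite S" for S v
    using that
  proof (induction S)
    case empty
    then show ?case using H'(1) unfolding partial_character_def by simp
  next
    case (insert i S)
    then show ?case
      using partial_character_mult[OF H'(1) partial_character_power[OF H'(1) x[of i]] insert.IH] by simp
  qed
  moreover have "(\<Sum>i\<in>UNIV. (v $ i) *s axis i 1) = v" for v :: "int ^ 'n"
    using basis_expansion[of v] .
  ultimately have lx: "(v, laurent x v) \<in> H'" for v unfolding laurent_def by (metis finite_class.finite_UNIV)
  have "laurent x (p a) = w a" if a: "a \<in> I" for a
  proof -
    have e: "(if b = a then 1 else 0) *s p b = (if b = a then p b else 0)" for b by (simp add: vec_eq_iff)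
    have "(p a, w a) \<in> H"
      unfolding H_def using a I
      by (intro CollectI exI[of _ "\<lambda>b. if b = a then 1 else 0"]) (simp add: e if_distrib[of "\<lambda>k. _ powi k"] cong: if_cong)
    then show ?thesis using partial_character_unique[OF H'(1) lx] H'(2) by blast
  qed
  moreover have "x i \<noteq> 0" for i using x[of i] H'(1) unfolding partial_character_def by blast
  ultimately show ?thesis by blast
qed

section \<open>Lattice bases from general position\<close>

lemma det_Ints:
  fixes M :: "real ^ 'n ^ 'n"
  assumes "\<And>i j. M $ i $ j \<in> \<int>"
  shows "det M \<in> \<int>"
  unfolding det_def using assms by (intro Ints_sum Ints_mult Ints_prod) auto

text \<open>
  Vectors that lie in no common hyperplane through 0 form an invertible integer matrix. By the rule of
  Cramer its inverse becomes integral after multiplication by the determinant.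
\<close>
lemma lattice_basis:
  fixes v :: "'n::finite \<Rightarrow> int ^ 'n"
  assumes span: "\<And>u. (\<forall>j. u \<bullet> real_point (v j) = 0) \<Longrightarrow> u = 0"
  shows "\<exists>d>0. \<exists>N. \<forall>i. d *s axis i 1 = (\<Sum>j\<in>UNIV. N i j *s v j)"
    and "(\<Sum>j\<in>UNIV. e j *s v j) = 0 \<Longrightarrow> e j = 0"
proof -
  define M :: "real ^ 'n ^ 'n" where "M = (\<chi> i j. real_of_int (v j $ i))"
  have "transpose M *v u = 0 \<Longrightarrow> u = 0" for u
  proof (rule span, rule allI)
    fix j assume *: "transpose M *v u = 0"
    have "(transpose M *v u) $ j = u \<bullet> real_point (v j)"
      by (simp add: matrix_vector_mult_def transpose_def M_def inner_vec_def real_point_def mult.commute)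
    then show "u \<bullet> real_point (v j) = 0" using * by simp
  qed
  then have "\<exists>B. B ** transpose M = mat 1" unfolding matrix_left_invertible_ker by blast
  then have dt: "det M \<noteq> 0"
    by (metis det_transpose invertible_det_nz invertible_left_inverse)
  have Ml: "M *v (\<chi> j. real_of_int (c j)) = real_point (\<Sum>j\<in>UNIV. c j *s v j)" for c
    by (simp add: vec_eq_iff matrix_vector_mult_def M_def real_point_def mult.commute)
  {
    assume "(\<Sum>j\<in>UNIV. e j *s v j) = 0"
    then have "M *v (\<chi> j. real_of_int (e j)) = 0" unfolding Ml by (simp add: real_point_def vec_eq_iff)
    then have "(\<chi> j. real_of_int (e j)) = 0" using dt by (metis invertible_det_nz matrix_left_invertible_ker invertible_def)
    then show "e j = 0" by (simp add: vec_eq_iff)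
  }
  have MZ: "M $ i $ j \<in> \<int>" for i j by (simp add: M_def)
  then have "det M \<in> \<int>" by (rule det_Ints)
  then obtain D where D: "det M = of_int D" by (elim Ints_cases)
  define C where "C = (\<lambda>k i. \<lfloor>det (\<chi> i' j. if j = k then axis i 1 $ i' else M $ i' $ j)\<rfloor>)"
  have C: "of_int (C k i) = det (\<chi> i' j. if j = k then axis i 1 $ i' else M $ i' $ j)" for k i
    unfolding C_def using MZ by (intro of_int_floor det_Ints) (auto simp: axis_def)
  have DC: "D *s axis i 1 = (\<Sum>j\<in>UNIV. C j i *s v j)" for i
  proof -
    have "M *v (\<chi> k. of_int (C k i) / det M) = axis i 1"
      using cramer[OF dt, of "\<chi> k. of_int (C k i) / det M" "axis i 1"] unfolding C by blast
    then have "(\<Sum>j\<in>UNIV. M $ k $ j * (of_int (C j i) / det M)) = axis i 1 $ k" for k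
      by (simp add: vec_eq_iff matrix_vector_mult_def)
    then have "(\<Sum>j\<in>UNIV. M $ k $ j * of_int (C j i)) = det M * axis i 1 $ k" for k
      using dt by (simp add: sum_divide_distrib[symmetric] field_simps)
    then have "real_of_int (\<Sum>j\<in>UNIV. v j $ k * C j i) = of_int (D * axis i 1 $ k)" for k
      unfolding D by (simp add: M_def axis_def)
    then have "(\<Sum>j\<in>UNIV. v j $ k * C j i) = D * axis i 1 $ k" for k by (simp only: of_int_eq_iff)
    then show ?thesis by (simp add: vec_eq_iff mult.commute)
  qed
  have "D \<noteq> 0" using dt D by auto
  \<comment> \<open>The determinant may be negative; its sign is moved into the coefficients.\<close>
  show "\<exists>d>0. \<exists>N. \<forall>i. d *s axis i 1 = (\<Sum>j\<in>UNIV. N i j *s v j)"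
  proof (intro exI[of _ "\<bar>D\<bar>"] exI[of _ "\<lambda>i j. sgn D * C j i"] conjI allI)
    fix i
    have "sgn D *s (D *s axis i 1) = sgn D *s (\<Sum>j\<in>UNIV. C j i *s v j)" using DC by simp
    then show "\<bar>D\<bar> *s axis i 1 = (\<Sum>j\<in>UNIV. (sgn D * C j i) *s v j)"
      by (simp add: vec_eq_iff sum_distrib_left mult.assoc abs_sgn mult.commute[of "sgn D" D])
  qed (use \<open>D \<noteq> 0\<close> in simp)
qed

lemma general_position_basis:
  fixes A :: "(int ^ 'n::finite) set"
  assumes A: "no_hyperplane_subset A" and S: "insert b S \<subseteq> A" "b \<notin> S" "card S = CARD('n)"
  shows "\<exists>d>0. \<exists>N. \<forall>i. d *s axis i 1 = (\<Sum>a\<in>S. N i a *s (a - b))"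
    and "(\<Sum>a\<in>S. e a *s (a - b)) = 0 \<Longrightarrow> a \<in> S \<Longrightarrow> e a = 0"
proof -
  have fin: "finite S" using S(3) by (metis card.infinite zero_less_card_finite less_irrefl)
  obtain f where f: "bij_betw f (UNIV :: 'n set) S"
    using finite_same_card_bij[OF finite_class.finite_UNIV fin] S(3) by auto
  have span: "u = 0" if "\<forall>j. u \<bullet> real_point (f j - b) = 0" for u
  proof (rule ccontr)
    assume "u \<noteq> 0"
    have "real_point (f j - b) = real_point (f j) - real_point b" for j
      by (simp add: real_point_def vec_eq_iff)
    then have "u \<bullet> real_point (f j) = u \<bullet> real_point b" for j
      using that by (simp add: inner_diff_right)
    then have "real_point ` insert b S \<subseteq> {x. u \<bullet> x = u \<bullet> real_point b}"
      using f unfolding bij_betw_def by auto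
    moreover have "card (insert b S) = CARD('n) + 1" using S fin by simp
    ultimately show False using A S(1) \<open>u \<noteq> 0\<close> unfolding no_hyperplane_subset_def affine_hyperplane_def by blast
  qed
  have re: "(\<Sum>j\<in>UNIV. h (f j)) = sum h S" for h :: "int ^ 'n \<Rightarrow> int ^ 'n"
    using sum.reindex_bij_betw[OF f] .
  from lattice_basis(1)[of "\<lambda>j. f j - b", OF span] obtain d N where
    d: "d > 0" "\<And>i. d *s axis i 1 = (\<Sum>j\<in>UNIV. N i j *s (f j - b))" by blast
  define g where "g = inv_into UNIV f"
  have "d *s axis i 1 = (\<Sum>a\<in>S. N i (g a) *s (a - b))" for i
    unfolding d(2) re[symmetric] g_def using f by (simp add: bij_betw_def inv_into_f_f)
  then show "\<exists>d>0. \<exists>N. \<forall>i. d *s axis i 1 = (\<Sum>a\<in>S. N i a *s (a - b))"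
    using d(1) by (intro exI[of _ d]) (auto intro!: exI[of _ "\<lambda>i a. N i (g a)"])
  show "e a = 0" if "(\<Sum>a\<in>S. e a *s (a - b)) = 0" "a \<in> S"
  proof -
    have "(\<Sum>j\<in>UNIV. e (f j) *s (f j - b)) = 0"
      using that(1) re[of "\<lambda>a. e a *s (a - b)"] by simp
    then have "e (f j) = 0" for j using lattice_basis(2)[of "\<lambda>j. f j - b" "\<lambda>j. e (f j)", OF span] by blast
    then show ?thesis using f \<open>a \<in> S\<close> unfolding bij_betw_def by auto
  qed
qed

section \<open>Substitution into polynomials\<close>

text \<open>
  One notion of substitution covers the three homomorphisms below: evaluation at a point, the
  embedding into the rational functions, and restriction to a parametrised curve.
\<close>
definition mpoly_subst :: "('k \<Rightarrow> 'r) \<Rightarrow> ('n::finite \<Rightarrow> 'r) \<Rightarrow> ('n, 'k::zero) mpoly \<Rightarrow> 'r::comm_ring_1"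
  where "mpoly_subst \<kappa> x p =
    (\<Sum>m\<in>Poly_Mapping.keys p. \<kappa> (Poly_Mapping.lookup p m) * (\<Prod>i\<in>UNIV. x i ^ Poly_Mapping.lookup m i))"

definition mpoly_var :: "'n \<Rightarrow> ('n, 'k::zero_neq_one) mpoly"
  where "mpoly_var j = Poly_Mapping.single (Poly_Mapping.single j 1) 1"

lemma mpoly_expansion: "p = (\<Sum>m\<in>Poly_Mapping.keys p. Poly_Mapping.single m (Poly_Mapping.lookup p m))"
proof (rule poly_mapping_eqI)
  fix k
  show "Poly_Mapping.lookup p k = Poly_Mapping.lookup (\<Sum>m\<in>Poly_Mapping.keys p. Poly_Mapping.single m (Poly_Mapping.lookup p m)) k"
    by (cases "k \<in> Poly_Mapping.keys p")
      (auto simp: lookup_sum lookup_single when_def in_keys_iff cong: if_cong)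
qed

locale scalar_hom =
  fixes \<kappa> :: "'k::field \<Rightarrow> 'r::comm_ring_1"
  assumes scalar_one [simp]: "\<kappa> 1 = 1"
    and scalar_add [simp]: "\<kappa> (a + b) = \<kappa> a + \<kappa> b"
    and scalar_mult [simp]: "\<kappa> (a * b) = \<kappa> a * \<kappa> b"
begin

lemma scalar_zero [simp]: "\<kappa> 0 = 0"
  using scalar_add[of 0 0] by simp

lemma scalar_minus [simp]: "\<kappa> (- a) = - \<kappa> a"
  using scalar_add[of a "- a"] by (simp add: eq_neg_iff_add_eq_0 add.commute)

lemma scalar_power [simp]: "\<kappa> (a ^ n) = \<kappa> a ^ n"
  by (induction n) auto

lemma scalar_prod: "\<kappa> (prod f A) = (\<Prod>i\<in>A. \<kappa> (f i))"
  by (induction A rule: infinite_finite_induct) auto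

lemma scalar_sum: "\<kappa> (sum f A) = (\<Sum>i\<in>A. \<kappa> (f i))"
  by (induction A rule: infinite_finite_induct) auto

lemma subst_superset:
  assumes "finite S" "Poly_Mapping.keys p \<subseteq> S"
  shows "mpoly_subst \<kappa> x p =
    (\<Sum>m\<in>S. \<kappa> (Poly_Mapping.lookup p m) * (\<Prod>i\<in>UNIV. x i ^ Poly_Mapping.lookup m i))"
  unfolding mpoly_subst_def using assms
  by (intro sum.mono_neutral_left) (auto simp: in_keys_iff)

lemma subst_single [simp]:
  "mpoly_subst \<kappa> x (Poly_Mapping.single m c) = \<kappa> c * (\<Prod>i\<in>UNIV. x i ^ Poly_Mapping.lookup m i)"
  by (subst subst_superset[of "{m}"]) auto

lemma subst_zero [simp]: "mpoly_subst \<kappa> x 0 = 0"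
  by (simp add: mpoly_subst_def)

lemma subst_add [simp]: "mpoly_subst \<kappa> x (p + q) = mpoly_subst \<kappa> x p + mpoly_subst \<kappa> x q"
proof -
  let ?S = "Poly_Mapping.keys p \<union> Poly_Mapping.keys q"
  have "Poly_Mapping.keys (p + q) \<subseteq> ?S" by (rule keys_add)
  then show ?thesis
    by (simp add: subst_superset[of ?S] lookup_add distrib_right sum.distrib)
qed

lemma subst_sum: "mpoly_subst \<kappa> x (sum f A) = (\<Sum>i\<in>A. mpoly_subst \<kappa> x (f i))"
  by (induction A rule: infinite_finite_induct) auto

lemma subst_mult [simp]: "mpoly_subst \<kappa> x (p * q) = mpoly_subst \<kappa> x p * mpoly_subst \<kappa> x q"
proof -
  have *: "mpoly_subst \<kappa> x (Poly_Mapping.single m a * Poly_Mapping.single n b) =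
      mpoly_subst \<kappa> x (Poly_Mapping.single m a) * mpoly_subst \<kappa> x (Poly_Mapping.single n b)" for m n a b
    by (simp add: mult_single lookup_add power_add prod.distrib mult_ac)
  have "mpoly_subst \<kappa> x (p * q) = (\<Sum>m\<in>Poly_Mapping.keys p. \<Sum>n\<in>Poly_Mapping.keys q.
     mpoly_subst \<kappa> x (Poly_Mapping.single m (Poly_Mapping.lookup p m) * Poly_Mapping.single n (Poly_Mapping.lookup q n)))"
    by (subst (1) mpoly_expansion[of p], subst (1) mpoly_expansion[of q]) (simp only: sum_product subst_sum)
  also have "\<dots> = mpoly_subst \<kappa> x p * mpoly_subst \<kappa> x q"
    unfolding * by (subst (3) mpoly_expansion[of p], subst (3) mpoly_expansion[of q]) (simp only: sum_product subst_sum)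
  finally show ?thesis .
qed

lemma subst_const [simp]: "mpoly_subst \<kappa> x (mpoly_const c) = \<kappa> c"
  by (simp add: mpoly_const_def)

lemma subst_one [simp]: "mpoly_subst \<kappa> x 1 = 1"
  using subst_const[of x 1] by (simp add: mpoly_const_def)

lemma subst_uminus [simp]: "mpoly_subst \<kappa> x (- p) = - mpoly_subst \<kappa> x p"
  using subst_add[of x p "- p"] by (simp add: eq_neg_iff_add_eq_0 add.commute)

lemma subst_diff [simp]: "mpoly_subst \<kappa> x (p - q) = mpoly_subst \<kappa> x p - mpoly_subst \<kappa> x q"
  using subst_add[of x p "- q"] by simp

end

lemma (in scalar_hom) subst_var: "mpoly_subst \<kappa> x (mpoly_var j) = x j"
proof -
  have "(\<Prod>i\<in>UNIV. x i ^ Poly_Mapping.lookup (Poly_Mapping.single j 1) i) = (\<Prod>i\<in>UNIV. if i = j then x i else 1)"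
    by (rule prod.cong) (auto simp: lookup_single when_def)
  then show ?thesis unfolding mpoly_var_def subst_single by simp
qed

lemma mpoly_eval_subst: "mpoly_eval p z = mpoly_subst id (($) z) p"
  by (simp add: mpoly_eval_def mpoly_subst_def)

interpretation id_hom: scalar_hom id
  by unfold_locales auto

lemma mpoly_const_add: "mpoly_const (a + b) = mpoly_const a + mpoly_const b"
  by (simp add: mpoly_const_def single_add)

lemma mpoly_const_mult: "mpoly_const (a * b) = mpoly_const a * (mpoly_const b :: ('n, 'k::comm_semiring_1) mpoly)"
  by (simp add: mpoly_const_def mult_single)

lemma mpoly_const_one: "mpoly_const 1 = 1"
  by (simp add: mpoly_const_def)

lemma mpoly_var_power: "mpoly_var j ^ k = Poly_Mapping.single (Poly_Mapping.single j k) (1::'k::field)"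
  by (induction k) (simp_all add: mpoly_var_def mult_single single_add[symmetric])

lemma mpoly_monomial:
  "Poly_Mapping.single m c = mpoly_const (c::'k::field) * (\<Prod>j\<in>(UNIV::'n::finite set). mpoly_var j ^ Poly_Mapping.lookup m j)"
proof -
  have "(\<Prod>j\<in>J. mpoly_var j ^ Poly_Mapping.lookup m j) =
     Poly_Mapping.single (\<Sum>j\<in>J. Poly_Mapping.single j (Poly_Mapping.lookup m j)) (1::'k)" for J :: "'n set"
    by (induction J rule: infinite_finite_induct) (auto simp: mpoly_var_power mult_single)
  moreover have "(\<Sum>j\<in>(UNIV::'n set). Poly_Mapping.single j (Poly_Mapping.lookup m j)) = m"
    by (rule poly_mapping_eqI) (simp add: lookup_sum lookup_single when_def)
  ultimately show ?thesis by (simp add: mpoly_const_def mult_single)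
qed

section \<open>The local ring and its ideals\<close>

definition scalar :: "'k::field \<Rightarrow> ('n::{finite,linorder}, 'k) mpoly fract"
  where "scalar c = Fract (mpoly_const c) 1"

definition coordinate :: "'n::{finite,linorder} \<Rightarrow> ('n, 'k::field) mpoly fract"
  where "coordinate j = Fract (mpoly_var j) 1"

interpretation scalar: scalar_hom scalar
  by unfold_locales (simp_all add: scalar_def mpoly_const_add mpoly_const_mult mpoly_const_one fract_collapse)

lemma Fract_one_add: "Fract (p + q) 1 = Fract p 1 + Fract q (1::'a::idom)"
  by simp

lemma Fract_one_mult: "Fract (p * q) 1 = Fract p 1 * Fract q (1::'a::idom)"
  by simp

lemma Fract_sum: "Fract (sum f A) 1 = (\<Sum>i\<in>A. Fract (f i) (1::'a::idom))"
  by (induction A rule: infinite_finite_induct) (simp_all add: fract_collapse del: add_fract add: Fract_one_add)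

lemma Fract_prod: "Fract (prod f A) 1 = (\<Prod>i\<in>A. Fract (f i) (1::'a::idom))"
  by (induction A rule: infinite_finite_induct) (auto simp: fract_collapse Fract_one_mult simp del: mult_fract)

lemma Fract_power: "Fract (p ^ k) 1 = Fract p (1::'a::idom) ^ k"
  by (induction k) (auto simp: fract_collapse Fract_one_mult simp del: mult_fract)

text \<open>
  Identities between the monomials \<open>x\<^sup>a\<close> hold in every field, so seeing a polynomial as its own value at
  the coordinate functions transports the elimination to the field of rational functions.
\<close>
lemma Fract_subst: "Fract p 1 = mpoly_subst scalar coordinate p"
proof -
  have "Fract p 1 = (\<Sum>m\<in>Poly_Mapping.keys p. Fract (Poly_Mapping.single m (Poly_Mapping.lookup p m)) 1)"
    by (subst mpoly_expansion) (rule Fract_sum)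
  also have "\<dots> = mpoly_subst scalar coordinate p"
    unfolding mpoly_subst_def
  proof (rule sum.cong)
    fix m
    have "Fract (Poly_Mapping.single m (Poly_Mapping.lookup p m)) 1 =
      Fract (mpoly_const (Poly_Mapping.lookup p m)) 1 * Fract (\<Prod>j\<in>UNIV. mpoly_var j ^ Poly_Mapping.lookup m j) 1"
      unfolding mpoly_monomial[of m] by simp
    then show "Fract (Poly_Mapping.single m (Poly_Mapping.lookup p m)) 1 =
       scalar (Poly_Mapping.lookup p m) * (\<Prod>i\<in>UNIV. coordinate i ^ Poly_Mapping.lookup m i)"
      by (simp add: scalar_def coordinate_def Fract_prod Fract_power)
  qed simp
  finally show ?thesis .
qed

lemma mpoly_eval_simps [simp]:
  "mpoly_eval 0 z = 0" "mpoly_eval 1 z = 1" "mpoly_eval (- p) z = - mpoly_eval p z"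
  "mpoly_eval (p + q) z = mpoly_eval p z + mpoly_eval q z"
  "mpoly_eval (p - q) z = mpoly_eval p z - mpoly_eval q z"
  "mpoly_eval (p * q) z = mpoly_eval p z * mpoly_eval q z"
  "mpoly_eval (mpoly_const c) z = c"
  "mpoly_eval (mpoly_var j) z = z $ j"
  for z :: "'k::field ^ 'n::finite"
  by (simp_all add: mpoly_eval_subst mpoly_var_def lookup_single when_def if_distrib[of "\<lambda>k. _ ^ k"] cong: if_cong)

text \<open>
  The value of a rational function at \<open>z\<close>, as a relation: it is defined exactly on the local ring, and the
  elements with a nonzero value are its units.
\<close>
definition residue :: "'k ^ 'n::{finite,linorder} \<Rightarrow> ('n::{finite,linorder}, 'k::field) mpoly fract \<Rightarrow> 'k \<Rightarrow> bool"
  where "residue z r c \<longleftrightarrow> (\<exists>p q. r = Fract p q \<and> mpoly_eval q z \<noteq> 0 \<and> mpoly_eval p z = c * mpoly_eval q z)"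

abbreviation "local_carrier z \<equiv> carrier (local_ring z)"

lemma local_ring_simps [simp]:
  "monoid.mult (local_ring z) = (*)" "one (local_ring z) = 1"
  "ring.zero (local_ring z) = 0" "add (local_ring z) = (+)"
  by (simp_all add: local_ring_def)

lemma local_carrier_iff: "r \<in> local_carrier z \<longleftrightarrow> (\<exists>c. residue z r c)"
proof
  assume "r \<in> local_carrier z"
  then obtain p q where "r = Fract p q" "mpoly_eval q z \<noteq> 0" by (auto simp: local_ring_def)
  then have "residue z r (mpoly_eval p z / mpoly_eval q z)"
    unfolding residue_def by (intro exI[of _ p] exI[of _ q]) simp
  then show "\<exists>c. residue z r c" ..
qed (auto simp: local_ring_def residue_def)

lemma residue_scalar: "residue z (scalar c) c"
  unfolding residue_def scalar_def by (intro exI[of _ "mpoly_const c"] exI[of _ 1]) simp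

lemma residue_coordinate: "residue z (coordinate j) (z $ j)"
  unfolding residue_def coordinate_def by (intro exI[of _ "mpoly_var j"] exI[of _ 1]) simp

lemma residue_add:
  assumes "residue z r c" "residue z r' c'"
  shows "residue z (r + r') (c + c')"
proof -
  obtain p q where 1: "r = Fract p q" "mpoly_eval q z \<noteq> 0" "mpoly_eval p z = c * mpoly_eval q z"
    using assms(1) unfolding residue_def by blast
  obtain p' q' where 2: "r' = Fract p' q'" "mpoly_eval q' z \<noteq> 0" "mpoly_eval p' z = c' * mpoly_eval q' z"
    using assms(2) unfolding residue_def by blast
  have "q \<noteq> 0" "q' \<noteq> 0" using 1 2 by auto
  then show ?thesis using 1 2 unfolding residue_def
    by (intro exI[of _ "p * q' + p' * q"] exI[of _ "q * q'"]) (simp add: algebra_simps)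
qed

lemma residue_mult:
  assumes "residue z r c" "residue z r' c'"
  shows "residue z (r * r') (c * c')"
proof -
  obtain p q where 1: "r = Fract p q" "mpoly_eval q z \<noteq> 0" "mpoly_eval p z = c * mpoly_eval q z"
    using assms(1) unfolding residue_def by blast
  obtain p' q' where 2: "r' = Fract p' q'" "mpoly_eval q' z \<noteq> 0" "mpoly_eval p' z = c' * mpoly_eval q' z"
    using assms(2) unfolding residue_def by blast
  show ?thesis using 1 2 unfolding residue_def
    by (intro exI[of _ "p * p'"] exI[of _ "q * q'"]) simp
qed

lemma residue_inverse:
  assumes "residue z r c" "c \<noteq> 0"
  shows "residue z (inverse r) (inverse c)" "r \<noteq> 0"
proof -
  obtain p q where 1: "r = Fract p q" "mpoly_eval q z \<noteq> 0" "mpoly_eval p z = c * mpoly_eval q z"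
    using assms(1) unfolding residue_def by blast
  have "p \<noteq> 0" "q \<noteq> 0" using 1 assms(2) by auto
  then show "r \<noteq> 0" using 1(1) by (simp add: Zero_fract_def eq_fract)
  show "residue z (inverse r) (inverse c)" using 1 assms(2) unfolding residue_def
    by (intro exI[of _ q] exI[of _ p]) simp
qed

lemma residue_minus: "residue z r c \<Longrightarrow> residue z (- r) (- c)"
  using residue_mult[OF residue_scalar[of z "- 1"], of r c] by simp

lemma residue_diff: "residue z r c \<Longrightarrow> residue z r' c' \<Longrightarrow> residue z (r - r') (c - c')"
  using residue_add[OF _ residue_minus, of z r c r' c'] by simp

lemma residue_power: "residue z r c \<Longrightarrow> residue z (r ^ k) (c ^ k)"
proof (induction k)
  case (Suc k)
  then show ?case using residue_mult[of z r c "r ^ k" "c ^ k"] by simp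
qed (use residue_scalar[of z 1] in simp)

lemma residue_powi: "residue z r c \<Longrightarrow> c \<noteq> 0 \<Longrightarrow> residue z (r powi k) (c powi k)"
  using residue_power[of z r c "nat k"] residue_power[OF residue_inverse(1), of z r c "nat (- k)"]
  unfolding power_int_def by auto

lemma residue_prod: "(\<And>i. i \<in> A \<Longrightarrow> residue z (f i) (c i)) \<Longrightarrow> residue z (prod f A) (prod c A)"
proof (induction A rule: infinite_finite_induct)
  case (insert i A)
  then show ?case using residue_mult[of z "f i" "c i" "prod f A" "prod c A"] by simp
qed (use residue_scalar[of z 1] in simp_all)

lemma local_carrier_closed [intro]:
  "scalar c \<in> local_carrier z" "coordinate j \<in> local_carrier z" "0 \<in> local_carrier z" "1 \<in> local_carrier z"
  "r \<in> local_carrier z \<Longrightarrow> r' \<in> local_carrier z \<Longrightarrow> r + r' \<in> local_carrier z"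
  "r \<in> local_carrier z \<Longrightarrow> r' \<in> local_carrier z \<Longrightarrow> r - r' \<in> local_carrier z"
  "r \<in> local_carrier z \<Longrightarrow> r' \<in> local_carrier z \<Longrightarrow> r * r' \<in> local_carrier z"
  "r \<in> local_carrier z \<Longrightarrow> - r \<in> local_carrier z"
  "r \<in> local_carrier z \<Longrightarrow> r ^ k \<in> local_carrier z"
  "Fract p 1 \<in> local_carrier z"
proof -
  show "scalar c \<in> local_carrier z" "coordinate j \<in> local_carrier z"
    using residue_scalar residue_coordinate local_carrier_iff by metis+
  show "0 \<in> local_carrier z" "1 \<in> local_carrier z"
    using residue_scalar[of z 0] residue_scalar[of z 1] unfolding local_carrier_iff by auto
  show "Fract p 1 \<in> local_carrier z"
    unfolding local_ring_def by simp (intro exI[of _ p] exI[of _ 1], simp)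
  assume "r \<in> local_carrier z"
  then obtain c where r: "residue z r c" unfolding local_carrier_iff ..
  show "- r \<in> local_carrier z" "r ^ k \<in> local_carrier z"
    using residue_minus[OF r] residue_power[OF r] local_carrier_iff by metis+
  assume "r' \<in> local_carrier z"
  then obtain c' where r': "residue z r' c'" unfolding local_carrier_iff ..
  show "r + r' \<in> local_carrier z" "r - r' \<in> local_carrier z" "r * r' \<in> local_carrier z"
    using residue_add[OF r r'] residue_diff[OF r r'] residue_mult[OF r r'] local_carrier_iff by metis+
qed

lemma cring_local_ring: "cring (local_ring z)"
proof (rule cringI)
  show "abelian_group (local_ring z)"
  proof (rule abelian_groupI)
    fix x assume "x \<in> local_carrier z"
    then show "\<exists>y\<in>local_carrier z. y \<oplus>\<^bsub>local_ring z\<^esub> x = \<zero>\<^bsub>local_ring z\<^esub>"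
      by (intro bexI[of _ "- x"]) auto
  qed (auto simp: algebra_simps)
  show "Group.comm_monoid (local_ring z)"
    by (rule comm_monoidI) (auto simp: algebra_simps)
qed (auto simp: algebra_simps)

lemma local_ideal_ideal: "ideal (local_ideal F z) (local_ring z)"
proof -
  interpret cring "local_ring z" by (rule cring_local_ring)
  show ?thesis unfolding local_ideal_def by (rule genideal_ideal) auto
qed

lemma local_ideal_props:
  shows local_ideal_gen: "Fract (F j) 1 \<in> local_ideal F z"
    and local_ideal_add: "a \<in> local_ideal F z \<Longrightarrow> b \<in> local_ideal F z \<Longrightarrow> a + b \<in> local_ideal F z"
    and local_ideal_mult: "r \<in> local_carrier z \<Longrightarrow> a \<in> local_ideal F z \<Longrightarrow> r * a \<in> local_ideal F z"
    and local_ideal_zero: "0 \<in> local_ideal F z"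
proof -
  interpret cring "local_ring z" by (rule cring_local_ring)
  interpret I: ideal "local_ideal F z" "local_ring z" by (rule local_ideal_ideal)
  have "range (\<lambda>j. Fract (F j) 1) \<subseteq> local_carrier z" by auto
  from genideal_self[OF this] show "Fract (F j) 1 \<in> local_ideal F z" unfolding local_ideal_def by blast
  show "a \<in> local_ideal F z \<Longrightarrow> b \<in> local_ideal F z \<Longrightarrow> a + b \<in> local_ideal F z" using I.a_closed by simp
  show "r \<in> local_carrier z \<Longrightarrow> a \<in> local_ideal F z \<Longrightarrow> r * a \<in> local_ideal F z" using I.I_l_closed by simp
  show "0 \<in> local_ideal F z" using I.zero_closed by simp
qed

lemma local_ideal_minimal:
  assumes "ideal T (local_ring z)" "\<And>j. Fract (F j) 1 \<in> T"
  shows "local_ideal F z \<subseteq> T"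
proof -
  interpret cring "local_ring z" by (rule cring_local_ring)
  show ?thesis unfolding local_ideal_def using assms by (intro genideal_minimal) auto
qed

lemma const_poly_hom: "scalar_hom (\<lambda>c::'k::field. [:c:])"
  by unfold_locales (auto simp: one_pCons)

interpretation cpoly: scalar_hom "\<lambda>c::'k::field. [:c:]"
  by (rule const_poly_hom)

abbreviation along_arc :: "('n::finite \<Rightarrow> 'k::field poly) \<Rightarrow> ('n, 'k) mpoly \<Rightarrow> 'k poly"
  where "along_arc \<equiv> mpoly_subst (\<lambda>c. [:c:])"

lemma poly_along_arc:
  assumes "\<And>i. poly (\<xi> i) 0 = z $ i"
  shows "poly (along_arc \<xi> p) 0 = mpoly_eval p z"
  by (simp add: mpoly_subst_def mpoly_eval_def poly_sum poly_prod assms)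

text \<open>
  For a curve \<open>\<xi>\<close> that passes through \<open>z\<close> at the parameter value 0, these are the functions that vanish
  there to order \<open>N\<close> along the curve. An ideal of the local ring that
  contains the equations of a system contains their local ideal, so such ideals bound it from above.
\<close>
definition arc_ideal :: "('n::{finite,linorder} \<Rightarrow> 'k::field poly) \<Rightarrow> nat \<Rightarrow> 'k ^ 'n::{finite,linorder} \<Rightarrow> ('n, 'k) mpoly fract set"
  where "arc_ideal \<xi> N z = {Fract p q | p q. mpoly_eval q z \<noteq> 0 \<and> [:0, 1:] ^ N dvd along_arc \<xi> p}"

lemma arc_ideal_ideal: "ideal (arc_ideal \<xi> N z) (local_ring z)"
proof -
  interpret R: cring "local_ring z" by (rule cring_local_ring)
  have add: "a + b \<in> arc_ideal \<xi> N z" if "a \<in> arc_ideal \<xi> N z" "b \<in> arc_ideal \<xi> N z" for a b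
  proof -
    from that obtain p q p' q' where
      *: "a = Fract p q" "mpoly_eval q z \<noteq> 0" "[:0, 1:] ^ N dvd along_arc \<xi> p"
        "b = Fract p' q'" "mpoly_eval q' z \<noteq> 0" "[:0, 1:] ^ N dvd along_arc \<xi> p'"
      unfolding arc_ideal_def by blast
    then have "q \<noteq> 0" "q' \<noteq> 0" by auto
    then show ?thesis using * unfolding arc_ideal_def
      by (intro CollectI exI[of _ "p * q' + p' * q"] exI[of _ "q * q'"]) (simp add: dvd_add dvd_mult2)
  qed
  have mult: "r * a \<in> arc_ideal \<xi> N z" if "r \<in> local_carrier z" "a \<in> arc_ideal \<xi> N z" for r a
  proof -
    from that obtain p q p' q' where
      *: "r = Fract p q" "mpoly_eval q z \<noteq> 0"
        "a = Fract p' q'" "mpoly_eval q' z \<noteq> 0" "[:0, 1:] ^ N dvd along_arc \<xi> p'"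
      unfolding arc_ideal_def local_ring_def by auto
    then show ?thesis unfolding arc_ideal_def
      by (intro CollectI exI[of _ "p * p'"] exI[of _ "q * q'"]) (simp add: dvd_mult)
  qed
  have sub: "arc_ideal \<xi> N z \<subseteq> local_carrier z" by (auto simp: arc_ideal_def local_ring_def)
  have zero: "0 \<in> arc_ideal \<xi> N z" unfolding arc_ideal_def
    by (intro CollectI exI[of _ 0] exI[of _ 1]) (simp add: fract_collapse)
  show ?thesis
  proof (rule idealI)
    show "Ring.ring (local_ring z)" by (rule R.ring_axioms)
    show "subgroup (arc_ideal \<xi> N z) (add_monoid (local_ring z))"
    proof (rule group.subgroupI)
      show "group (add_monoid (local_ring z))" by (rule R.a_group)
      fix a assume a: "a \<in> arc_ideal \<xi> N z"
      then have ac: "a \<in> local_carrier z" using sub by blast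
      have "\<ominus>\<^bsub>local_ring z\<^esub> a = - a" by (rule R.minus_equality) (use ac in auto)
      moreover have "- a \<in> arc_ideal \<xi> N z" using mult[OF _ a, of "- 1"] by auto
      ultimately show "inv\<^bsub>add_monoid (local_ring z)\<^esub> a \<in> arc_ideal \<xi> N z" by (simp add: a_inv_def)
    qed (use sub zero add in auto)
  next
    fix a x assume "a \<in> arc_ideal \<xi> N z" "x \<in> local_carrier z"
    then show "x \<otimes>\<^bsub>local_ring z\<^esub> a \<in> arc_ideal \<xi> N z" "a \<otimes>\<^bsub>local_ring z\<^esub> x \<in> arc_ideal \<xi> N z"
      using mult[of x a] by (simp_all add: mult.commute[of a])
  qed
qed

text \<open>
  Denominators do not vanish at \<open>z\<close>, so along the curve they are prime to the parameter, and the order of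
  vanishing may be read off from any numerator.
\<close>
lemma arc_ideal_polynomial:
  assumes \<xi>: "\<And>i. poly (\<xi> i) 0 = z $ i" and p: "Fract p 1 \<in> arc_ideal \<xi> N z"
  shows "[:0, 1:] ^ N dvd along_arc \<xi> p"
proof -
  obtain p' q where *: "Fract p 1 = Fract p' q" "mpoly_eval q z \<noteq> 0" "[:0, 1:] ^ N dvd along_arc \<xi> p'"
    using p unfolding arc_ideal_def by blast
  have "q \<noteq> 0" using * by auto
  then have "p * q = p'" using *(1) by (simp add: eq_fract)
  then have "[:0, 1:] ^ N dvd along_arc \<xi> p * along_arc \<xi> q" using * by auto
  moreover have "poly (along_arc \<xi> q) 0 \<noteq> 0" using poly_along_arc[OF \<xi>] * by simp
  ultimately show ?thesis by (rule X_power_dvd_mult_cancel)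
qed

section \<open>Dimension of the local quotient\<close>

lemma local_ideal_diff:
  "a \<in> local_ideal F z \<Longrightarrow> b \<in> local_ideal F z \<Longrightarrow> a - b \<in> local_ideal F z"
  using local_ideal_add[of a F z "- 1 * b"] local_ideal_mult[of "- 1" z b F] by auto

definition local_class ::
  "('n::{finite,linorder} \<Rightarrow> ('n, 'k::field) mpoly) \<Rightarrow> 'k ^ 'n::{finite,linorder} \<Rightarrow> ('n, 'k) mpoly fract \<Rightarrow> ('n, 'k) mpoly fract set"
  where "local_class F z r = local_ideal F z +>\<^bsub>local_ring z\<^esub> r"

lemma local_class_eq: "local_class F z r = {a + r | a. a \<in> local_ideal F z}"
  unfolding local_class_def a_r_coset_def r_coset_def by auto

lemma local_class_eq_iff: "local_class F z r = local_class F z r' \<longleftrightarrow> r - r' \<in> local_ideal F z"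
proof
  assume "local_class F z r = local_class F z r'"
  moreover have "r \<in> local_class F z r" unfolding local_class_eq using local_ideal_zero[of F z] by force
  ultimately show "r - r' \<in> local_ideal F z" unfolding local_class_eq by auto
next
  assume d: "r - r' \<in> local_ideal F z"
  have "a + r = (a + (r - r')) + r'" "a + r' = (a - (r - r')) + r" for a by auto
  then show "local_class F z r = local_class F z r'"
    unfolding local_class_eq using d local_ideal_add[of _ F z "r - r'"] local_ideal_diff[of _ F z "r - r'"] by blast
qed

lemma (in ring) dimension_Span_le:
  assumes K: "subfield K R" and "set Us \<subseteq> carrier R"
  shows "\<exists>d\<le>length Us. dimension d K (Span K Us)"
  using assms(2)
proof (induction Us)
  case (Cons u Us)
  then obtain d where d: "d \<le> length Us" "dimension d K (Span K Us)" by auto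
  show ?case
  proof (cases "u \<in> Span K Us")
    case True
    have Us: "set Us \<subseteq> carrier R" using Cons.prems by simp
    have 1: "set (u # Us) \<subseteq> Span K Us" using True Span_base_incl[OF K Us] by simp
    have 2: "set Us \<subseteq> Span K (u # Us)" using Span_base_incl[OF K Cons.prems] by simp
    have "Span K (u # Us) = Span K Us"
      by (rule subset_antisym[OF mono_Span_subset[OF K 1 Us] mono_Span_subset[OF K 2 Cons.prems]])
    then show ?thesis using d by (intro exI[of _ d]) simp
  next
    case False
    then have "dimension (Suc d) K (line_extension K u (Span K Us))"
      using Suc_dim d Cons.prems by simp
    then show ?thesis using d by (intro exI[of _ "Suc d"]) simp
  qed
qed auto

abbreviation "local_dimension_at_most F z D \<equiv> \<exists>d\<le>D. ring.dimension (local_quotient F z) d (local_constants F z) (carrier (local_quotient F z))"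

locale local_zero =
  fixes F :: "'n::{finite,linorder} \<Rightarrow> ('n, 'k::field) mpoly" and z :: "'k ^ 'n::{finite,linorder}"
  assumes zero: "\<And>j. mpoly_eval (F j) z = 0"
begin

abbreviation "Q \<equiv> local_quotient F z"
abbreviation "cls \<equiv> local_class F z"
abbreviation "K \<equiv> local_constants F z"

text \<open>
  The constant curve through \<open>z\<close> shows that all members of the local ideal vanish at \<open>z\<close>.
\<close>
lemma one_notin_local_ideal: "1 \<notin> local_ideal F z"
proof
  define \<xi> where "\<xi> = (\<lambda>i. [:z $ i:])"
  have \<xi>: "poly (\<xi> i) 0 = z $ i" for i by (simp add: \<xi>_def)
  have e: "along_arc \<xi> p = [:mpoly_eval p z:]" for p
    by (simp add: mpoly_subst_def mpoly_eval_def \<xi>_def cpoly.scalar_sum cpoly.scalar_prod)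
  have "Fract (F j) 1 \<in> arc_ideal \<xi> 1 z" for j
    unfolding arc_ideal_def by (intro CollectI exI[of _ "F j"] exI[of _ 1]) (simp add: e zero)
  then have "local_ideal F z \<subseteq> arc_ideal \<xi> 1 z" by (rule local_ideal_minimal[OF arc_ideal_ideal])
  moreover assume "1 \<in> local_ideal F z"
  ultimately have "1 \<in> arc_ideal \<xi> 1 z" by (rule subsetD)
  then have "Fract 1 1 \<in> arc_ideal \<xi> 1 z" unfolding One_fract_def .
  from arc_ideal_polynomial[OF \<xi> this] have "[:0, 1:] dvd (1 :: 'k poly)" by simp
  then obtain q :: "'k poly" where "1 = [:0, 1:] * q" by (rule dvdE)
  then have "poly 1 0 = poly ([:0, 1:] * q) 0" by (rule arg_cong)
  then show False by simp
qed

lemma local_quotient_hom: "ring_hom_ring (local_ring z) Q cls"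
proof -
  interpret I: ideal "local_ideal F z" "local_ring z" by (rule local_ideal_ideal)
  have "local_class F z = (+>\<^bsub>local_ring z\<^esub>) (local_ideal F z)" by (simp add: local_class_def fun_eq_iff)
  then show ?thesis unfolding local_quotient_def using I.rcos_ring_hom_ring by simp
qed

sublocale h: ring_hom_ring "local_ring z" Q cls
  by (rule local_quotient_hom)

lemma cls_simps:
  "r \<in> local_carrier z \<Longrightarrow> r' \<in> local_carrier z \<Longrightarrow> cls (r + r') = cls r \<oplus>\<^bsub>Q\<^esub> cls r'"
  "r \<in> local_carrier z \<Longrightarrow> r' \<in> local_carrier z \<Longrightarrow> cls (r * r') = cls r \<otimes>\<^bsub>Q\<^esub> cls r'"
  "r \<in> local_carrier z \<Longrightarrow> cls r \<in> carrier Q"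
  "cls 0 = \<zero>\<^bsub>Q\<^esub>"
  using h.hom_add[of r r'] h.hom_mult[of r r'] h.hom_closed[of r] h.hom_zero by simp_all

lemma carrier_quotient: "carrier Q = cls ` local_carrier z"
  unfolding local_quotient_def FactRing_def A_RCOSETS_def' local_class_def by auto

lemma constants_eq: "K = range (\<lambda>c. cls (scalar c))"
  unfolding local_constants_def local_class_def scalar_def ..

lemma subfield_constants: "subfield K Q"
proof -
  interpret R: cring "local_ring z" by (rule cring_local_ring)
  let ?S = "local_ring z \<lparr>carrier := range scalar\<rparr>"
  have "cring ?S"
  proof (rule h.R.subcring_iff[THEN iffD1])
    show "range scalar \<subseteq> local_carrier z" by (rule image_subsetI) (rule local_carrier_closed)
    have m: "\<ominus>\<^bsub>local_ring z\<^esub> scalar c = scalar (- c)" for c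
      by (rule h.R.minus_equality) (simp_all add: local_carrier_closed)
    have "\<ominus>\<^bsub>local_ring z\<^esub> a \<in> range scalar" if "a \<in> range scalar" for a
    proof -
      from that obtain c where a: "a = scalar c" by (rule rangeE)
      show ?thesis unfolding a m by (rule rangeI)
    qed
    moreover have "a + b \<in> range scalar" "a * b \<in> range scalar" if ab: "a \<in> range scalar" "b \<in> range scalar"
      for a b :: "('n, 'k) mpoly fract"
    proof -
      from ab(1) obtain c where a: "a = scalar c" by (rule rangeE)
      from ab(2) obtain d where b: "b = scalar d" by (rule rangeE)
      show "a + b \<in> range scalar" unfolding a b scalar.scalar_add[symmetric] by (rule rangeI)
      show "a * b \<in> range scalar" unfolding a b scalar.scalar_mult[symmetric] by (rule rangeI)
    qed
    moreover have "1 \<in> range scalar" by (metis rangeI scalar.scalar_one)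
    moreover have "range scalar \<subseteq> local_carrier z" by (rule image_subsetI) (rule local_carrier_closed)
    ultimately show "subcring (range scalar) (local_ring z)"
      by (intro R.subcringI' h.R.subringI) simp_all
  qed
  then interpret S: cring ?S .
  have "field ?S"
  proof (rule S.cring_fieldI2)
    show "\<zero>\<^bsub>?S\<^esub> \<noteq> \<one>\<^bsub>?S\<^esub>" by simp
    fix a assume a: "a \<in> carrier ?S" "a \<noteq> \<zero>\<^bsub>?S\<^esub>"
    from a(1) obtain c where c: "a = scalar c" by auto
    have "c \<noteq> 0" using a(2) c by auto
    then have "scalar c * scalar (inverse c) = (scalar 1 :: ('n, 'k) mpoly fract)"
      unfolding scalar.scalar_mult[symmetric] by simp
    then have "a \<otimes>\<^bsub>?S\<^esub> scalar (inverse c) = \<one>\<^bsub>?S\<^esub>" using c by simp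
    then show "\<exists>b\<in>carrier ?S. a \<otimes>\<^bsub>?S\<^esub> b = \<one>\<^bsub>?S\<^esub>" by (rule bexI) simp
  qed
  then have "subfield (range scalar) (local_ring z)" 
    by (rule h.R.subfield_iff(1)) (rule image_subsetI, rule local_carrier_closed)
  moreover have "\<one>\<^bsub>Q\<^esub> \<noteq> \<zero>\<^bsub>Q\<^esub>"
  proof -
    have "cls 1 \<noteq> cls 0" unfolding local_class_eq_iff using one_notin_local_ideal by simp
    then show ?thesis using h.hom_one h.hom_zero unfolding local_ring_simps by metis
  qed
  ultimately have "subfield (cls ` range scalar) Q" by (rule h.img_is_subfield(2))
  then show ?thesis unfolding constants_eq image_image .
qed

lemma intersection_multiplicityI:
  assumes "ring.dimension Q d K (carrier Q)"
  shows "intersection_multiplicity F z = enat d"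
proof -
  have "h.S.dim K (carrier Q) = d" using h.S.dimI[OF subfield_constants assms] unfolding over_def .
  then show ?thesis
    unfolding intersection_multiplicity_def Let_def using h.S.finite_dimensionI[OF assms] by (simp only: if_True)
qed

text \<open>
  Substituting the expansion of the remainder into itself produces one further power of \<open>s\<close>.
\<close>
lemma powers_span_modulo_ideal:
  assumes s: "s \<in> local_carrier z"
    and step: "\<And>r. r \<in> local_carrier z \<Longrightarrow> \<exists>c r'. r' \<in> local_carrier z \<and> r - (scalar c + s * r') \<in> local_ideal F z"
    and r: "r \<in> local_carrier z"
  shows "\<exists>c r'. r' \<in> local_carrier z \<and> r - ((\<Sum>i<k. scalar (c i) * s ^ i) + s ^ k * r') \<in> local_ideal F z"
proof (induction k)
  case 0
  show ?case using r local_ideal_zero by (auto intro!: exI[of _ r])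
next
  case (Suc k)
  then obtain c r' where 1: "r' \<in> local_carrier z" "r - ((\<Sum>i<k. scalar (c i) * s ^ i) + s ^ k * r') \<in> local_ideal F z"
    by blast
  obtain c' r'' where 2: "r'' \<in> local_carrier z" "r' - (scalar c' + s * r'') \<in> local_ideal F z"
    using step[OF 1(1)] by blast
  let ?c = "c(k := c')"
  have "s ^ k * (r' - (scalar c' + s * r'')) \<in> local_ideal F z"
    using local_ideal_mult[OF _ 2(2)] s by blast
  from local_ideal_add[OF 1(2) this]
  have "r - ((\<Sum>i<k. scalar (c i) * s ^ i) + scalar c' * s ^ k + s ^ Suc k * r'') \<in> local_ideal F z"
    by (simp add: algebra_simps)
  moreover have "(\<Sum>i<Suc k. scalar (?c i) * s ^ i) = (\<Sum>i<k. scalar (c i) * s ^ i) + scalar c' * s ^ k"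
    by simp
  ultimately have "r - ((\<Sum>i<Suc k. scalar (?c i) * s ^ i) + s ^ Suc k * r'') \<in> local_ideal F z" by simp
  with 2(1) show ?case by blast
qed

lemma sum_carrier: "s \<in> local_carrier z \<Longrightarrow> (\<Sum>i<k. scalar (c i) * s ^ i) \<in> local_carrier z"
  by (induction k) auto

text \<open>
  A local quotient that is generated over \<open>K\<close> by one nilpotent element \<open>s\<close> is spanned by the powers of
  \<open>s\<close> below the exponent of nilpotency.
\<close>
lemma local_dimension_le:
  assumes s: "s \<in> local_carrier z"
    and step: "\<And>r. r \<in> local_carrier z \<Longrightarrow> \<exists>c r'. r' \<in> local_carrier z \<and> r - (scalar c + s * r') \<in> local_ideal F z"
    and nil: "s ^ N \<in> local_ideal F z"
  shows "local_dimension_at_most F z N"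
proof -
  let ?Us = "map (\<lambda>i. cls (s ^ i)) [0..<N]"
  note props = h.S.Span_subgroup_props[OF subfield_constants]
  have Us: "set ?Us \<subseteq> carrier Q" using s by (auto intro!: cls_simps(3) local_carrier_closed)
  have comb: "k \<le> N \<Longrightarrow> cls (\<Sum>i<k. scalar (c i) * s ^ i) \<in> h.S.Span K ?Us" for k c
  proof (induction k)
    case 0
    show ?case using props(2)[OF Us] by (simp add: cls_simps)
  next
    case (Suc k)
    have "cls (s ^ k) \<in> set ?Us" using Suc.prems by auto
    then have 1: "cls (s ^ k) \<in> h.S.Span K ?Us"
      by (rule subsetD[OF h.S.Span_base_incl[OF subfield_constants Us]])
    have 2: "cls (scalar (c k)) \<in> K" unfolding constants_eq by (rule rangeI)
    have 3: "scalar (c k) * s ^ k \<in> local_carrier z" using s by (intro local_carrier_closed)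
    have 4: "cls (scalar (c k) * s ^ k) = cls (scalar (c k)) \<otimes>\<^bsub>Q\<^esub> cls (s ^ k)"
      by (rule cls_simps(2)) (use s in \<open>intro local_carrier_closed\<close>)+
    have 5: "cls (scalar (c k) * s ^ k) \<in> h.S.Span K ?Us"
      unfolding 4 by (rule h.S.Span_smult_closed[OF subfield_constants Us 2 1])
    have 6: "cls (\<Sum>i<Suc k. scalar (c i) * s ^ i) = cls (\<Sum>i<k. scalar (c i) * s ^ i) \<oplus>\<^bsub>Q\<^esub> cls (scalar (c k) * s ^ k)"
      unfolding sum.lessThan_Suc by (rule cls_simps(1)[OF sum_carrier[OF s] 3])
    have "k \<le> N" using Suc.prems by simp
    then show ?case unfolding 6 by (intro props(3)[OF Us] Suc.IH 5)
  qed
  have "cls r \<in> h.S.Span K ?Us" if r: "r \<in> local_carrier z" for r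
  proof -
    obtain c r' where c: "r' \<in> local_carrier z" "r - ((\<Sum>i<N. scalar (c i) * s ^ i) + s ^ N * r') \<in> local_ideal F z"
      using powers_span_modulo_ideal[OF s step r] by blast
    from local_ideal_add[OF c(2) local_ideal_mult[OF c(1) nil]]
    have "r - (\<Sum>i<N. scalar (c i) * s ^ i) \<in> local_ideal F z" by (simp add: algebra_simps)
    then have "cls r = cls (\<Sum>i<N. scalar (c i) * s ^ i)" by (simp add: local_class_eq_iff)
    then show ?thesis using comb by simp
  qed
  then have "carrier Q \<subseteq> h.S.Span K ?Us" unfolding carrier_quotient by (rule image_subsetI)
  then have Span: "h.S.Span K ?Us = carrier Q" using props(1)[OF Us] by (rule subset_antisym[rotated])
  show ?thesis using h.S.dimension_Span_le[OF subfield_constants Us] unfolding Span length_map length_upt diff_zero .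
qed

text \<open>
  Along the curve \<open>\<xi>\<close> the function \<open>y\<close> is the parameter itself, and the equations vanish to order \<open>N\<close>.
  A linear combination of the first \<open>N\<close> powers of \<open>y\<close> that lies in the local ideal restricts to a
  polynomial of degree below \<open>N\<close> that is divisible by the \<open>N\<close>-th power of the parameter, so it is zero.
\<close>
lemma local_dimension_ge:
  assumes \<xi>: "\<And>i. poly (\<xi> i) 0 = z $ i" and F: "\<And>j. [:0, 1:] ^ N dvd along_arc \<xi> (F j)"
    and y: "along_arc \<xi> y = [:0, 1:]"
    and dim: "ring.dimension Q d K (carrier Q)"
  shows "N \<le> d"
proof -
  let ?s = "Fract y 1"
  let ?Us = "map (\<lambda>i. cls (?s ^ i)) [0..<N]"
  have s: "?s \<in> local_carrier z" by blast
  have sub: "local_ideal F z \<subseteq> arc_ideal \<xi> N z"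
  proof (rule local_ideal_minimal[OF arc_ideal_ideal])
    show "Fract (F j) 1 \<in> arc_ideal \<xi> N z" for j
      unfolding arc_ideal_def by (rule CollectI, rule exI[of _ "F j"], rule exI[of _ "1 :: ('n, 'k) mpoly"]) (intro conjI refl F, simp)
  qed
  have Us: "set ?Us \<subseteq> carrier Q" using s by (auto intro!: cls_simps(3) local_carrier_closed)
  have comb: "h.S.combine (map (\<lambda>i. cls (scalar (c i))) xs) (map (\<lambda>i. cls (?s ^ i)) xs) =
      cls (\<Sum>i\<leftarrow>xs. scalar (c i) * ?s ^ i) \<and> (\<Sum>i\<leftarrow>xs. scalar (c i) * ?s ^ i) \<in> local_carrier z" for c xs
    using s by (induction xs) (auto simp: cls_simps local_carrier_closed)
  have "h.S.independent K ?Us"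
  proof (rule h.S.trivial_combine_imp_independent[OF subfield_constants Us])
    fix Ks assume Ks: "set Ks \<subseteq> K" and zero: "h.S.combine Ks ?Us = \<zero>\<^bsub>Q\<^esub>"
    \<comment> \<open>The list \<open>Ks\<close> may be shorter or longer than the family of powers; \<open>combine\<close> ignores the excess.\<close>
    define c where "c = (\<lambda>i. if i < length Ks then SOME c. cls (scalar c) = Ks ! i else 0)"
    have c: "cls (scalar (c i)) = Ks ! i" if "i < length Ks" for i
    proof -
      have "Ks ! i \<in> K" using Ks that by auto
      then have "\<exists>c. cls (scalar c) = Ks ! i" unfolding constants_eq by auto
      then show ?thesis unfolding c_def using that by (simp add: someI_ex[of "\<lambda>c. cls (scalar c) = Ks ! i"])
    qed
    let ?m = "min N (length Ks)"
    have tk: "take N Ks = map (\<lambda>i. cls (scalar (c i))) [0..<?m]"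
      by (rule nth_equalityI) (auto simp: c)
    have "h.S.combine Ks ?Us = h.S.combine (take N Ks) (take ?m ?Us)"
    proof -
      have "h.S.combine Ks ?Us = h.S.combine (take N Ks) ?Us" using h.S.combine_take[of ?Us Ks] by simp
      also have "h.S.combine Ls Vs = h.S.combine Ls (take (length Ls) Vs)" for Ls Vs
        by (induction Ls Vs rule: h.S.combine.induct) auto
      from this[of "take N Ks" ?Us] have "h.S.combine (take N Ks) ?Us = h.S.combine (take N Ks) (take ?m ?Us)"
        by (simp add: min.commute)
      finally show ?thesis .
    qed
    moreover have "take ?m ?Us = map (\<lambda>i. cls (?s ^ i)) [0..<?m]" by (simp add: take_map)
    ultimately have "cls (\<Sum>i\<leftarrow>[0..<?m]. scalar (c i) * ?s ^ i) = cls 0"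
      using zero comb[of c "[0..<?m]"] unfolding tk by (simp add: cls_simps)
    then have "(\<Sum>i\<leftarrow>[0..<?m]. scalar (c i) * ?s ^ i) \<in> local_ideal F z"
      unfolding local_class_eq_iff by simp
    moreover have "(\<Sum>i\<leftarrow>[0..<?m]. scalar (c i) * ?s ^ i) = Fract (\<Sum>i<?m. mpoly_const (c i) * y ^ i) 1"
      by (simp add: interv_sum_list_conv_sum_set_nat lessThan_atLeast0 Fract_sum Fract_one_mult Fract_power scalar_def del: mult_fract)
    ultimately have "Fract (\<Sum>i<?m. mpoly_const (c i) * y ^ i) 1 \<in> arc_ideal \<xi> N z" using sub by auto
    note arc = arc_ideal_polynomial[OF \<xi> this]
    let ?p = "\<Sum>i<?m. Polynomial.monom (c i) i"
    have dvd: "[:0, 1:] ^ N dvd (\<Sum>i<?m. [:c i:] * [:0, 1:] ^ i)"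
    proof -
      have "along_arc \<xi> (y ^ i) = [:0, 1:] ^ i" for i by (induction i) (simp_all add: y)
      then show ?thesis using arc by (simp add: cpoly.subst_sum)
    qed
    also have "(\<Sum>i<?m. [:c i:] * [:0, 1:] ^ i) = ?p"
      by (simp add: Polynomial.monom_altdef)
    finally have dvd: "[:0, 1:] ^ N dvd ?p" .
    have "?p = 0"
    proof (rule ccontr)
      assume nz: "?p \<noteq> 0"
      then have m: "?m > 0" by (cases "?m = 0") auto
      have "Polynomial.degree ?p \<le> ?m - 1"
        by (rule degree_sum_le) (auto intro: order.trans[OF degree_monom_le])
      moreover have "N \<le> Polynomial.degree ?p"
        using dvd_imp_degree_le[OF dvd nz] by (simp add: degree_power_eq)
      ultimately show False using m by linarith
    qed
    then have "Polynomial.coeff ?p j = 0" for j by (simp only: coeff_0)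
    then have "(if j < ?m then c j else 0) = 0" for j by (simp add: coeff_sum when_def)
    then have "c j = 0" if "j < ?m" for j using that by (metis (full_types))
    then have c0: "cls (scalar (c j)) = \<zero>\<^bsub>Q\<^esub>" if "j < ?m" for j using that by (simp add: cls_simps(4))
    have "length ?Us = N" by simp
    then have take: "take (length ?Us) Ks = map (\<lambda>i. cls (scalar (c i))) [0..<?m]" using tk by (rule ssubst)
    show "set (take (length ?Us) Ks) \<subseteq> {\<zero>\<^bsub>Q\<^esub>}"
      unfolding take set_map set_upt by (rule image_subsetI) (use c0 in simp)
  qed
  then have "length ?Us \<le> d" using Us by (rule h.S.independent_length_le_dimension[OF subfield_constants dim])
  then show ?thesis by simp
qed

end

section \<open>Congruences in the local ring\<close>

text \<open>
  Ideals of the local ring seen as sets of rational functions, so that congruences modulo them can be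
  computed in the field. They are applied to the local ideal of a system and to its sum with a
  principal ideal.
\<close>
definition local_submodule :: "'k ^ 'n::{finite,linorder} \<Rightarrow> ('n, 'k::field) mpoly fract set \<Rightarrow> bool"
  where "local_submodule z J \<longleftrightarrow> 0 \<in> J \<and> (\<forall>a b. a \<in> J \<longrightarrow> b \<in> J \<longrightarrow> a + b \<in> J) \<and>
    (\<forall>r a. r \<in> local_carrier z \<longrightarrow> a \<in> J \<longrightarrow> r * a \<in> J)"

lemma local_submodule_ideal: "local_submodule z (local_ideal F z)"
  unfolding local_submodule_def by (intro conjI allI impI local_ideal_zero local_ideal_add local_ideal_mult)

context
  fixes z :: "'k::field ^ 'n::{finite,linorder}" and J
  assumes J: "local_submodule z J"
begin

lemma submodule_zero: "0 \<in> J"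
  using J unfolding local_submodule_def by blast

lemma submodule_add: "a \<in> J \<Longrightarrow> b \<in> J \<Longrightarrow> a + b \<in> J"
  using J unfolding local_submodule_def by blast

lemma submodule_mult: "r \<in> local_carrier z \<Longrightarrow> a \<in> J \<Longrightarrow> r * a \<in> J"
  using J unfolding local_submodule_def by blast

lemma congruent_mult:
  assumes "a - b \<in> J" "a' - b' \<in> J" "a' \<in> local_carrier z" "b \<in> local_carrier z"
  shows "a * a' - b * b' \<in> J"
proof -
  have "a' * (a - b) + b * (a' - b') \<in> J"
    by (intro submodule_add submodule_mult assms)
  then show ?thesis by (simp add: algebra_simps)
qed

lemma congruent_sum: "(\<And>i. i \<in> S \<Longrightarrow> f i - g i \<in> J) \<Longrightarrow> sum f S - sum g S \<in> J"
proof (induction S rule: infinite_finite_induct)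
  case (insert i S)
  then show ?case using submodule_add[of "f i - g i" "sum f S - sum g S"] by (simp add: algebra_simps)
qed (simp_all add: submodule_zero)

lemma prod_local_carrier: "(\<And>i. i \<in> S \<Longrightarrow> f i \<in> local_carrier z) \<Longrightarrow> prod f S \<in> local_carrier z"
  by (induction S rule: infinite_finite_induct) (simp_all add: local_carrier_closed)

lemma congruent_prod:
  "(\<And>i. i \<in> S \<Longrightarrow> f i - g i \<in> J \<and> f i \<in> local_carrier z \<and> g i \<in> local_carrier z) \<Longrightarrow> prod f S - prod g S \<in> J"
proof (induction S rule: infinite_finite_induct)
  case (insert i S)
  then show ?case
    using congruent_mult[of "f i" "g i" "prod f S" "prod g S"] prod_local_carrier[of S f] by simp
qed (simp_all add: submodule_zero)

lemma congruent_power: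
  "a - b \<in> J \<Longrightarrow> a \<in> local_carrier z \<Longrightarrow> b \<in> local_carrier z \<Longrightarrow> a ^ k - b ^ k \<in> J"
  using congruent_prod[of "{..<k}" "\<lambda>_. a" "\<lambda>_. b"] by simp

lemma residue_carrier: "residue z a c \<Longrightarrow> a \<in> local_carrier z"
  unfolding local_carrier_iff by (rule exI)

lemma congruent_powi:
  assumes "a - b \<in> J" "residue z a c" "residue z b c'" "c \<noteq> 0" "c' \<noteq> 0"
  shows "a powi k - b powi k \<in> J"
proof -
  have nz: "a \<noteq> 0" "b \<noteq> 0" using residue_inverse(2) assms by metis+
  have inv: "inverse a \<in> local_carrier z" "inverse b \<in> local_carrier z"
    using residue_carrier[OF residue_inverse(1)[OF assms(2,4)]] residue_carrier[OF residue_inverse(1)[OF assms(3,5)]] .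
  have "- (inverse a * inverse b) * (a - b) \<in> J"
    using inv by (intro submodule_mult assms(1) local_carrier_closed)
  then have "inverse a - inverse b \<in> J" unfolding inverse_diff_inverse[OF nz] by (simp add: mult_ac)
  then have "inverse a ^ nat (- k) - inverse b ^ nat (- k) \<in> J" by (rule congruent_power[OF _ inv])
  moreover have "a ^ nat k - b ^ nat k \<in> J"
    by (rule congruent_power[OF assms(1) residue_carrier[OF assms(2)] residue_carrier[OF assms(3)]])
  ultimately show ?thesis unfolding power_int_def by simp
qed

text \<open>
  The quotient \<open>(a\<^sup>m - b\<^sup>m) / (a - b)\<close> has residue \<open>m c\<^sup>m\<^sup>-\<^sup>1\<close>, so it is a unit. This is where the
  characteristic matters.
\<close>
lemma congruent_root:
  assumes pow: "a ^ m - b ^ m \<in> J" and a: "residue z a c" and b: "residue z b c" and c: "of_nat m * c ^ (m - 1) \<noteq> 0"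
  shows "a - b \<in> J"
proof -
  define u where "u = (\<Sum>i<m. b ^ (m - Suc i) * a ^ i)"
  have "residue z (\<Sum>i<k. b ^ (m - Suc i) * a ^ i) (\<Sum>i<k. c ^ (m - Suc i) * c ^ i)" for k
  proof (induction k)
    case 0
    then show ?case using residue_scalar[of z 0] by simp
  next
    case (Suc k)
    then show ?case
      unfolding sum.lessThan_Suc by (intro residue_add residue_mult residue_power a b)
  qed
  then have "residue z u (\<Sum>i<m. c ^ (m - Suc i) * c ^ i)" unfolding u_def .
  also have "(\<Sum>i<m. c ^ (m - Suc i) * c ^ i) = (\<Sum>i<m. c ^ (m - 1))"
  proof (rule sum.cong)
    fix i assume "i \<in> {..<m}"
    then have "m - Suc i + i = m - 1" by auto
    then show "c ^ (m - Suc i) * c ^ i = c ^ (m - 1)" unfolding power_add[symmetric] by (rule arg_cong)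
  qed (rule refl)
  also have "\<dots> = of_nat m * c ^ (m - 1)" by simp
  finally have u: "residue z u (of_nat m * c ^ (m - 1))" .
  have "a ^ m - b ^ m = (a - b) * u"
  proof (cases m)
    case (Suc k)
    show ?thesis unfolding u_def Suc diff_power_eq_sum diff_Suc_Suc
      by (rule arg_cong[of _ _ "(*) (a - b)"], rule sum.cong[OF refl], rule mult.commute)
  qed (simp add: u_def)
  then have "inverse u * (a ^ m - b ^ m) = a - b" using residue_inverse(2)[OF u c] by simp
  moreover have "inverse u * (a ^ m - b ^ m) \<in> J"
    using residue_carrier[OF residue_inverse(1)[OF u c]] pow by (rule submodule_mult)
  ultimately show ?thesis by (simp only:)
qed

lemma polynomial_congruent_value:
  assumes "\<And>j. coordinate j - scalar (z $ j) \<in> J"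
  shows "Fract p 1 - scalar (mpoly_eval p z) \<in> J"
proof -
  have "mpoly_eval p z = (\<Sum>m\<in>Poly_Mapping.keys p. Poly_Mapping.lookup p m * (\<Prod>i\<in>UNIV. (z $ i) ^ Poly_Mapping.lookup m i))"
    by (rule mpoly_eval_def)
  then have e: "scalar (mpoly_eval p z) = (\<Sum>m\<in>Poly_Mapping.keys p. scalar (Poly_Mapping.lookup p m) * (\<Prod>i\<in>UNIV. scalar (z $ i) ^ Poly_Mapping.lookup m i))"
    by (simp add: scalar.scalar_sum scalar.scalar_prod)
  have "scalar c * (\<Prod>i\<in>UNIV. coordinate i ^ Poly_Mapping.lookup m i) -
      scalar c * (\<Prod>i\<in>UNIV. scalar (z $ i) ^ Poly_Mapping.lookup m i) \<in> J" for c m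
  proof (rule congruent_mult)
    show "(\<Prod>i\<in>UNIV. coordinate i ^ Poly_Mapping.lookup m i) - (\<Prod>i\<in>UNIV. scalar (z $ i) ^ Poly_Mapping.lookup m i) \<in> J"
      by (intro congruent_prod conjI congruent_power assms local_carrier_closed)
    show "(\<Prod>i\<in>UNIV. coordinate i ^ Poly_Mapping.lookup m i) \<in> local_carrier z"
      by (intro prod_local_carrier local_carrier_closed)
  qed (simp_all add: submodule_zero local_carrier_closed)
  then show ?thesis unfolding Fract_subst mpoly_subst_def e by (intro congruent_sum)
qed

lemma local_congruent_scalar:
  assumes "\<And>j. coordinate j - scalar (z $ j) \<in> J" and r: "r \<in> local_carrier z"
  shows "\<exists>c. r - scalar c \<in> J"
proof -
  obtain p q where pq: "r = Fract p q" "mpoly_eval q z \<noteq> 0" using r by (auto simp: local_ring_def)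
  have p: "Fract p 1 - scalar (mpoly_eval p z) \<in> J" by (rule polynomial_congruent_value[OF assms(1)])
  have q: "Fract q 1 - scalar (mpoly_eval q z) \<in> J" by (rule polynomial_congruent_value[OF assms(1)])
  have rq: "residue z (Fract q 1) (mpoly_eval q z)"
    unfolding residue_def by (rule exI[of _ q], rule exI[of _ 1]) simp
  from congruent_powi[OF q rq residue_scalar pq(2,2), of "-1"]
  have "inverse (Fract q 1) - inverse (scalar (mpoly_eval q z)) \<in> J" by (simp only: power_int_minus power_int_1_right)
  moreover have "inverse (scalar (mpoly_eval q z) :: ('n, 'k) mpoly fract) = scalar (inverse (mpoly_eval q z))"
    using pq(2) by (intro inverse_unique) (simp flip: scalar.scalar_mult)
  ultimately have "inverse (Fract q 1) - scalar (inverse (mpoly_eval q z)) \<in> J" by simp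
  from congruent_mult[OF p this residue_carrier[OF residue_inverse(1)[OF rq pq(2)]] local_carrier_closed(1)]
  have "Fract p 1 * inverse (Fract q 1) - scalar (mpoly_eval p z * inverse (mpoly_eval q z)) \<in> J" by (simp only: scalar.scalar_mult)
  moreover have "Fract p 1 * inverse (Fract q 1) = r" using pq by simp
  ultimately have "r - scalar (mpoly_eval p z * inverse (mpoly_eval q z)) \<in> J" by (simp only:)
  then show ?thesis by (rule exI)
qed

end

lemma scalar_inverse: "scalar (inverse c) = inverse (scalar c :: ('n::{finite,linorder}, 'k::field) mpoly fract)"
proof (cases "c = 0")
  case False
  then have "scalar c * scalar (inverse c) = (scalar 1 :: ('n, 'k) mpoly fract)"
    unfolding scalar.scalar_mult[symmetric] by simp
  then show ?thesis by (intro inverse_unique[symmetric]) simp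
qed simp

lemma scalar_powi: "scalar (c powi k) = scalar c powi k"
  by (simp add: power_int_def scalar_inverse)

lemma coordinate_nonzero: "coordinate j \<noteq> (0 :: ('n::{finite,linorder}, 'k::field) mpoly fract)"
proof -
  have "mpoly_var j \<noteq> (0 :: ('n, 'k) mpoly)"
    unfolding mpoly_var_def by (metis lookup_single_eq lookup_zero zero_neq_one)
  then show ?thesis by (simp add: coordinate_def Zero_fract_def eq_fract)
qed

lemma residue_laurent:
  assumes "\<And>i. z $ i \<noteq> 0"
  shows "residue z (laurent coordinate a) (laurent (($) z) a)"
  unfolding laurent_def by (intro residue_prod residue_powi residue_coordinate assms)

text \<open>
  A power of each coordinate is a product of powers of the given monomials, hence congruent to its value at
  \<open>z\<close>; the \<open>d\<close>-th root may then be taken by \<open>congruent_root\<close>.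
\<close>
lemma monomials_determine_coordinates:
  fixes z :: "'k::field_char_0 ^ 'n::{finite,linorder}" and p :: "'i \<Rightarrow> int ^ 'n::{finite,linorder}"
  assumes J: "local_submodule z J" and z: "\<And>i. z $ i \<noteq> 0"
    and p: "\<And>a. a \<in> S \<Longrightarrow> laurent coordinate (p a) - scalar (laurent (($) z) (p a)) \<in> J"
    and d: "d > 0" "d *s axis i 1 = (\<Sum>a\<in>S. N a *s p a)"
  shows "coordinate i - scalar (z $ i) \<in> J"
proof (rule congruent_root[OF J])
  have nz: "laurent (($) z) a \<noteq> 0" for a using z by (rule laurent_nonzero)
  have 1: "laurent y (d *s axis i 1) = (\<Prod>a\<in>S. laurent y (p a) powi N a)" if "\<And>i. y i \<noteq> 0" for y :: "'n \<Rightarrow> 'f::field"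
    unfolding d(2) laurent_sum[OF that] laurent_scale ..
  have 2: "laurent y (d *s axis i 1) = y i ^ nat d" for y :: "'n \<Rightarrow> 'f::field"
    unfolding laurent_scale laurent_axis using d(1) by (simp add: power_int_def)
  have "(\<Prod>a\<in>S. laurent coordinate (p a) powi N a) - (\<Prod>a\<in>S. scalar (laurent (($) z) (p a)) powi N a) \<in> J"
  proof (rule congruent_prod[OF J], intro conjI)
    fix a assume a: "a \<in> S"
    show "laurent coordinate (p a) powi N a - scalar (laurent (($) z) (p a)) powi N a \<in> J"
      by (rule congruent_powi[OF J p[OF a] residue_laurent[OF z] residue_scalar nz nz])
    show "laurent coordinate (p a) powi N a \<in> local_carrier z"
      by (rule residue_carrier[OF J residue_powi[OF residue_laurent[OF z] nz]])
    show "scalar (laurent (($) z) (p a)) powi N a \<in> local_carrier z"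
      unfolding scalar_powi[symmetric] by (rule local_carrier_closed)
  qed
  moreover have "(\<Prod>a\<in>S. scalar (laurent (($) z) (p a)) powi N a) = (scalar :: _ \<Rightarrow> ('n, 'k) mpoly fract) (laurent (($) z) (d *s axis i 1))"
    unfolding 1[OF z] by (simp add: scalar.scalar_prod scalar_powi)
  moreover have "(\<Prod>a\<in>S. laurent coordinate (p a) powi N a) = (coordinate i :: ('n, 'k) mpoly fract) ^ nat d"
    unfolding 2[symmetric] by (rule 1[symmetric]) (rule coordinate_nonzero)
  ultimately show "coordinate i ^ nat d - scalar (z $ i) ^ nat d \<in> J"
    unfolding 2 scalar.scalar_power by (simp only:)
  show "of_nat (nat d) * (z $ i) ^ (nat d - 1) \<noteq> 0" using d(1) z by simp
qed (rule residue_coordinate residue_scalar)+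

section \<open>From one equation in one variable to nilpotency\<close>

definition eval_at :: "('n::{finite,linorder}, 'k::field) mpoly fract \<Rightarrow> 'k poly \<Rightarrow> ('n, 'k) mpoly fract"
  where "eval_at s p = poly (map_poly scalar p) s"

lemma eval_at_pCons [simp]: "eval_at s (pCons a p) = scalar a + s * eval_at s p"
  by (simp add: eval_at_def map_poly_pCons)

lemma eval_at_0 [simp]: "eval_at s 0 = 0"
  by (simp add: eval_at_def)

lemma eval_at_add: "eval_at s (p + q) = eval_at s p + eval_at s q"
  by (induction p q rule: poly_induct2) (simp_all add: algebra_simps)

lemma eval_at_smult: "eval_at s (Polynomial.smult c p) = scalar c * eval_at s p"
  by (induction p) (simp_all add: algebra_simps)

lemma eval_at_mult: "eval_at s (p * q) = eval_at s p * eval_at s q"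
  by (induction p) (simp_all add: eval_at_add eval_at_smult algebra_simps)

lemma eval_at_1: "eval_at s 1 = 1"
  using eval_at_pCons[of s 1 0] by simp

lemma eval_at_diff: "eval_at s (p - q) = eval_at s p - eval_at s q"
  using eval_at_add[of s "p - q" q] by simp

lemma eval_at_power: "eval_at s (p ^ k) = eval_at s p ^ k"
  by (induction k) (simp_all add: eval_at_1 eval_at_mult)

lemma eval_at_prod: "eval_at s (prod f S) = (\<Prod>i\<in>S. eval_at s (f i))"
  by (induction S rule: infinite_finite_induct) (simp_all add: eval_at_1 eval_at_mult)

lemma residue_eval_at: "residue z s 0 \<Longrightarrow> residue z (eval_at s p) (poly p 0)"
proof (induction p)
  case 0
  then show ?case using residue_scalar[of z 0] by simp
next
  case (pCons a p)
  then have "residue z (scalar a + s * eval_at s p) (a + 0 * poly p 0)"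
    by (intro residue_add residue_mult residue_scalar)
  then show ?case by simp
qed

text \<open>
  A polynomial of order \<open>k\<close> at 0 takes the value \<open>s\<^sup>k\<close> times a unit at an element \<open>s\<close> of the maximal
  ideal.
\<close>
lemma power_mem_of_eval_at_mem:
  assumes J: "local_submodule z J" and s: "residue z s 0" and p: "eval_at s p \<in> J"
    and ord: "\<not> [:0, 1:] ^ Suc N dvd p"
  shows "s ^ N \<in> J"
proof -
  have p0: "p \<noteq> 0" using ord by auto
  then obtain q where q: "p = [:-0, 1:] ^ Polynomial.order 0 p * q" "\<not> [:-0, 1:] dvd q"
    using order_decomp by blast
  let ?k = "Polynomial.order 0 p"
  have k: "?k \<le> N" using ord p0 order_divides[of 0 "Suc N" p] by simp
  have q0: "poly q 0 \<noteq> 0" using q(2) by (simp add: poly_eq_0_iff_dvd)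
  have "eval_at s [:0, 1:] = s" by (simp add: eval_at_1)
  then have "eval_at s p = s ^ ?k * eval_at s q"
    by (subst q(1)) (simp only: eval_at_mult eval_at_power minus_zero)
  then have pe: "s ^ ?k * eval_at s q \<in> J" using p by simp
  note rq = residue_eval_at[OF s, of q]
  have "inverse (eval_at s q) \<in> local_carrier z"
    by (rule residue_carrier[OF J residue_inverse(1)[OF rq q0]])
  then have "s ^ (N - ?k) * inverse (eval_at s q) * (s ^ ?k * eval_at s q) \<in> J"
    by (intro submodule_mult[OF J _ pe] local_carrier_closed residue_carrier[OF J s])
  moreover have "s ^ (N - ?k) * inverse (eval_at s q) * (s ^ ?k * eval_at s q) = s ^ (N - ?k + ?k)"
    using residue_inverse(2)[OF rq q0] by (simp add: power_add)
  ultimately show ?thesis using k by simp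
qed

text \<open>
  Raised to the exponents \<open>e\<close> and multiplied, the monomials give 1 because of the relation, and the linear
  expressions in \<open>s\<close> give a congruent product; clearing the negative exponents yields the difference.
\<close>
lemma relation_polynomial_mem:
  fixes z :: "'k::field_char_0 ^ 'n::{finite,linorder}" and p :: "'i \<Rightarrow> int ^ 'n::{finite,linorder}"
  assumes J: "local_submodule z J" and z: "\<And>i. z $ i \<noteq> 0" and s: "residue z s 0"
    and v: "\<And>a. a \<in> S \<Longrightarrow> v a \<noteq> 0"
    and p: "\<And>a. a \<in> S \<Longrightarrow> laurent coordinate (p a) - (scalar (v a) + scalar (\<gamma> a) * s) \<in> J"
    and e: "(\<Sum>a\<in>S. e a *s p a) = 0"
  shows "eval_at s ((\<Prod>a\<in>S. [:v a, \<gamma> a:] ^ nat (e a)) - (\<Prod>a\<in>S. [:v a, \<gamma> a:] ^ nat (- e a))) \<in> J"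
proof -
  define w where "w = (\<lambda>a. scalar (v a) + scalar (\<gamma> a) * s)"
  have rw: "residue z (w a) (v a)" for a
    using residue_add[OF residue_scalar[of z "v a"] residue_mult[OF residue_scalar[of z "\<gamma> a"] s]] by (simp add: w_def)
  have nz: "laurent (($) z) a \<noteq> 0" for a using z by (rule laurent_nonzero)
  have wn: "w a \<noteq> 0" if "a \<in> S" for a using residue_inverse(2)[OF rw v[OF that]] .
  have "(\<Prod>a\<in>S. laurent coordinate (p a) powi e a) - (\<Prod>a\<in>S. w a powi e a) \<in> J"
  proof (rule congruent_prod[OF J], intro conjI)
    fix a assume a: "a \<in> S"
    have "laurent coordinate (p a) - w a \<in> J" using p[OF a] by (simp add: w_def)
    then show "laurent coordinate (p a) powi e a - w a powi e a \<in> J"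
      by (rule congruent_powi[OF J _ residue_laurent[OF z] rw nz v[OF a]])
    show "laurent coordinate (p a) powi e a \<in> local_carrier z"
      by (rule residue_carrier[OF J residue_powi[OF residue_laurent[OF z] nz]])
    show "w a powi e a \<in> local_carrier z"
      by (rule residue_carrier[OF J residue_powi[OF rw v[OF a]]])
  qed
  also have "(\<Prod>a\<in>S. laurent coordinate (p a) powi e a) = laurent coordinate (\<Sum>a\<in>S. e a *s p a)"
    by (simp add: laurent_sum[OF coordinate_nonzero] laurent_scale)
  finally have 1: "1 - (\<Prod>a\<in>S. w a powi e a) \<in> J" unfolding e by simp
  let ?P = "\<Prod>a\<in>S. w a ^ nat (e a)" and ?Q = "\<Prod>a\<in>S. w a ^ nat (- e a)"
  have "?Q * (\<Prod>a\<in>S. w a powi e a) = (\<Prod>a\<in>S. w a ^ nat (- e a) * w a powi e a)" by (simp add: prod.distrib)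
  also have "\<dots> = ?P"
  proof (rule prod.cong)
    fix a assume "a \<in> S"
    then show "w a ^ nat (- e a) * w a powi e a = w a ^ nat (e a)"
      using wn[of a] by (simp add: power_int_def power_inverse)
  qed simp
  finally have PQ: "?Q * (\<Prod>a\<in>S. w a powi e a) = ?P" .
  have "- ?Q \<in> local_carrier z"
    by (intro local_carrier_closed prod_local_carrier[OF J] residue_carrier[OF J rw])
  from submodule_mult[OF J this 1] have "?P - ?Q \<in> J" unfolding PQ[symmetric] by (simp add: algebra_simps)
  then show ?thesis unfolding eval_at_diff eval_at_prod eval_at_power by (simp add: w_def mult.commute)
qed

section \<open>Multiplicity bounds for systems with few monomials\<close>

text \<open>
  The coefficient at a lattice point, which is 0 at points with a negative coordinate. It lets a sum over
  the support run over the whole of \<open>A\<close>, which need not lie in the positive orthant.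
\<close>
definition lattice_coeff :: "('n::finite, 'k::zero) mpoly \<Rightarrow> int ^ 'n::finite \<Rightarrow> 'k"
  where "lattice_coeff p a = (if \<exists>m. a = (\<chi> i. int (Poly_Mapping.lookup m i))
     then Poly_Mapping.lookup p (THE m. a = (\<chi> i. int (Poly_Mapping.lookup m i))) else 0)"

lemma lattice_point_inj:
  "(\<chi> i. int (Poly_Mapping.lookup m i)) = (\<chi> i. int (Poly_Mapping.lookup m' i)) \<Longrightarrow> m = m'"
  by (rule poly_mapping_eqI) (simp add: vec_eq_iff)

lemma lattice_coeff_point: "lattice_coeff p (\<chi> i. int (Poly_Mapping.lookup m i)) = Poly_Mapping.lookup p m"
proof -
  have "(THE m'. (\<chi> i. int (Poly_Mapping.lookup m i)) = ((\<chi> i. int (Poly_Mapping.lookup m' i)) :: int ^ 'b)) = m"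
    by (rule the_equality, rule refl, rule lattice_point_inj, rule sym)
  then show ?thesis unfolding lattice_coeff_def by auto
qed

lemma mpoly_subst_laurent:
  fixes \<kappa> :: "'k::field \<Rightarrow> 'f::field" and p :: "('n::finite, 'k) mpoly"
  assumes \<kappa>: "\<kappa> 0 = 0" and A: "finite A" "mpoly_support p \<subseteq> A"
  shows "mpoly_subst \<kappa> x p = (\<Sum>a\<in>A. \<kappa> (lattice_coeff p a) * laurent x a)"
proof -
  let ?f = "\<lambda>m. \<chi> i. int (Poly_Mapping.lookup m i)"
  have "(\<Sum>a\<in>A. \<kappa> (lattice_coeff p a) * laurent x a) = (\<Sum>a\<in>mpoly_support p. \<kappa> (lattice_coeff p a) * laurent x a)"
  proof (rule sum.mono_neutral_right[OF A], rule ballI)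
    fix a assume a: "a \<in> A - mpoly_support p"
    have "lattice_coeff p a = 0"
    proof (cases "\<exists>m. a = ?f m")
      case True
      then obtain m where m: "a = ?f m" ..
      then have "m \<notin> Poly_Mapping.keys p" using a unfolding mpoly_support_def by blast
      then show ?thesis unfolding m lattice_coeff_point by (simp add: in_keys_iff)
    qed (simp add: lattice_coeff_def)
    then show "\<kappa> (lattice_coeff p a) * laurent x a = 0" using \<kappa> by simp
  qed
  also have "\<dots> = (\<Sum>m\<in>Poly_Mapping.keys p. \<kappa> (lattice_coeff p (?f m)) * laurent x (?f m))"
    unfolding mpoly_support_def by (rule sum.reindex[unfolded o_def]) (auto intro!: inj_onI dest: lattice_point_inj)
  also have "\<dots> = mpoly_subst \<kappa> x p"
    unfolding mpoly_subst_def lattice_coeff_point by (simp add: laurent_def)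
  finally show ?thesis ..
qed

text \<open>
  A relation is determined by its entry at \<open>c\<close>, so the relations form a subgroup of the integers; a
  relation whose entry at \<open>c\<close> has the least nonzero absolute value generates it by division with remainder.
\<close>
lemma integer_relations_cyclic:
  fixes p :: "'i \<Rightarrow> int ^ 'n"
  assumes S: "finite S" "c \<notin> S" and indep: "\<And>e a. (\<Sum>a\<in>S. e a *s p a) = 0 \<Longrightarrow> a \<in> S \<Longrightarrow> e a = 0"
  shows "\<exists>m. (\<Sum>a\<in>insert c S. m a *s p a) = 0 \<and>
    (\<forall>e. (\<Sum>a\<in>insert c S. e a *s p a) = 0 \<longrightarrow> (\<exists>k. \<forall>a\<in>insert c S. e a = k * m a))"
proof -
  let ?G = "\<lambda>e. (\<Sum>a\<in>insert c S. e a *s p a) = 0"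
  have split: "?G e \<longleftrightarrow> e c *s p c + (\<Sum>a\<in>S. e a *s p a) = 0" for e using S by simp
  have zero: "\<forall>a\<in>insert c S. e a = 0" if "?G e" "e c = 0" for e
  proof -
    have "0 *s p c = 0" by (simp add: vec_eq_iff)
    then have "(\<Sum>a\<in>S. e a *s p a) = 0" using that unfolding split by simp
    then show ?thesis using indep[of e] that(2) by (metis insert_iff)
  qed
  show ?thesis
  proof (cases "\<exists>e. ?G e \<and> e c \<noteq> 0")
    case False
    have "?G (\<lambda>_. 0)" by (simp add: vec_eq_iff)
    moreover have "\<exists>k. \<forall>a\<in>insert c S. e a = k * 0" if "?G e" for e
    proof -
      have "e c = 0" using False that by blast
      then show ?thesis using zero[OF that] by simp
    qed
    ultimately show ?thesis by (intro exI[of _ "\<lambda>_. 0"] conjI allI impI)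
  next
    case True
    define d where "d = (LEAST d. \<exists>e. ?G e \<and> e c \<noteq> 0 \<and> d = nat \<bar>e c\<bar>)"
    have "\<exists>d e. ?G e \<and> e c \<noteq> 0 \<and> d = nat \<bar>e c\<bar>" using True by blast
    then have "\<exists>e. ?G e \<and> e c \<noteq> 0 \<and> d = nat \<bar>e c\<bar>" unfolding d_def by (rule LeastI_ex)
    then obtain m where m: "?G m" "m c \<noteq> 0" "d = nat \<bar>m c\<bar>" by blast
    have least: "d \<le> nat \<bar>e c\<bar>" if "?G e" "e c \<noteq> 0" for e
      unfolding d_def by (rule Least_le) (use that in blast)
    have "\<exists>k. \<forall>a\<in>insert c S. e a = k * m a" if e: "?G e" for e
    proof -
      let ?k = "e c div m c"
      let ?e = "\<lambda>a. e a - ?k * m a"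
      have "(\<Sum>a\<in>insert c S. ?e a *s p a) = (\<Sum>a\<in>insert c S. e a *s p a) - ?k *s (\<Sum>a\<in>insert c S. m a *s p a)"
        by (simp add: vec_eq_iff sum_subtractf sum_distrib_left algebra_simps)
      also have "\<dots> = 0" unfolding e m(1) by (simp add: vec_eq_iff)
      finally have G: "?G ?e" .
      have "?e c = e c mod m c" by (simp add: minus_div_mult_eq_mod)
      then have "\<bar>?e c\<bar> < \<bar>m c\<bar>" using m(2) by (simp add: abs_mod_less)
      then have "\<not> d \<le> nat \<bar>?e c\<bar>" unfolding m(3) by simp
      then have "?e c = 0" using least[OF G] by (rule contrapos_np)
      from zero[OF G this] show ?thesis by (intro exI[of _ ?k]) simp
    qed
    then show ?thesis using m(1) by (intro exI[of _ m] conjI allI impI)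
  qed
qed

lemma infinite_nonzero_affine:
  fixes v g :: "'i \<Rightarrow> 'k::field_char_0"
  assumes "finite S" "\<And>a. a \<in> S \<Longrightarrow> v a \<noteq> 0"
  shows "infinite {t. \<forall>a\<in>S. v a + g a * t \<noteq> 0}"
proof -
  let ?p = "\<Prod>a\<in>S. [:v a, g a:]"
  have "?p \<noteq> 0" using assms by simp
  then have "finite {t. poly ?p t = 0}" by (rule poly_roots_finite)
  then have "infinite (UNIV - {t. poly ?p t = 0})" using infinite_UNIV_char_0 by (rule Diff_infinite_finite)
  moreover have "poly ?p t = 0 \<longleftrightarrow> (\<exists>a\<in>S. v a + g a * t = 0)" for t
    using assms(1) by (simp add: poly_prod mult.commute[of t])
  then have "UNIV - {t. poly ?p t = 0} = {t. \<forall>a\<in>S. v a + g a * t \<noteq> 0}" by blast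
  ultimately show ?thesis by simp
qed

lemma prod_powi_eq_one_iff:
  fixes w :: "'i \<Rightarrow> 'k::field"
  assumes "finite S" "\<And>a. a \<in> S \<Longrightarrow> w a \<noteq> 0"
  shows "(\<Prod>a\<in>S. w a powi e a) = 1 \<longleftrightarrow> (\<Prod>a\<in>S. w a ^ nat (e a)) = (\<Prod>a\<in>S. w a ^ nat (- e a))"
proof -
  have "w a powi e a = w a ^ nat (e a) / w a ^ nat (- e a)" for a
    by (cases "e a \<ge> 0") (simp_all add: power_int_def power_inverse divide_inverse)
  then have "(\<Prod>a\<in>S. w a powi e a) = (\<Prod>a\<in>S. w a ^ nat (e a) / w a ^ nat (- e a))" by simp
  also have "\<dots> = (\<Prod>a\<in>S. w a ^ nat (e a)) / (\<Prod>a\<in>S. w a ^ nat (- e a))"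
    by (rule prod_dividef)
  finally have *: "(\<Prod>a\<in>S. w a powi e a) = \<dots>" .
  have "(\<Prod>a\<in>S. w a ^ nat (- e a)) \<noteq> 0" using assms by simp
  then show ?thesis unfolding * by simp
qed

text \<open>
  A system with finitely many zeros in the torus, one of these zeros, the outcome of the elimination, and a
  free monomial \<open>b\<close> by which all monomials are divided.
\<close>
locale reduced_system =
  fixes A B :: "(int ^ 'n::{finite,linorder}) set"
    and F :: "'n \<Rightarrow> ('n, 'k::{alg_closed_field,field_char_0}) mpoly" and z :: "'k ^ 'n::{finite,linorder}"
    and g :: "int ^ 'n::{finite,linorder} \<Rightarrow> int ^ 'n::{finite,linorder} \<Rightarrow> 'k"
    and h :: "int ^ 'n::{finite,linorder} \<Rightarrow> 'n \<Rightarrow> 'k" and b :: "int ^ 'n::{finite,linorder}"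
  assumes finA: "finite A" and gen: "no_hyperplane_subset A"
    and supp: "\<And>j. mpoly_support (F j) \<subseteq> A" and fin: "finite (torus_zeros F)" and z: "z \<in> torus_zeros F"
    and BA: "B \<subseteq> A" and bB: "b \<in> B"
    and ker: "\<And>j c. c \<in> B \<Longrightarrow> (\<Sum>a\<in>A. lattice_coeff (F j) a * g a c) = 0"
    and gB: "\<And>c c'. c \<in> B \<Longrightarrow> c' \<in> B \<Longrightarrow> g c c' = (if c = c' then 1 else 0)"
    and rep: "\<And>a a'. a \<in> A \<Longrightarrow> a' \<in> A \<Longrightarrow> (if a = a' then 1 else 0) =
        (if a' \<in> B then g a a' else 0) + (\<Sum>j\<in>UNIV. h a j * lattice_coeff (F j) a')"
begin

lemma z_nonzero: "z $ i \<noteq> 0" and z_zero: "mpoly_eval (F j) z = 0"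
  using z unfolding torus_zeros_def by simp_all

lemma b_in_A: "b \<in> A" using bB BA by blast

lemma laurent_z_nonzero: "laurent (($) z) a \<noteq> 0"
  by (rule laurent_nonzero) (rule z_nonzero)

definition v where "v a = laurent (($) z) (a - b)"

abbreviation "is_relation e \<equiv> (\<Sum>a\<in>A-{b}. e a *s (a - b)) = 0"

abbreviation "side c e \<equiv> \<Prod>a\<in>A-{b}. [:v a, g a c:] ^ nat (e a)"

lemma v_nonzero: "v a \<noteq> 0"
  unfolding v_def by (rule laurent_z_nonzero)

lemma v_b: "v b = 1" by (simp add: v_def)

sublocale local_zero F z by unfold_locales (rule z_zero)

text \<open>
  The witness \<open>h\<close> of the elimination, read in an arbitrary field. Applied to constants it
  expands the values of the monomials at \<open>z\<close>; applied to rational functions it reduces monomials modulo the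
  local ideal.
\<close>
lemma elimination:
  fixes \<kappa> :: "'k \<Rightarrow> 'f::field"
  assumes \<kappa>: "scalar_hom \<kappa>" and a: "a \<in> A"
  shows "laurent x a - (\<Sum>c\<in>B. \<kappa> (g a c) * laurent x c) = (\<Sum>j\<in>UNIV. \<kappa> (h a j) * mpoly_subst \<kappa> x (F j))"
proof -
  interpret \<kappa>: scalar_hom \<kappa> by (rule \<kappa>)
  have "laurent x a = (\<Sum>a'\<in>A. \<kappa> (if a = a' then 1 else 0) * laurent x a')"
  proof -
    have "(\<Sum>a'\<in>A. \<kappa> (if a = a' then 1 else 0) * laurent x a') = (\<Sum>a'\<in>A. if a = a' then laurent x a' else 0)"
      by (intro sum.cong) auto
    then show ?thesis using a finA by simp
  qed
  also have "\<dots> = (\<Sum>a'\<in>A. \<kappa> ((if a' \<in> B then g a a' else 0) + (\<Sum>j\<in>UNIV. h a j * lattice_coeff (F j) a')) * laurent x a')"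
    using rep[OF a] by (intro sum.cong) auto
  also have "\<dots> = (\<Sum>a'\<in>A. (if a' \<in> B then \<kappa> (g a a') * laurent x a' else 0)) +
      (\<Sum>a'\<in>A. \<Sum>j\<in>UNIV. \<kappa> (h a j) * (\<kappa> (lattice_coeff (F j) a') * laurent x a'))"
    unfolding sum.distrib[symmetric]
    by (intro sum.cong) (auto simp: \<kappa>.scalar_sum distrib_right sum_distrib_right mult.assoc)
  also have "(\<Sum>a'\<in>A. (if a' \<in> B then \<kappa> (g a a') * laurent x a' else 0)) = (\<Sum>c\<in>B. \<kappa> (g a c) * laurent x c)"
    using BA finA by (simp add: sum.If_cases Int_absorb1)
  also have "(\<Sum>a'\<in>A. \<Sum>j\<in>UNIV. \<kappa> (h a j) * (\<kappa> (lattice_coeff (F j) a') * laurent x a')) =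
      (\<Sum>j\<in>UNIV. \<kappa> (h a j) * mpoly_subst \<kappa> x (F j))"
    by (subst sum.swap) (simp add: mpoly_subst_laurent[where A = A and \<kappa> = \<kappa>, OF \<kappa>.scalar_zero finA supp] sum_distrib_left)
  finally show ?thesis by simp
qed

lemma v_kernel: "(\<Sum>a\<in>A. lattice_coeff (F j) a * v a) = 0"
proof -
  have "0 = mpoly_subst id (($) z) (F j)" using z_zero[of j] by (simp add: mpoly_eval_subst)
  also have "\<dots> = (\<Sum>a\<in>A. lattice_coeff (F j) a * laurent (($) z) a)"
    using mpoly_subst_laurent[OF _ finA supp, of id "($) z" j] by simp
  also have "\<dots> = (\<Sum>a\<in>A. lattice_coeff (F j) a * v a) * laurent (($) z) b"
    using laurent_z_nonzero[of b] by (simp add: v_def laurent_diff z_nonzero sum_distrib_right)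
  finally show ?thesis using laurent_z_nonzero[of b] by simp
qed

lemma lift_to_torus_zero:
  assumes w: "\<And>a. a \<in> A \<Longrightarrow> w a \<noteq> 0" "w b = 1"
    and kw: "\<And>j. (\<Sum>a\<in>A. lattice_coeff (F j) a * w a) = 0"
    and rel: "\<And>e. is_relation e \<Longrightarrow> (\<Prod>a\<in>A-{b}. w a powi e a) = 1"
  shows "\<exists>x\<in>torus_zeros F. \<forall>a\<in>A. laurent (($) x) (a - b) = w a"
proof -
  have "\<exists>x. (\<forall>i. x i \<noteq> 0) \<and> (\<forall>a\<in>A - {b}. laurent x (a - b) = w a)"
    by (rule torus_point_exists) (use finA w rel in simp_all)
  then obtain x where x: "\<And>i. x i \<noteq> 0" "\<And>a. a \<in> A - {b} \<Longrightarrow> laurent x (a - b) = w a" by metis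
  have xa: "laurent x (a - b) = w a" if "a \<in> A" for a
    using x(2)[of a] that w(2) by (cases "a = b") auto
  have "mpoly_eval (F j) (vec_lambda x) = 0" for j
  proof -
    have "mpoly_eval (F j) (vec_lambda x) = mpoly_subst id x (F j)"
      by (simp add: mpoly_eval_subst vec_lambda_inverse)
    also have "\<dots> = (\<Sum>a\<in>A. lattice_coeff (F j) a * laurent x a)"
      using mpoly_subst_laurent[OF _ finA supp, of id x j] by simp
    also have "\<dots> = (\<Sum>a\<in>A. lattice_coeff (F j) a * w a * laurent x b)"
    proof (rule sum.cong)
      fix a assume "a \<in> A"
      then have "laurent x a = w a * laurent x b"
        using xa[of a] laurent_nonzero[of x b, OF x(1)] unfolding laurent_diff[OF x(1)] by (simp add: field_simps)
      then show "lattice_coeff (F j) a * laurent x a = lattice_coeff (F j) a * w a * laurent x b" by simp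
    qed simp
    also have "\<dots> = 0" unfolding sum_distrib_right[symmetric] kw by simp
    finally show ?thesis .
  qed
  then have "vec_lambda x \<in> torus_zeros F" using x(1) by (simp add: torus_zeros_def)
  moreover have "($) (vec_lambda x) = x" by auto
  ultimately show ?thesis using xa by (intro bexI[of _ "vec_lambda x"]) simp_all
qed

text \<open>
  The elements \<open>\<tau>\<close> are the coordinates, in the kernel of the coefficient matrix, of perturbations of the
  vector \<open>v\<close> of values of the monomials at \<open>z\<close>. Each lifts to a zero in the torus. Distinct ones lift to
  distinct zeros, because the free monomials take the values \<open>v c + \<tau> c\<close> there.
\<close>
lemma no_infinite_family:
  assumes inf: "infinite T" and D: "D \<subseteq> B - {b}"
    and w: "\<And>\<tau> a. \<tau> \<in> T \<Longrightarrow> a \<in> A \<Longrightarrow> v a + (\<Sum>c\<in>D. g a c * \<tau> c) \<noteq> 0"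
    and rel: "\<And>\<tau> e. \<tau> \<in> T \<Longrightarrow> is_relation e \<Longrightarrow>
       (\<Prod>a\<in>A-{b}. (v a + (\<Sum>c\<in>D. g a c * \<tau> c)) powi e a) = 1"
    and ext: "\<And>\<tau> c. \<tau> \<in> T \<Longrightarrow> c \<notin> D \<Longrightarrow> \<tau> c = 0"
  shows False
proof -
  have finD: "finite D" using D BA finA by (meson finite_subset Diff_subset order.trans)
  define w where "w = (\<lambda>\<tau> a. v a + (\<Sum>c\<in>D. g a c * \<tau> c))"
  have gb: "g c c' = (if c = c' then 1 else 0)" if "c \<in> B" "c' \<in> D" for c c'
    using gB that D by blast
  have wb: "w \<tau> b = 1" for \<tau>
  proof -
    have "(\<Sum>c\<in>D. g b c * \<tau> c) = 0" by (rule sum.neutral) (use gb[OF bB] D in auto)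
    then show ?thesis by (simp add: w_def v_b)
  qed
  have wD: "w \<tau> c = v c + \<tau> c" if "c \<in> D" for \<tau> c
  proof -
    have "(\<Sum>c'\<in>D. g c c' * \<tau> c') = (\<Sum>c'\<in>D. if c = c' then \<tau> c' else 0)"
      using gb that D by (intro sum.cong) auto
    then show ?thesis using that finD by (simp add: w_def)
  qed
  have kw: "(\<Sum>a\<in>A. lattice_coeff (F j) a * w \<tau> a) = 0" for j \<tau>
  proof -
    have "(\<Sum>a\<in>A. lattice_coeff (F j) a * w \<tau> a) =
        (\<Sum>a\<in>A. lattice_coeff (F j) a * v a) + (\<Sum>a\<in>A. \<Sum>c\<in>D. lattice_coeff (F j) a * g a c * \<tau> c)"
      by (simp add: w_def distrib_left sum.distrib sum_distrib_left mult.assoc)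
    also have "(\<Sum>a\<in>A. \<Sum>c\<in>D. lattice_coeff (F j) a * g a c * \<tau> c) = (\<Sum>c\<in>D. (\<Sum>a\<in>A. lattice_coeff (F j) a * g a c) * \<tau> c)"
      by (subst sum.swap) (simp add: sum_distrib_right)
    also have "\<dots> = 0" by (rule sum.neutral) (use ker D in auto)
    finally show ?thesis using v_kernel by simp
  qed
  have "\<forall>\<tau>\<in>T. \<exists>x. x \<in> torus_zeros F \<and> (\<forall>a\<in>A. laurent (($) x) (a - b) = w \<tau> a)"
  proof
    fix \<tau> assume \<tau>: "\<tau> \<in> T"
    have "\<exists>x\<in>torus_zeros F. \<forall>a\<in>A. laurent (($) x) (a - b) = w \<tau> a"
      by (rule lift_to_torus_zero[OF _ wb kw]) (use w[OF \<tau>] rel[OF \<tau>] in \<open>simp_all add: w_def\<close>)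
    then show "\<exists>x. x \<in> torus_zeros F \<and> (\<forall>a\<in>A. laurent (($) x) (a - b) = w \<tau> a)" by (simp only: Bex_def)
  qed
  from bchoice[OF this] obtain f where f: "\<forall>\<tau>\<in>T. f \<tau> \<in> torus_zeros F \<and> (\<forall>a\<in>A. laurent (($) (f \<tau>)) (a - b) = w \<tau> a)" ..
  have "inj_on f T"
  proof (rule inj_onI)
    fix \<tau> \<sigma> assume *: "\<tau> \<in> T" "\<sigma> \<in> T" "f \<tau> = f \<sigma>"
    show "\<tau> = \<sigma>"
    proof
      fix c
      show "\<tau> c = \<sigma> c"
      proof (cases "c \<in> D")
        case True
        then have "c \<in> A" using D BA by blast
        then have "w \<tau> c = w \<sigma> c" using f * by metis
        then show ?thesis using wD[OF True] by simp
      next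
        case False
        then show ?thesis using ext[OF *(1) False] ext[OF *(2) False] by simp
      qed
    qed
  qed
  moreover have "f ` T \<subseteq> torus_zeros F" using f by (intro image_subsetI) simp
  then have "finite (f ` T)" using fin by (rule finite_subset)
  ultimately have "finite T" by (rule finite_imageD[rotated])
  with inf show False ..
qed

lemma coordinate_basis: "\<exists>d>0. \<exists>N. d *s axis i 1 = (\<Sum>a\<in>A-{b}. N a *s (a - b))"
  if card: "card A > CARD('n)"
proof -
  have "card (A - {b}) \<ge> CARD('n)" using card b_in_A finA by simp
  then obtain S where S: "S \<subseteq> A - {b}" "card S = CARD('n)" "finite S"
    by (rule obtain_subset_with_card_n)
  have 1: "insert b S \<subseteq> A" "b \<notin> S" using S(1) b_in_A by auto
  obtain d N where d: "d > 0" "\<And>i. d *s axis i 1 = (\<Sum>a\<in>S. N i a *s (a - b))"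
    using general_position_basis(1)[OF gen 1 S(2)] by blast
  have "(\<Sum>a\<in>A-{b}. (if a \<in> S then N i a else 0) *s (a - b)) = (\<Sum>a\<in>S. (if a \<in> S then N i a else 0) *s (a - b))"
    by (rule sum.mono_neutral_right) (use finA S(1) in simp_all)
  also have "\<dots> = (\<Sum>a\<in>S. N i a *s (a - b))" by (rule sum.cong) simp_all
  also have "\<dots> = d *s axis i 1" by (rule d(2)[symmetric])
  finally show ?thesis
    using d(1) by (intro exI[of _ d] conjI exI[of _ "\<lambda>a. if a \<in> S then N i a else 0"]) (simp_all only:)
qed

text \<open>
  Modulo the local ideal and \<open>s\<close> the monomials \<open>x\<^sup>a\<^sup>-\<^sup>b\<close> are constant, hence so are the coordinates and
  with them all functions in the local ring. So \<open>s\<close> generates the local quotient over \<open>K\<close>.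
\<close>
lemma local_dimension_bound:
  assumes card: "card A > CARD('n)" and s: "residue z s 0"
    and red: "\<And>a. a \<in> A \<Longrightarrow> laurent coordinate (a - b) - (scalar (v a) + scalar (\<gamma> a) * s) \<in> local_ideal F z"
    and nil: "s ^ N \<in> local_ideal F z"
  shows "local_dimension_at_most F z N"
proof (rule local_dimension_le[OF _ _ nil])
  let ?I = "local_ideal F z"
  note I = local_submodule_ideal[of z F]
  show sc: "s \<in> local_carrier z" by (rule residue_carrier[OF I s])
  \<comment> \<open>The ideal generated by the local ideal and \<open>s\<close>.\<close>
  define J where "J = {i + s * r | i r. i \<in> ?I \<and> r \<in> local_carrier z}"
  have J: "local_submodule z J"
    unfolding local_submodule_def
  proof (intro conjI allI impI)
    have "0 = 0 + s * (0 :: ('n, 'k) mpoly fract)" by simp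
    then show "0 \<in> J" unfolding J_def using submodule_zero[OF I] local_carrier_closed(3) by blast
  next
    fix x y assume "x \<in> J" "y \<in> J"
    then obtain i r i' r' where *: "x = i + s * r" "y = i' + s * r'" "i \<in> ?I" "i' \<in> ?I" "r \<in> local_carrier z" "r' \<in> local_carrier z"
      unfolding J_def by blast
    have "x + y = (i + i') + s * (r + r')" unfolding * by (simp add: algebra_simps)
    moreover have "i + i' \<in> ?I" "r + r' \<in> local_carrier z"
      by (rule submodule_add[OF I *(3,4)], rule local_carrier_closed(5)[OF *(5,6)])
    ultimately show "x + y \<in> J" unfolding J_def by blast
  next
    fix q x assume q: "q \<in> local_carrier z" and "x \<in> J"
    then obtain i r where *: "x = i + s * r" "i \<in> ?I" "r \<in> local_carrier z" unfolding J_def by blast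
    have "q * x = q * i + s * (q * r)" unfolding * by (simp add: algebra_simps)
    moreover have "q * i \<in> ?I" "q * r \<in> local_carrier z"
      by (rule submodule_mult[OF I q *(2)], rule local_carrier_closed(7)[OF q *(3)])
    ultimately show "q * x \<in> J" unfolding J_def by blast
  qed
  have red': "laurent coordinate (a - b) - scalar (laurent (($) z) (a - b)) \<in> J" if "a \<in> A - {b}" for a
  proof -
    have "laurent coordinate (a - b) - scalar (laurent (($) z) (a - b)) =
        (laurent coordinate (a - b) - (scalar (v a) + scalar (\<gamma> a) * s)) + s * scalar (\<gamma> a)"
      by (simp add: v_def)
    then show ?thesis using red[of a] that local_carrier_closed(1) unfolding J_def by blast
  qed
  have "coordinate i - scalar (z $ i) \<in> J" for i
  proof -
    obtain d N where d: "d > 0" "d *s axis i 1 = (\<Sum>a\<in>A-{b}. N a *s (a - b))"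
      using coordinate_basis[OF card] by blast
    show ?thesis by (rule monomials_determine_coordinates[OF J z_nonzero red' d])
  qed
  note step = local_congruent_scalar[OF J this]
  fix r assume "r \<in> local_carrier z"
  from step[OF this] obtain c where "r - scalar c \<in> J" ..
  then obtain i r' where *: "r - scalar c = i + s * r'" "i \<in> ?I" "r' \<in> local_carrier z" unfolding J_def by blast
  have "r - (scalar c + s * r') = i" using *(1) by (simp add: algebra_simps)
  then show "\<exists>c r'. r' \<in> local_carrier z \<and> r - (scalar c + s * r') \<in> ?I" using *(2,3) by blast
qed

lemma reduction_mod_ideal:
  assumes a: "a \<in> A"
  shows "laurent coordinate (a - b) - (\<Sum>c\<in>B. scalar (g a c) * laurent coordinate (c - b)) \<in> local_ideal F z"
proof -
  note I = local_submodule_ideal[of z F]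
  have "(\<Sum>j\<in>UNIV. scalar (h a j) * Fract (F j) 1) - (\<Sum>j\<in>(UNIV::'n set). 0) \<in> local_ideal F z"
  proof (rule congruent_sum[OF I])
    fix j
    have "scalar (h a j) * Fract (F j) 1 \<in> local_ideal F z"
      by (rule local_ideal_mult[OF local_carrier_closed(1) local_ideal_gen])
    then show "scalar (h a j) * Fract (F j) 1 - 0 \<in> local_ideal F z" by simp
  qed
  then have "laurent coordinate a - (\<Sum>c\<in>B. scalar (g a c) * laurent coordinate c) \<in> local_ideal F z"
    unfolding elimination[OF scalar.scalar_hom_axioms a] Fract_subst by simp
  moreover have "inverse (laurent coordinate b) \<in> local_carrier z"
    by (rule residue_carrier[OF I residue_inverse(1)[OF residue_laurent[OF z_nonzero] laurent_z_nonzero]])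
  ultimately have "inverse (laurent coordinate b) * (laurent coordinate a - (\<Sum>c\<in>B. scalar (g a c) * laurent coordinate c)) \<in> local_ideal F z"
    by (rule local_ideal_mult[rotated])
  then show ?thesis
    unfolding laurent_diff[OF coordinate_nonzero] by (simp add: right_diff_distrib sum_distrib_left divide_inverse mult_ac)
qed

lemma v_expansion: "a \<in> A \<Longrightarrow> v a = (\<Sum>c\<in>B. g a c * v c)"
proof -
  assume a: "a \<in> A"
  have "laurent (($) z) a - (\<Sum>c\<in>B. g a c * laurent (($) z) c) = 0"
    using elimination[OF id_hom.scalar_hom_axioms a, of "($) z"] z_zero by (simp add: mpoly_eval_subst[symmetric])
  then have "laurent (($) z) a = (\<Sum>c\<in>B. g a c * laurent (($) z) c)" by simp
  then show ?thesis by (simp add: v_def laurent_diff z_nonzero sum_divide_distrib)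
qed

text \<open>
  If every relation held identically along the line in direction \<open>c\<close>, then almost every point of that line
  would lift to a zero in the torus.
\<close>
lemma nonidentical_relation_exists:
  assumes c: "c \<in> B" "c \<noteq> b"
  shows "\<exists>e. is_relation e \<and>
    side c e \<noteq> side c (\<lambda>a. - e a)"
proof (rule ccontr)
  assume no: "\<not> ?thesis"
  define \<tau> where "\<tau> = (\<lambda>t c'. if c' = c then t else (0::'k))"
  define U where "U = {t. \<forall>a\<in>A. v a + g a c * t \<noteq> 0}"
  have "infinite U" unfolding U_def by (rule infinite_nonzero_affine[OF finA v_nonzero])
  moreover have "inj_on \<tau> U" by (rule inj_onI) (metis \<tau>_def)
  ultimately have inf: "infinite (\<tau> ` U)" by (metis finite_imageD)
  have sum: "(\<Sum>c'\<in>{c}. g a c' * \<tau> t c') = g a c * t" for a t by (simp add: \<tau>_def)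
  show False
  proof (rule no_infinite_family[OF inf, of "{c}"])
    show "{c} \<subseteq> B - {b}" using c by simp
  next
    fix \<sigma> a assume "\<sigma> \<in> \<tau> ` U" and a: "a \<in> A"
    then obtain t where t: "t \<in> U" "\<sigma> = \<tau> t" by blast
    show "v a + (\<Sum>c'\<in>{c}. g a c' * \<sigma> c') \<noteq> 0" unfolding t(2) sum using t(1) a unfolding U_def by simp
  next
    fix \<sigma> e assume "\<sigma> \<in> \<tau> ` U" and e: "is_relation e"
    then obtain t where t: "t \<in> U" "\<sigma> = \<tau> t" by blast
    have "side c e = side c (\<lambda>a. - e a)"
      using no e by simp
    then have "poly (side c e) t = poly (side c (\<lambda>a. - e a)) t"
      by (rule arg_cong)
    then have eq: "(\<Prod>a\<in>A-{b}. (v a + g a c * t) ^ nat (e a)) = (\<Prod>a\<in>A-{b}. (v a + g a c * t) ^ nat (- e a))"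
      by (simp add: poly_prod mult.commute[of t])
    have "(\<Prod>a\<in>A-{b}. (v a + g a c * t) powi e a) = 1"
      by (subst prod_powi_eq_one_iff) (use finA t(1) eq in \<open>simp_all add: U_def\<close>)
    then show "(\<Prod>a\<in>A-{b}. (v a + (\<Sum>c'\<in>{c}. g a c' * \<sigma> c')) powi e a) = 1" unfolding t(2) sum .
  next
    fix \<sigma> c' assume "\<sigma> \<in> \<tau> ` U" "c' \<notin> {c}"
    then show "\<sigma> c' = 0" by (auto simp: \<tau>_def)
  qed
qed

text \<open>
  With \<open>n + 1\<close> points in general position the vectors \<open>a - b\<close> are linearly independent.
\<close>
lemma relations_trivial:
  assumes card: "card A = CARD('n) + 1" and e: "is_relation e" and a: "a \<in> A - {b}"
  shows "e a = 0"
proof (rule general_position_basis(2)[OF gen _ _ _ e a])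
  show "insert b (A - {b}) \<subseteq> A" using b_in_A by simp
  show "card (A - {b}) = CARD('n)" using card b_in_A finA by simp
qed simp

text \<open>
  A second free monomial would call for a nontrivial relation, and there is none. With \<open>b\<close> alone free,
  the monomials \<open>x\<^sup>a\<^sup>-\<^sup>b\<close> are constant modulo the ideal, which is the case \<open>s = 0\<close>.
\<close>
lemma dimension_bound_simplex:
  assumes card: "card A = CARD('n) + 1"
  shows "local_dimension_at_most F z 1"
proof -
  have "B = {b}"
  proof (rule ccontr)
    assume "B \<noteq> {b}"
    then obtain c where c: "c \<in> B" "c \<noteq> b" using bB by blast
    obtain e where e: "is_relation e"
      "side c e \<noteq> side c (\<lambda>a. - e a)"
      using nonidentical_relation_exists[OF c] by blast
    have "e a = 0" if "a \<in> A - {b}" for a by (rule relations_trivial[OF card e(1) that])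
    then show False using e(2) by simp
  qed
  show ?thesis
  proof (rule local_dimension_bound[where s = 0 and \<gamma> = "\<lambda>_. 0"])
    show "card A > CARD('n)" using card by simp
    show "residue z 0 0" using residue_scalar[of z 0] by simp
    show "0 ^ 1 \<in> local_ideal F z" using local_ideal_zero by simp
    fix a assume a: "a \<in> A"
    have "v a = g a b" using v_expansion[OF a] \<open>B = {b}\<close> v_b by simp
    then show "laurent coordinate (a - b) - (scalar (v a) + scalar 0 * 0) \<in> local_ideal F z"
      using reduction_mod_ideal[OF a] \<open>B = {b}\<close> by simp
  qed
qed

text \<open>
  Three free monomials leave a plane of candidates through \<open>v\<close>. All relations are multiples of one
  relation \<open>m\<close>, so the candidates that lift are those on a single curve with all coordinates
  nonzero. The curve passes through the origin of the plane, which corresponds to \<open>z\<close>.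
\<close>
lemma no_three_free_monomials:
  assumes card: "card A = CARD('n) + 2" and c: "c1 \<in> B" "c2 \<in> B" "c1 \<noteq> b" "c2 \<noteq> b" "c1 \<noteq> c2"
  shows False
proof -
  have "card (A - {b}) = CARD('n) + 1" using card b_in_A finA by simp
  then have "A - {b} \<noteq> {}" by (intro notI) simp
  then obtain p where p: "p \<in> A - {b}" by blast
  define S where "S = A - {b} - {p}"
  have S1: "A - {b} = insert p S" using p unfolding S_def by blast
  have S2: "p \<notin> S" "b \<notin> S" unfolding S_def by simp_all
  have S3: "finite S" unfolding S_def using finA by simp
  have S4: "card S = CARD('n)" unfolding S_def using p finA \<open>card (A - {b}) = _\<close> by simp
  have S5: "insert b S \<subseteq> A" unfolding S_def using b_in_A by blast
  obtain m where m: "(\<Sum>a\<in>insert p S. m a *s (a - b)) = 0"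
    "\<forall>e. (\<Sum>a\<in>insert p S. e a *s (a - b)) = 0 \<longrightarrow> (\<exists>k. \<forall>a\<in>insert p S. e a = k * m a)"
  proof -
    have "\<exists>m. (\<Sum>a\<in>insert p S. m a *s (a - b)) = 0 \<and>
      (\<forall>e. (\<Sum>a\<in>insert p S. e a *s (a - b)) = 0 \<longrightarrow> (\<exists>k. \<forall>a\<in>insert p S. e a = k * m a))"
    proof (rule integer_relations_cyclic[OF S3 S2(1)])
      show "e a = 0" if "(\<Sum>a\<in>S. e a *s (a - b)) = 0" "a \<in> S" for e a
        by (rule general_position_basis(2)[OF gen S5 S2(2) S4 that])
    qed
    then show thesis by (elim exE conjE) (rule that)
  qed
  define \<tau> where "\<tau> = (\<lambda>(t, u) c. if c = c1 then t else if c = c2 then u else (0::'k))"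
  define U where "U = {(t, u). (\<forall>a\<in>A-{b}. v a + g a c1 * t + g a c2 * u \<noteq> 0) \<and>
    (\<Prod>a\<in>A-{b}. (v a + g a c1 * t + g a c2 * u) ^ nat (m a)) = (\<Prod>a\<in>A-{b}. (v a + g a c1 * t + g a c2 * u) ^ nat (- m a))}"
  have "infinite U" unfolding U_def
  proof (rule infinitely_many_zeros_off_lines)
    have "(\<Prod>a\<in>A-{b}. v a powi m a) = laurent (($) z) (\<Sum>a\<in>A-{b}. m a *s (a - b))"
      unfolding v_def by (subst laurent_sum) (rule z_nonzero, simp only: laurent_scale)
    also have "\<dots> = 1" unfolding S1 m(1) by simp
    finally show "(\<Prod>a\<in>A-{b}. v a ^ nat (m a)) = (\<Prod>a\<in>A-{b}. v a ^ nat (- m a))"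
      by (subst (asm) prod_powi_eq_one_iff) (use finA v_nonzero in simp_all)
  qed (use finA v_nonzero in simp_all)
  moreover have "inj_on \<tau> U"
  proof (rule inj_onI)
    fix x y assume eq: "\<tau> x = \<tau> y"
    obtain t u where x: "x = (t, u)" by (rule prod.exhaust)
    obtain t' u' where y: "y = (t', u')" by (rule prod.exhaust)
    note xy = x y
    have "\<tau> x c1 = \<tau> y c1" "\<tau> x c2 = \<tau> y c2" using eq by simp_all
    then show "x = y" using c(5) by (simp add: xy \<tau>_def)
  qed
  ultimately have inf: "infinite (\<tau> ` U)" by (metis finite_imageD)
  have sum: "v a + (\<Sum>c\<in>{c1, c2}. g a c * \<tau> (t, u) c) = v a + g a c1 * t + g a c2 * u" for a t u
    using c(5) by (simp add: \<tau>_def)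
  have wb: "v b + g b c1 * t + g b c2 * u = 1" for t u
    using gB[OF bB c(1)] gB[OF bB c(2)] c(3,4) v_b by simp
  show False
  proof (rule no_infinite_family[OF inf, of "{c1, c2}"])
    show "{c1, c2} \<subseteq> B - {b}" using c by simp
  next
    fix \<sigma> a assume "\<sigma> \<in> \<tau> ` U" and a: "a \<in> A"
    then obtain t u where t: "(t, u) \<in> U" "\<sigma> = \<tau> (t, u)" by (elim imageE) (simp only: split_paired_all)
    show "v a + (\<Sum>c\<in>{c1, c2}. g a c * \<sigma> c) \<noteq> 0"
    proof (cases "a = b")
      case True
      then show ?thesis unfolding t(2) sum True wb by simp
    next
      case False
      then show ?thesis unfolding t(2) sum using t(1) a unfolding U_def by simp
    qed
  next
    fix \<sigma> e assume "\<sigma> \<in> \<tau> ` U" and e: "is_relation e"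
    then obtain t u where t: "(t, u) \<in> U" "\<sigma> = \<tau> (t, u)" by (elim imageE) (simp only: split_paired_all)
    define w where "w = (\<lambda>a. v a + g a c1 * t + g a c2 * u)"
    from m(2)[rule_format, OF e[unfolded S1]] obtain k where "\<forall>a\<in>A-{b}. e a = k * m a" unfolding S1 ..
    then have k: "e a = k * m a" if "a \<in> A - {b}" for a using that by (rule bspec)
    have wU: "(\<forall>a\<in>A-{b}. w a \<noteq> 0) \<and> (\<Prod>a\<in>A-{b}. w a ^ nat (m a)) = (\<Prod>a\<in>A-{b}. w a ^ nat (- m a))"
      using t(1) unfolding U_def w_def mem_Collect_eq case_prod_conv .
    have wm: "(\<Prod>a\<in>A-{b}. w a powi m a) = 1"
    proof (rule prod_powi_eq_one_iff[THEN iffD2])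
      show "w a \<noteq> 0" if "a \<in> A - {b}" for a using wU that by (elim conjE) (rule bspec)
    qed (use finA wU in simp_all)
    have "(\<Prod>a\<in>A-{b}. w a powi e a) = (\<Prod>a\<in>A-{b}. (w a powi m a) powi k)"
    proof (rule prod.cong)
      fix a assume "a \<in> A - {b}"
      then have "e a = m a * k" using k by (simp add: mult.commute)
      then show "w a powi e a = (w a powi m a) powi k" by (simp only: power_int_mult)
    qed simp
    also have "\<dots> = (\<Prod>a\<in>A-{b}. w a powi m a) powi k" by (rule prod_powi[symmetric])
    finally have "(\<Prod>a\<in>A-{b}. w a powi e a) = 1" unfolding wm by simp
    then show "(\<Prod>a\<in>A-{b}. (v a + (\<Sum>c\<in>{c1, c2}. g a c * \<sigma> c)) powi e a) = 1"
      unfolding t(2) sum w_def .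
  next
    fix \<sigma> c assume "\<sigma> \<in> \<tau> ` U" and c: "c \<notin> {c1, c2}"
    then obtain x where "\<sigma> = \<tau> x" by blast
    then show "\<sigma> c = 0" using c by (simp add: \<tau>_def split_beta)
  qed
qed

text \<open>
  Exactly two monomials are free, and a relation that is not an identity along the line they leave bounds
  the exponent of nilpotency of \<open>s\<close> by the number \<open>n + 1\<close> of the vectors \<open>a - b\<close>.
\<close>
lemma dimension_bound_circuit:
  assumes card: "card A = CARD('n) + 2" and B2: "card B \<ge> 2"
  shows "local_dimension_at_most F z (CARD('n) + 1)"
proof -
  have finB: "finite B" using BA finA by (rule finite_subset)
  have "card (B - {b}) \<ge> 1" using B2 bB finB by simp
  then have "B - {b} \<noteq> {}" by (metis card.empty not_one_le_zero)
  then obtain c where c: "c \<in> B" "c \<noteq> b" by blast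
  have B: "B = {b, c}" using no_three_free_monomials[OF card] bB c by blast
  obtain e where e: "is_relation e"
    "side c e \<noteq> side c (\<lambda>a. - e a)"
    using nonidentical_relation_exists[OF c] by blast
  define s where "s = laurent coordinate (c - b) - scalar (v c)"
  have s: "residue z s 0"
    using residue_diff[OF residue_laurent[OF z_nonzero] residue_scalar, of "c - b" "v c"] by (simp add: s_def v_def)
  have red: "laurent coordinate (a - b) - (scalar (v a) + scalar (g a c) * s) \<in> local_ideal F z" if a: "a \<in> A" for a
  proof -
    have "v a = g a b + g a c * v c" using v_expansion[OF a] c v_b unfolding B by simp
    then have "scalar (v a) + scalar (g a c) * s = scalar (g a b) + scalar (g a c) * laurent coordinate (c - b)"
      by (simp add: s_def algebra_simps)
    then show ?thesis using reduction_mod_ideal[OF a] c unfolding B by simp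
  qed
  have cardA: "card (A - {b}) = CARD('n) + 1" using card b_in_A finA by simp
  show ?thesis
  proof (rule local_dimension_bound[OF _ s red])
    show "card A > CARD('n)" using card by simp
    show "s ^ (CARD('n) + 1) \<in> local_ideal F z"
    proof (rule power_mem_of_eval_at_mem[OF local_submodule_ideal s])
      show "eval_at s ((side c e) - (side c (\<lambda>a. - e a))) \<in> local_ideal F z"
        by (rule relation_polynomial_mem[OF local_submodule_ideal z_nonzero s v_nonzero _ e(1)]) (rule red, simp)
      show "\<not> [:0, 1:] ^ Suc (CARD('n) + 1) dvd
          (side c e) - (side c (\<lambda>a. - e a))"
        using prod_power_diff_order_bound[of "A - {b}" v "\<lambda>a. g a c" e] finA v_nonzero e(2) unfolding cardA by blast
    qed
  qed
qed

end

lemma multiplicity_bounds: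
  fixes A :: "(int ^ 'n::{finite,linorder}) set" and F :: "'n \<Rightarrow> ('n, 'k::{alg_closed_field,field_char_0}) mpoly"
  assumes A: "finite A" "no_hyperplane_subset A" and supp: "\<And>j. mpoly_support (F j) \<subseteq> A"
    and fin: "finite (torus_zeros F)" and z: "z \<in> torus_zeros F"
  shows "card A = CARD('n) + 1 \<Longrightarrow> local_dimension_at_most F z 1"
    and "card A = CARD('n) + 2 \<Longrightarrow> local_dimension_at_most F z (CARD('n) + 1)"
proof -
  obtain B g h where B: "B \<subseteq> A" and card: "card A \<le> card B + CARD('n)"
    and ker: "\<And>j b. b \<in> B \<Longrightarrow> (\<Sum>a\<in>A. lattice_coeff (F j) a * g a b) = 0"
    and gB: "\<And>b b'. b \<in> B \<Longrightarrow> b' \<in> B \<Longrightarrow> g b b' = (if b = b' then 1 else 0)"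
    and rep: "\<And>a a'. a \<in> A \<Longrightarrow> a' \<in> A \<Longrightarrow> (if a = a' then 1 else 0) =
        (if a' \<in> B then g a a' else 0) + (\<Sum>j\<in>UNIV. h a j * lattice_coeff (F j) a')"
  proof -
    from gaussian_elimination[OF A(1) finite_class.finite_UNIV, of "\<lambda>j. lattice_coeff (F j)"]
    obtain B g h where "B \<subseteq> A \<and> card A \<le> card B + CARD('n) \<and>
      (\<forall>j\<in>UNIV. \<forall>b\<in>B. (\<Sum>a\<in>A. lattice_coeff (F j) a * g a b) = 0) \<and>
      (\<forall>b\<in>B. \<forall>b'\<in>B. g b b' = (if b = b' then 1 else 0)) \<and>
      (\<forall>a\<in>A. \<forall>a'\<in>A. (if a = a' then 1 else 0) =
        (if a' \<in> B then g a a' else 0) + (\<Sum>j\<in>UNIV. h a j * lattice_coeff (F j) a'))"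
      by (elim exE)
    then show thesis by (intro that[of B g h]) simp_all
  qed
  have sys: "reduced_system A B F z g h b" if "b \<in> B" for b
    by (intro reduced_system.intro A supp fin z B that ker gB rep)
  {
    assume c: "card A = CARD('n) + 1"
    then have "card B \<noteq> 0" using card by linarith
    then have "B \<noteq> {}" by (intro notI) simp
    then obtain b where "b \<in> B" by blast
    then interpret reduced_system A B F z g h b by (rule sys)
    show "local_dimension_at_most F z 1"
      by (rule dimension_bound_simplex[OF c])
  }
  {
    assume c: "card A = CARD('n) + 2"
    then have "card B \<ge> 2" using card by linarith
    then have "B \<noteq> {}" by (intro notI) simp
    then obtain b where "b \<in> B" by blast
    then interpret reduced_system A B F z g h b by (rule sys)
    show "local_dimension_at_most F z (CARD('n) + 1)"
      by (rule dimension_bound_circuit[OF c \<open>card B \<ge> 2\<close>])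
  }
qed

section \<open>Systems attaining the bounds\<close>

definition power_vector :: "('n::finite \<Rightarrow> nat) \<Rightarrow> 'n \<Rightarrow>\<^sub>0 nat"
  where "power_vector f = (\<Sum>i\<in>UNIV. Poly_Mapping.single i (f i))"

lemma lookup_power_vector [simp]: "Poly_Mapping.lookup (power_vector f) i = f i"
  by (simp add: power_vector_def lookup_sum lookup_single when_def)

lemma mpoly_support_single: "mpoly_support (Poly_Mapping.single (power_vector f) c) \<subseteq> {\<chi> i. int (f i)}"
  by (simp add: mpoly_support_def)

lemma mpoly_support_diff: "mpoly_support (p - q) \<subseteq> mpoly_support p \<union> mpoly_support (q :: ('n::finite, 'k::ab_group_add) mpoly)"
proof -
  have "Poly_Mapping.keys (p - q) \<subseteq> Poly_Mapping.keys p \<union> Poly_Mapping.keys q"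
    by (auto simp: in_keys_iff lookup_minus)
  then show ?thesis unfolding mpoly_support_def by blast
qed

text \<open>
  The system \<open>x\<^sub>j = 1\<close> supported on the standard simplex. Every multiplicity is at least 1 because the
  local quotient is not zero; the diagonal line serves as the curve in \<open>local_dimension_ge\<close>.
\<close>
lemma simplex_example:
  "\<exists>(A :: (int ^ 'n::{finite,linorder}) set) (F :: 'n \<Rightarrow> ('n, 'k::{alg_closed_field,field_char_0}) mpoly).
     finite A \<and> card A = CARD('n) + 1 \<and> no_hyperplane_subset A \<and>
     (\<forall>j. mpoly_support (F j) \<subseteq> A) \<and> finite (torus_zeros F) \<and>
     (\<exists>z \<in> torus_zeros F. intersection_multiplicity F z = 1)"
proof -
  define A :: "(int ^ 'n::{finite,linorder}) set" where "A = insert 0 (range (\<lambda>j. axis j 1))"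
  define F :: "'n \<Rightarrow> ('n, 'k) mpoly" where "F = (\<lambda>j. mpoly_var j - 1)"
  define z :: "'k ^ 'n::{finite,linorder}" where "z = (\<chi> i. 1)"
  have inj: "inj (\<lambda>j. axis j (1::int) :: int ^ 'n::{finite,linorder})" by (rule injI) (simp add: axis_eq_axis)
  have "(0 :: int ^ 'n::{finite,linorder}) \<notin> range (\<lambda>j. axis j 1)" by (auto simp: axis_eq_0_iff)
  then have card: "card A = CARD('n) + 1" unfolding A_def using card_image[OF inj] by simp
  have finA: "finite A" unfolding A_def by simp
  have gen: "no_hyperplane_subset A"
    unfolding no_hyperplane_subset_def affine_hyperplane_def
  proof (intro notI, elim exE conjE)
    fix S H v c
    assume S: "S \<subseteq> A" "card S = CARD('n) + 1" "real_point ` S \<subseteq> H" and v: "v \<noteq> 0" "H = {x. v \<bullet> x = (c::real)}"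
    have "S = A" using card_subset_eq[OF finA S(1)] S(2) card by simp
    then have on: "v \<bullet> real_point a = c" if "a \<in> A" for a using S(3) v(2) that by auto
    have "real_point 0 = (0 :: real ^ 'n::{finite,linorder})" by (simp add: real_point_def vec_eq_iff)
    then have "c = 0" using on[of 0] by (simp add: A_def)
    have "real_point (axis j 1) = (axis j 1 :: real ^ 'n::{finite,linorder})" for j
      by (simp add: real_point_def vec_eq_iff axis_def)
    then have "v $ j = 0" for j using on[of "axis j 1"] \<open>c = 0\<close> by (simp add: A_def inner_axis)
    then show False using v(1) by (simp add: vec_eq_iff)
  qed
  have supp: "mpoly_support (F j) \<subseteq> A" for j
  proof -
    have "mpoly_support (mpoly_var j :: ('n, 'k) mpoly) \<subseteq> {axis j 1}"
      by (auto simp: mpoly_support_def mpoly_var_def vec_eq_iff axis_def lookup_single when_def)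
    moreover have "mpoly_support (1 :: ('n, 'k) mpoly) \<subseteq> {0}"
      by (auto simp: mpoly_support_def vec_eq_iff)
    ultimately show ?thesis using mpoly_support_diff[of "mpoly_var j" "1 :: ('n, 'k) mpoly"] unfolding F_def A_def by auto
  qed
  have zeros: "torus_zeros F = {z}"
  proof -
    have "x \<in> torus_zeros F \<longleftrightarrow> x = z" for x
      by (auto simp: torus_zeros_def F_def z_def vec_eq_iff)
    then show ?thesis by blast
  qed
  interpret local_zero F z by unfold_locales (simp add: F_def z_def)
  obtain d where d: "d \<le> 1" "ring.dimension Q d K (carrier Q)"
  proof -
    have "finite (torus_zeros F)" "z \<in> torus_zeros F" using zeros by simp_all
    from multiplicity_bounds(1)[OF finA gen supp this card] show thesis by (elim exE conjE) (rule that)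
  qed
  have v: "along_arc (\<lambda>_. [:1, 1:]) (mpoly_var j) = [:1, 1 :: 'k:]" for j :: 'n
    by (rule cpoly.subst_var)
  have F: "along_arc (\<lambda>_. [:1, 1:]) (F j) = [:0, 1:]" for j
    unfolding F_def cpoly.subst_diff cpoly.subst_one v unfolding one_pCons
    by (simp only: diff_pCons diff_self diff_0_right)
  have "1 \<le> d"
  proof (rule local_dimension_ge[OF _ _ F d(2)])
    show "poly [:1, 1:] 0 = z $ i" for i by (simp add: z_def)
    show "[:0, 1:] ^ 1 dvd along_arc (\<lambda>_. [:1, 1:]) (F j)" for j unfolding F by simp
  qed
  then have "intersection_multiplicity F z = 1"
    using intersection_multiplicityI[OF d(2)] d(1) by (simp add: one_enat_def)
  then show ?thesis using finA card gen supp zeros by (intro exI[of _ A] exI[of _ F]) simp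
qed

text \<open>
  The equations express that the point lies on the line \<open>x\<^sub>j = 1 + \<iota> j * r\<close> and that the monomial with
  exponent vector \<open>(e (\<iota> j))\<^sub>j\<close> takes the value \<open>1 + N r\<close>. On the line this is the equation
  \<open>\<Prod> (1 + i r)\<^sup>e\<^sup>i = 1\<close> over \<open>i = 1, \<dots>, N\<close>, of order \<open>N\<close> at 0. The exponents may be
  negative, so everything is multiplied by the monomial with exponent vector \<open>t\<close>, the negative part. The
  numbers \<open>m\<close> are the coefficients of the affine relation between the \<open>N + 1\<close> points of the support.
\<close>
locale circuit_example =
  fixes \<iota> :: "'n::{finite,linorder} \<Rightarrow> nat" and N :: nat and e m :: "nat \<Rightarrow> int"
  assumes \<iota>: "bij_betw \<iota> UNIV {1..CARD('n)}"
  defines "N \<equiv> CARD('n) + 1"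
  defines "e \<equiv> \<lambda>i. (-1) ^ (N + 1 + i) * int (N choose i)"
  defines "m \<equiv> \<lambda>i. (-1) ^ i * int (N choose i)"
begin

definition t :: "'n \<Rightarrow> nat" where "t j = nat (- e (\<iota> j))"
definition s :: "'n \<Rightarrow> nat" where "s j = nat (e (\<iota> j))"

lemma s_minus_t: "int (s j) - int (t j) = e (\<iota> j)"
  by (simp add: s_def t_def)

lemma \<iota>_range: "\<iota> j \<ge> 1" "\<iota> j \<le> CARD('n)" "\<iota> j < N"
proof -
  have "\<iota> j \<in> {1..CARD('n)}" using \<iota> by (auto simp: bij_betw_def)
  then show "\<iota> j \<ge> 1" "\<iota> j \<le> CARD('n)" "\<iota> j < N" by (auto simp: N_def)
qed

lemma \<iota>_inj: "\<iota> j = \<iota> k \<longleftrightarrow> j = k"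
  using \<iota> by (auto simp: bij_betw_def inj_on_def)

lemma \<iota>_surj: "1 \<le> i \<Longrightarrow> i < N \<Longrightarrow> \<exists>j. \<iota> j = i"
  using \<iota> unfolding bij_betw_def N_def by (metis (no_types, lifting) Suc_eq_plus1 atLeastAtMost_iff imageE less_Suc_eq_le)

definition point :: "nat \<Rightarrow> int ^ 'n::{finite,linorder}"
  where "point i = (\<chi> k. int (t k) + (if i = \<iota> k then 1 else 0) + (if i = N then e (\<iota> k) else 0))"

definition A :: "(int ^ 'n::{finite,linorder}) set" where "A = point ` {0..N}"

lemma e_N: "e N = -1"
  by (simp add: e_def flip: mult_2)

lemma point_neq:
  assumes "i < i'" "i' \<le> N"
  shows "point i \<noteq> point i'"
proof (cases "i' = N")
  case True
  \<comment> \<open>Relative to \<open>t\<close> the last point has the entry \<open>N\<close> here, every other point 0 or 1.\<close>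
  obtain k where k: "\<iota> k = N - 1" using \<iota>_surj[of "N - 1"] by (auto simp: N_def)
  have "N + 1 + (N - 1) = 2 * N" by (simp add: N_def)
  then have "e (N - 1) = int (N choose (N - 1))" unfolding e_def by (simp add: power_mult)
  also have "N choose (N - 1) = N choose 1" using binomial_symmetric[of 1 N] by (simp add: N_def)
  finally have "e (N - 1) \<ge> 2" by (simp add: N_def)
  then have "point i $ k \<noteq> point i' $ k" using assms True k \<iota>_range(3)[of k] by (simp add: point_def)
  then show ?thesis by metis
next
  case False
  then obtain k where "\<iota> k = i'" using \<iota>_surj[of i'] assms by auto
  then have "point i $ k \<noteq> point i' $ k" using assms False by (simp add: point_def)
  then show ?thesis by metis
qed

lemma card_A: "card A = CARD('n) + 2" and finite_A: "finite A"
proof -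
  have "inj_on point {0..N}"
  proof (rule inj_onI)
    fix i i' assume "i \<in> {0..N}" "i' \<in> {0..N}" "point i = point i'"
    then show "i = i'" using point_neq[of i i'] point_neq[of i' i] by (cases i i' rule: linorder_cases) auto
  qed
  then show "card A = CARD('n) + 2" unfolding A_def by (subst card_image) (simp_all add: N_def)
  show "finite A" unfolding A_def by simp
qed

lemma sum_m: "(\<Sum>i\<in>{0..N}. m i) = 0"
  using choose_alternating_sum[of N, where 'a = int] by (simp add: m_def N_def atMost_atLeast0)

lemma sum_m_point: "(\<Sum>i\<in>{0..N}. m i * point i $ k) = 0"
proof -
  have "(\<Sum>i\<in>{0..N}. m i * point i $ k) = (\<Sum>i\<in>{0..N}. m i) * int (t k) +
      (\<Sum>i\<in>{0..N}. if i = \<iota> k then m i else 0) + (\<Sum>i\<in>{0..N}. if i = N then m i * e (\<iota> k) else 0)"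
    unfolding sum_distrib_right sum.distrib[symmetric]
    by (rule sum.cong) (simp_all add: point_def algebra_simps)
  also have "\<dots> = m (\<iota> k) + m N * e (\<iota> k)"
    unfolding sum_m using \<iota>_range[of k] by simp
  also have "m N * e (\<iota> k) = - m (\<iota> k)"
    unfolding m_def e_def power_add by (simp flip: power_mult_distrib)
  finally show ?thesis by simp
qed

text \<open>
  All coefficients of the affine relation are nonzero, so a hyperplane through all but one of the points
  contains the last one as well. But the points \<open>point 0\<close> and \<open>point (\<iota> k)\<close> differ by a unit vector, so no
  hyperplane contains them all.
\<close>
lemma general_position_A: "no_hyperplane_subset A"
  unfolding no_hyperplane_subset_def affine_hyperplane_def
proof (intro notI, elim exE conjE)
  fix S H v c
  assume S: "S \<subseteq> A" "card S = CARD('n) + 1" "real_point ` S \<subseteq> H" and v: "v \<noteq> 0" "H = {x. v \<bullet> x = (c::real)}"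
  have "card (A - S) = 1" using card_Diff_subset[OF finite_subset[OF S(1) finite_A] S(1)] card_A S(2) by simp
  then obtain q where q: "A - S = {q}" by (rule card_1_singletonE)
  then obtain l where l: "l \<in> {0..N}" "q = point l" unfolding A_def by blast
  let ?f = "\<lambda>i. v \<bullet> real_point (point i) - c"
  have on: "?f i = 0" if "i \<in> {0..N}" "i \<noteq> l" for i
  proof -
    have "point i \<noteq> q" using point_neq[of i l] point_neq[of l i] that l by (cases i l rule: linorder_cases) auto
    moreover have "point i \<in> A" using that(1) by (simp add: A_def)
    ultimately have "point i \<in> S" using q by blast
    then show ?thesis using S(3) v(2) by auto
  qed
  have "(\<Sum>i\<in>{0..N}. of_int (m i) * ?f i) = 0"
  proof -
    have "(\<Sum>i\<in>{0..N}. of_int (m i) * (v \<bullet> real_point (point i))) = (\<Sum>i\<in>{0..N}. \<Sum>k\<in>UNIV. v $ k * of_int (m i * point i $ k))"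
      by (simp add: inner_vec_def real_point_def sum_distrib_left mult_ac)
    also have "\<dots> = (\<Sum>k\<in>UNIV. v $ k * of_int (\<Sum>i\<in>{0..N}. m i * point i $ k))"
      by (subst sum.swap) (simp add: sum_distrib_left)
    also have "\<dots> = 0" unfolding sum_m_point by simp
    finally have "(\<Sum>i\<in>{0..N}. of_int (m i) * (v \<bullet> real_point (point i))) = 0" .
    moreover have "(\<Sum>i\<in>{0..N}. of_int (m i) * c) = of_int (\<Sum>i\<in>{0..N}. m i) * c"
      by (simp add: sum_distrib_right)
    ultimately show ?thesis unfolding sum_m by (simp add: right_diff_distrib sum_subtractf)
  qed
  moreover have "(\<Sum>i\<in>{0..N}. of_int (m i) * ?f i) = (\<Sum>i\<in>{0..N}. if i = l then of_int (m i) * ?f i else 0)"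
    using on by (intro sum.cong) auto
  ultimately have "of_int (m l) * ?f l = 0" using l(1) by simp
  moreover have "m l \<noteq> 0" using l(1) by (simp add: m_def)
  ultimately have "?f l = 0" by simp
  then have all: "v \<bullet> real_point (point i) = c" if "i \<le> N" for i using on[of i] that by (cases "i = l") auto
  have "v $ k = 0" for k
  proof -
    have "real_point (point (\<iota> k)) - real_point (point 0) = axis k 1"
    proof -
      have "0 \<noteq> \<iota> i" "0 \<noteq> N" "\<iota> i \<noteq> N" for i using \<iota>_range[of i] by simp_all
      then show ?thesis by (simp add: real_point_def point_def vec_eq_iff axis_def \<iota>_inj) (metis less_irrefl)
    qed
    moreover have "v \<bullet> (real_point (point (\<iota> k)) - real_point (point 0)) = 0"
      unfolding inner_diff_right using all[of "\<iota> k"] all[of 0] \<iota>_range(3)[of k] by simp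
    ultimately have "v \<bullet> axis k 1 = 0" by (simp only:)
    then show ?thesis by (simp add: inner_axis)
  qed
  then show False using v(1) by (simp add: vec_eq_iff)
qed

text \<open>
  With \<open>r = (x\<^sup>s\<^sup>-\<^sup>t - 1) / N\<close>, the equation \<open>F j = 0\<close> says \<open>x\<^sub>j - 1 = \<iota> j * r\<close>, multiplied by \<open>x\<^sup>t\<close>.
\<close>
definition F :: "'n \<Rightarrow> ('n, 'k::{alg_closed_field,field_char_0}) mpoly" where
  "F j = Poly_Mapping.single (power_vector (\<lambda>i. t i + (if i = j then 1 else 0))) 1
     - Poly_Mapping.single (power_vector t) 1
     - (Poly_Mapping.single (power_vector s) (of_nat (\<iota> j) / of_nat N)
        - Poly_Mapping.single (power_vector t) (of_nat (\<iota> j) / of_nat N))"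

lemma support_F: "mpoly_support (F j) \<subseteq> A"
proof -
  have t: "(\<chi> i. int (t i)) \<in> A"
  proof -
    have "0 \<noteq> \<iota> i" "0 \<noteq> N" for i using \<iota>_range[of i] by simp_all
    then have "(\<chi> i. int (t i)) = point 0" by (simp add: point_def vec_eq_iff)
    then show ?thesis by (simp add: A_def)
  qed
  have s: "(\<chi> i. int (s i)) \<in> A"
  proof -
    have "N \<noteq> \<iota> i" for i using \<iota>_range(3)[of i] by simp
    then have "(\<chi> i. int (s i)) = point N"
      using s_minus_t by (simp add: point_def vec_eq_iff) (metis add.commute diff_add_cancel)
    then show ?thesis by (simp add: A_def)
  qed
  have tj: "(\<chi> i. int (t i + (if i = j then 1 else 0))) \<in> A"
  proof -
    have "\<iota> j \<noteq> N" using \<iota>_range(3)[of j] by simp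
    then have "(\<chi> i. int (t i + (if i = j then 1 else 0))) = point (\<iota> j)"
      by (simp add: point_def vec_eq_iff \<iota>_inj)
    then show ?thesis using \<iota>_range(3)[of j] by (simp add: A_def)
  qed
  show ?thesis
    unfolding F_def
    by (intro subset_trans[OF mpoly_support_diff] Un_least subset_trans[OF mpoly_support_single])
       (use t s tj in \<open>simp_all del: of_nat_add\<close>)
qed

lemma subst_F:
  assumes "scalar_hom \<kappa>"
  shows "mpoly_subst \<kappa> x (F j) = (\<Prod>i\<in>UNIV. x i ^ t i) * (x j - 1)
    - \<kappa> (of_nat (\<iota> j) / of_nat N) * ((\<Prod>i\<in>UNIV. x i ^ s i) - (\<Prod>i\<in>UNIV. x i ^ t i))"
proof -
  interpret \<kappa>: scalar_hom \<kappa> by (rule assms)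
  have "(\<Prod>i\<in>UNIV. x i ^ (if i = j then 1 else 0)) = x j"
    by (simp add: if_distrib[of "\<lambda>k. _ ^ k"] cong: if_cong)
  then show ?thesis
    unfolding F_def by (simp add: power_add prod.distrib right_diff_distrib)
qed

definition P :: "'k::field_char_0 poly" where "P = (\<Prod>j\<in>UNIV. [:1, of_nat (\<iota> j):] ^ s j)"
definition R :: "'k::field_char_0 poly" where "R = (\<Prod>j\<in>UNIV. [:1, of_nat (\<iota> j):] ^ t j) * [:1, of_nat N:]"

lemma prod_split: "(\<Prod>i\<in>{1..N}. h i) = (\<Prod>j\<in>UNIV. h (\<iota> j)) * h N" for h :: "nat \<Rightarrow> 'r::comm_monoid_mult"
proof -
  have "{1..N} = insert N {1..CARD('n)}" by (auto simp: N_def)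
  moreover have "N \<notin> {1..CARD('n)}" by (simp add: N_def)
  ultimately have "(\<Prod>i\<in>{1..N}. h i) = h N * (\<Prod>i\<in>{1..CARD('n)}. h i)" by simp
  also have "(\<Prod>i\<in>{1..CARD('n)}. h i) = (\<Prod>j\<in>UNIV. h (\<iota> j))" by (rule prod.reindex_bij_betw[OF \<iota>, symmetric])
  finally show ?thesis by (simp add: mult.commute)
qed

lemma P_eq: "(\<Prod>i\<in>{1..N}. [:1, of_nat i:] ^ nat (e i)) = P"
  unfolding P_def prod_split e_N by (simp add: s_def)

lemma R_eq: "(\<Prod>i\<in>{1..N}. [:1, of_nat i:] ^ nat (- e i)) = R"
  unfolding R_def prod_split e_N by (simp add: t_def del: mult_pCons_right)

lemma P_neq_R: "(P :: 'k::field_char_0 poly) \<noteq> R" and dvd_P_minus_R: "[:0, 1:] ^ N dvd (P :: 'k poly) - R"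
proof -
  have "N > 0" by (simp add: N_def)
  have e: "(-1) ^ (N + 1 + i) * int (N choose i) = e i" for i by (simp only: e_def)
  note * = binomial_prod_power_diff[OF \<open>N > 0\<close>, where 'a = 'k, unfolded e P_eq R_eq]
  show "(P :: 'k poly) \<noteq> R" by (rule *(2))
  show "[:0, 1:] ^ N dvd (P :: 'k poly) - R" by (rule *(1))
qed

text \<open>
  The parameter \<open>r\<close> is read off from the quotient of the two monomials \<open>x\<^sup>s\<close> and \<open>x\<^sup>t\<close>; the coordinates
  are then determined, and inserting them back gives the equation for \<open>r\<close>.
\<close>
lemma torus_zero_on_line:
  assumes x: "x \<in> torus_zeros (F :: 'n \<Rightarrow> ('n, 'k::{alg_closed_field,field_char_0}) mpoly)"
  shows "\<exists>r. poly (P - R) r = 0 \<and> x = (\<chi> j. 1 + of_nat (\<iota> j) * r)"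
proof -
  have xn: "x $ i \<noteq> 0" for i using x by (simp add: torus_zeros_def)
  define S T where "S = (\<Prod>i\<in>UNIV. (x $ i) ^ s i)" and "T = (\<Prod>i\<in>UNIV. (x $ i) ^ t i)"
  have T: "T \<noteq> 0" unfolding T_def using xn by simp
  have N0: "(of_nat N :: 'k) \<noteq> 0" by (simp add: N_def del: of_nat_add of_nat_Suc)
  define r where "r = (S / T - 1) / of_nat N"
  have xj: "x $ j = 1 + of_nat (\<iota> j) * r" for j
  proof -
    have "T * (x $ j - 1) - of_nat (\<iota> j) / of_nat N * (S - T) = 0"
      using x subst_F[OF id_hom.scalar_hom_axioms, of "($) x" j]
      by (simp add: torus_zeros_def mpoly_eval_subst S_def T_def)
    then have eq: "T * (x $ j - 1) = of_nat (\<iota> j) / of_nat N * (S - T)" by simp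
    have "x $ j - 1 = T * (x $ j - 1) / T" using T by simp
    also have "\<dots> = of_nat (\<iota> j) / of_nat N * ((S - T) / T)" unfolding eq by simp
    also have "(S - T) / T = S / T - 1" using T by (simp add: diff_divide_distrib)
    also have "of_nat (\<iota> j) / of_nat N * (S / T - 1) = of_nat (\<iota> j) * r" by (simp add: r_def)
    finally show ?thesis by (simp add: algebra_simps)
  qed
  have "S = T * (1 + of_nat N * r)" using T N0 by (simp add: r_def field_simps)
  moreover have "poly P r = S"
    unfolding P_def S_def by (simp add: poly_prod xj mult.commute[of r])
  moreover have "poly R r = T * (1 + of_nat N * r)"
    unfolding R_def T_def poly_mult poly_prod by (simp add: xj mult.commute[of r])
  ultimately have "poly (P - R) r = 0" by simp
  moreover have "x = (\<chi> j. 1 + of_nat (\<iota> j) * r)" using xj by (simp add: vec_eq_iff)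
  ultimately show ?thesis by blast
qed

lemma finite_zeros: "finite (torus_zeros (F :: 'n \<Rightarrow> ('n, 'k::{alg_closed_field,field_char_0}) mpoly))"
proof (rule finite_subset)
  show "torus_zeros F \<subseteq> (\<lambda>r. (\<chi> j. 1 + of_nat (\<iota> j) * r) :: 'k ^ 'n::{finite,linorder}) ` {r :: 'k. poly (P - R) r = 0}"
  proof
    fix x :: "'k ^ 'n::{finite,linorder}" assume "x \<in> torus_zeros F"
    then obtain r where r: "poly (P - R) r = 0" "x = (\<chi> j. 1 + of_nat (\<iota> j) * r)" using torus_zero_on_line by blast
    show "x \<in> (\<lambda>r. (\<chi> j. 1 + of_nat (\<iota> j) * r) :: 'k ^ 'n::{finite,linorder}) ` {r :: 'k. poly (P - R) r = 0}"
      by (rule image_eqI[of _ _ r]) (simp_all only: r mem_Collect_eq)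
  qed
  have "(P - R :: 'k poly) \<noteq> 0" using P_neq_R by simp
  then show "finite ((\<lambda>r. (\<chi> j. 1 + of_nat (\<iota> j) * r) :: 'k ^ 'n::{finite,linorder}) ` {r :: 'k. poly (P - R) r = 0})"
    by (intro finite_imageI poly_roots_finite)
qed

text \<open>
  The upper bound is an instance of \<open>multiplicity_bounds\<close>. For the lower bound the curve is the line
  \<open>x\<^sub>j = 1 + \<iota> j * r\<close>, on which the equations become multiples of \<open>P - R\<close>.
\<close>
lemma multiplicity_attained:
  defines "z \<equiv> (\<chi> i. 1) :: 'k::{alg_closed_field,field_char_0} ^ 'n::{finite,linorder}"
  shows "z \<in> torus_zeros F" and "intersection_multiplicity F z = enat (CARD('n) + 1)"
proof -
  have zero: "mpoly_eval (F j) z = 0" for j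
    unfolding mpoly_eval_subst subst_F[OF id_hom.scalar_hom_axioms] by (simp add: z_def)
  then show zF: "z \<in> torus_zeros F" by (simp add: torus_zeros_def z_def)
  interpret local_zero F z by unfold_locales (rule zero)
  obtain d where d: "d \<le> CARD('n) + 1" "ring.dimension Q d K (carrier Q)"
    using multiplicity_bounds(2)[OF finite_A general_position_A support_F finite_zeros zF card_A] by (elim exE conjE)
  define \<xi> :: "'n \<Rightarrow> 'k poly" where "\<xi> = (\<lambda>j. [:1, of_nat (\<iota> j):])"
  define T where "T = (\<Prod>i\<in>UNIV. \<xi> i ^ t i)"
  have N0: "(of_nat N :: 'k) \<noteq> 0" by (simp add: N_def del: of_nat_add of_nat_Suc)
  have arc: "along_arc \<xi> (F j) = - [:of_nat (\<iota> j) / of_nat N:] * (P - R)" for j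
  proof -
    have "\<xi> j - 1 = [:0, of_nat (\<iota> j):]" unfolding \<xi>_def one_pCons diff_pCons by simp
    then have 1: "[:of_nat (\<iota> j) / of_nat N:] * [:0, of_nat N:] = \<xi> j - 1" using N0 by simp
    have 2: "[:1, of_nat N:] = 1 + [:0, of_nat N :: 'k:]" unfolding one_pCons add_pCons by simp
    have rearrange: "u * (c * w) - c * (p - u) = - c * (p - (u + u * w))" for u c w p :: "'k poly"
      by (simp add: algebra_simps)
    have "along_arc \<xi> (F j) = T * (\<xi> j - 1) - [:of_nat (\<iota> j) / of_nat N:] * (P - T)"
      unfolding subst_F[OF const_poly_hom] P_def T_def \<xi>_def ..
    also have "\<dots> = - [:of_nat (\<iota> j) / of_nat N:] * (P - (T + T * [:0, of_nat N:]))"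
      unfolding 1[symmetric] by (rule rearrange)
    also have "T + T * [:0, of_nat N:] = R"
      unfolding R_def 2 T_def \<xi>_def by (simp only: distrib_left mult_1_right)
    finally show ?thesis .
  qed
  have dvd: "[:0, 1:] ^ N dvd along_arc \<xi> (F j)" for j unfolding arc by (rule dvd_mult) (rule dvd_P_minus_R)
  obtain j :: 'n where True by blast
  define y where "y = mpoly_const (inverse (of_nat (\<iota> j))) * (mpoly_var j - 1 :: ('n, 'k) mpoly)"
  have \<iota>0: "(of_nat (\<iota> j) :: 'k) \<noteq> 0" using \<iota>_range(1)[of j] by simp
  have "along_arc \<xi> (mpoly_var j) = \<xi> j" by (rule cpoly.subst_var)
  moreover have "\<xi> j - 1 = [:0, of_nat (\<iota> j):]" unfolding \<xi>_def one_pCons diff_pCons by simp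
  then have "[:inverse (of_nat (\<iota> j)):] * (\<xi> j - 1) = [:0, 1:]" using \<iota>0 by simp
  ultimately have y: "along_arc \<xi> y = [:0, 1:]" by (simp add: y_def)
  have "N \<le> d" by (rule local_dimension_ge[OF _ dvd y d(2)]) (simp add: \<xi>_def z_def)
  then have "d = CARD('n) + 1" using d(1) by (simp add: N_def)
  then show "intersection_multiplicity F z = enat (CARD('n) + 1)" using intersection_multiplicityI[OF d(2)] by simp
qed

end

lemma circuit_attains:
  "\<exists>(A :: (int ^ 'n::{finite,linorder}) set) (F :: 'n \<Rightarrow> ('n, 'k::{alg_closed_field,field_char_0}) mpoly).
     finite A \<and> card A = CARD('n) + 2 \<and> no_hyperplane_subset A \<and>
     (\<forall>j. mpoly_support (F j) \<subseteq> A) \<and> finite (torus_zeros F) \<and>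
     (\<exists>z \<in> torus_zeros F. intersection_multiplicity F z = enat (CARD('n) + 1))"
proof -
  obtain \<iota> :: "'n \<Rightarrow> nat" where \<iota>: "bij_betw \<iota> UNIV {1..CARD('n)}"
    using finite_same_card_bij[of "UNIV :: 'n set" "{1..CARD('n)}"] by auto
  interpret circuit_example \<iota> "CARD('n) + 1" "\<lambda>i. (-1) ^ (CARD('n) + 1 + 1 + i) * int ((CARD('n) + 1) choose i)"
    "\<lambda>i. (-1) ^ i * int ((CARD('n) + 1) choose i)"
    by unfold_locales (rule \<iota>, simp_all)
  have attained: "\<exists>z\<in>torus_zeros (F :: 'n \<Rightarrow> ('n, 'k) mpoly). intersection_multiplicity F z = enat (CARD('n) + 1)"
    by (rule bexI) (rule multiplicity_attained(2), rule multiplicity_attained(1))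
  show ?thesis
    by (rule exI[of _ A], rule exI[of _ F])
      (intro conjI allI finite_A card_A general_position_A support_F finite_zeros attained)
qed

theorem theorem1p12:
  shows
    "(\<forall>(A :: (int ^ 'n::{finite,linorder}) set)
       (F :: 'n \<Rightarrow> ('n, 'k::{alg_closed_field,field_char_0}) mpoly).
        finite A \<and> card A \<le> CARD('n) + 2 \<and> no_hyperplane_subset A \<and>
        (\<forall>j. mpoly_support (F j) \<subseteq> A) \<and> finite (torus_zeros F) \<longrightarrow>
        (\<forall>z \<in> torus_zeros F.
           (card A = CARD('n) + 2 \<longrightarrow>
              intersection_multiplicity F z \<le> enat (CARD('n) + 1)) \<and>
           (card A = CARD('n) + 1 \<longrightarrow>
              intersection_multiplicity F z \<le> 1)))
     \<and> (\<exists>(A :: (int ^ 'n::{finite,linorder}) set) (F :: 'n \<Rightarrow> ('n, 'k) mpoly).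
        finite A \<and> card A = CARD('n) + 2 \<and> no_hyperplane_subset A \<and>
        (\<forall>j. mpoly_support (F j) \<subseteq> A) \<and> finite (torus_zeros F) \<and>
        (\<exists>z \<in> torus_zeros F. intersection_multiplicity F z = enat (CARD('n) + 1)))
     \<and> (\<exists>(A :: (int ^ 'n::{finite,linorder}) set) (F :: 'n \<Rightarrow> ('n, 'k) mpoly).
        finite A \<and> card A = CARD('n) + 1 \<and> no_hyperplane_subset A \<and>
        (\<forall>j. mpoly_support (F j) \<subseteq> A) \<and> finite (torus_zeros F) \<and>
        (\<exists>z \<in> torus_zeros F. intersection_multiplicity F z = 1))"
proof (intro conjI, goal_cases)
  case 1
  show ?case
  proof (intro allI impI ballI, elim conjE)
    fix A :: "(int ^ 'n::{finite,linorder}) set" and F :: "'n \<Rightarrow> ('n, 'k) mpoly" and z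
    assume A: "finite A" "no_hyperplane_subset A" and "\<forall>j. mpoly_support (F j) \<subseteq> A"
      and fin: "finite (torus_zeros F)" and z: "z \<in> torus_zeros F"
    then have supp: "mpoly_support (F j) \<subseteq> A" for j by simp
    interpret local_zero F z by unfold_locales (use z in \<open>simp add: torus_zeros_def\<close>)
    have bound: "intersection_multiplicity F z \<le> enat D" if D: "local_dimension_at_most F z D" for D
    proof -
      from D obtain d where "d \<le> D" "ring.dimension Q d K (carrier Q)" by (elim exE conjE)
      then show ?thesis using intersection_multiplicityI by simp
    qed
    show "(card A = CARD('n) + 2 \<longrightarrow> intersection_multiplicity F z \<le> enat (CARD('n) + 1)) \<and>
        (card A = CARD('n) + 1 \<longrightarrow> intersection_multiplicity F z \<le> 1)"
      unfolding one_enat_def using multiplicity_bounds[OF A supp fin z] by (intro conjI impI bound)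
  qed
next
  case 2
  show ?case by (rule circuit_attains)
next
  case 3
  show ?case by (rule simplex_example)
qed

end
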